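(* Let $W$ be a Coxeter group whose Coxeter graph is a simply laced tree (a tree all of whose edge labels are $3$). If $W$ is finite, then it is futuristic; otherwise, it is ancient.
   Context: Let $(W,S)$ be a Coxeter system with $S=\{s_i:i\in I\}$, $I$ a finite index set; $m(i,i')$ is the order of $s_is_{i'}$. The Coxeter graph has vertex set $I$, with distinct $i,i'$ joined by an edge labeled $m(i,i')$ whenever $m(i,i')\ge 3$. The root space is $V=\mathbb R^I$ with standard basis the simple roots $\{\alpha_i:i\in I\}$ and symmetric bilinear form $B(\alpha_i,\alpha_{i'})=-\cos(\pi/m(i,i'))$ (and $-1$ if $m(i,i')=\infty$). $W$ acts on $V$ by $s_i\beta=\beta-2B(\beta,\alpha_i)\alpha_i$. The root system is $\Phi=\{w\alpha_i:w\in W,i\in I\}=\Phi^+\sqcup\Phi^-$, where $\Phi^+$ are the roots that are nonnegative combinations of simple roots and $\Phi^-=-\Phi^+$. For $\beta\in\Phi$ the half-space $H_\beta^+$ is $\{w\in W:w\beta\in\Phi^+\}$. A subset of $W$ is convex if it is an intersection of half-spaces (the empty intersection being $W$). For a nonempty convex set $\mathscr L\subseteq W$ let $\mathrm R(\mathscr L)=\{\beta\in\Phi:\mathscr L\subseteq H_\beta^+\}$. For $i\in I$, the toggle $\tau_i\colon W\to W$ is defined by $\tau_i(u)=u$ if $u^{-1}\alpha_i\in\mathrm R(\mathscr L)$ and $\tau_i(u)=s_iu$ otherwise. A Coxeter element is a product $c=s_{i_n}\cdots s_{i_1}$ where $i_1,\ldots,i_n$ is an ordering of $I$ (each element once); $\mathrm{Pro}_c=\tau_{i_n}\cdots\tau_{i_1}$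 (composition), which depends only on $c$ and $\mathscr L$. The set $\mathscr L$ is heavy with respect to $c$ if every periodic point of $\mathrm{Pro}_c$ (i.e. every $u\in W$ with $\mathrm{Pro}_c^K(u)=u$ for some $K\ge 1$) lies in $\mathscr L$. A Coxeter element $c$ is futuristic if every nonempty convex $\mathscr L\subseteq W$ is heavy with respect to $c$. The Coxeter group $W$ is futuristic if all its Coxeter elements are futuristic, and ancient if none of them is. *)

theory Defs
  imports "HOL-Analysis.Analysis" "HOL-Algebra.Multiplicative_Group" "HOL-Algebra.Generated_Groups"
begin

section \<open>Trees\<close>

text \<open>
  A simple graph on the vertex set \<^term>\<open>UNIV\<close> is given by its adjacency relation, which is
  symmetric and irreflexive. A cycle is a list of at least three distinct vertices in which
  consecutive vertices, as well as the last and the first, are adjacent. (The notion of tree in the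
  Graph-Theory entry is for digraphs, where an edge traversed back and forth counts as a cycle.)
\<close>

definition simple_graph :: "('i \<Rightarrow> 'i \<Rightarrow> bool) \<Rightarrow> bool" where
  "simple_graph E \<longleftrightarrow> symp E \<and> irreflp E"

definition graph_connected :: "('i \<Rightarrow> 'i \<Rightarrow> bool) \<Rightarrow> bool" where
  "graph_connected E \<longleftrightarrow> (\<forall>i j. E\<^sup>*\<^sup>* i j)"

definition graph_cycle :: "('i \<Rightarrow> 'i \<Rightarrow> bool) \<Rightarrow> 'i list \<Rightarrow> bool" where
  "graph_cycle E p \<longleftrightarrow> 3 \<le> length p \<and> distinct p \<and> successively E p \<and> E (last p) (hd p)"

definition is_tree :: "('i \<Rightarrow> 'i \<Rightarrow> bool) \<Rightarrow> bool" where
  "is_tree E \<longleftrightarrow> simple_graph E \<and> graph_connected E \<and> (\<nexists>p. graph_cycle E p)"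


section \<open>Coxeter systems\<close>

text \<open>
  The congruence on words generated by the Coxeter relations; the value \<open>m i j = 0\<close> encodes
  \<open>m i j = \<infinity>\<close>, i.e. the absence of a relation.
\<close>

inductive coxeter_equiv :: "('i \<Rightarrow> 'i \<Rightarrow> nat) \<Rightarrow> 'i list \<Rightarrow> 'i list \<Rightarrow> bool"
  for m :: "'i \<Rightarrow> 'i \<Rightarrow> nat" where
  refl: "coxeter_equiv m u u"
| sym: "coxeter_equiv m u v \<Longrightarrow> coxeter_equiv m v u"
| trans: "coxeter_equiv m u v \<Longrightarrow> coxeter_equiv m v w \<Longrightarrow> coxeter_equiv m u w"
| relation: "m i j \<noteq> 0 \<Longrightarrow> coxeter_equiv m (u @ concat (replicate (m i j) [i, j]) @ v) (u @ v)"

text \<open>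
  \<open>W\<close> is generated by the involutions \<open>s i\<close> and is presented by the relations
  \<open>(s i \<otimes> s j) ^ m i j = \<one>\<close>, where \<open>m i j\<close> is the order of \<open>s i \<otimes> s j\<close> (and there is no relation if
  this order is infinite; \<open>group.ord\<close> is then \<open>0\<close>). Since \<open>m i i = 1\<close>, a presentation as a monoid is
  the same as a presentation as a group.
\<close>

locale coxeter_system = group W for W :: "('w, 'b) monoid_scheme" (structure) +
  fixes s :: "'i::finite \<Rightarrow> 'w"
  assumes s_closed: "s i \<in> carrier W"
    and s_inj: "inj s"
    and s_order: "ord (s i) = 2"
    and s_generate: "generate W (range s) = carrier W"
    and presentation:
      "foldr (\<lambda>i w. s i \<otimes> w) p \<one> = foldr (\<lambda>i w. s i \<otimes> w) q \<one> \<Longrightarrow>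
       coxeter_equiv (\<lambda>i j. ord (s i \<otimes> s j)) p q"
begin

definition m :: "'i \<Rightarrow> 'i \<Rightarrow> nat" where
  "m i j = ord (s i \<otimes> s j)"

definition word :: "'i list \<Rightarrow> 'w" where
  "word p = foldr (\<lambda>i w. s i \<otimes> w) p \<one>"

text \<open>The disjunct \<open>m i j = 0\<close> stands for the edges labeled \<open>\<infinity>\<close>.\<close>

definition adj :: "'i \<Rightarrow> 'i \<Rightarrow> bool" where
  "adj i j \<longleftrightarrow> i \<noteq> j \<and> (m i j \<ge> 3 \<or> m i j = 0)"

definition simply_laced :: bool where
  "simply_laced \<longleftrightarrow> (\<forall>i j. adj i j \<longrightarrow> m i j = 3)"


subsection \<open>The root space and the root system\<close>

definition simple_root :: "'i \<Rightarrow> real ^ 'i" where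
  "simple_root i = axis i 1"

definition B :: "real ^ 'i \<Rightarrow> real ^ 'i \<Rightarrow> real" where
  "B x y = (\<Sum>i\<in>UNIV. \<Sum>j\<in>UNIV. x $ i * y $ j * (if m i j = 0 then - 1 else - cos (pi / real (m i j))))"

definition reflection :: "'i \<Rightarrow> real ^ 'i \<Rightarrow> real ^ 'i" where
  "reflection i v = v - (2 * B v (simple_root i)) *\<^sub>R simple_root i"

text \<open>
  The action of \<open>w\<close> is the composition of the reflections along any word for \<open>w\<close>. It does not depend
  on the word; see \<open>act_word\<close>, \<open>act_s\<close>, \<open>act_one\<close> and \<open>act_mult\<close> below.
\<close>

definition act :: "'w \<Rightarrow> real ^ 'i \<Rightarrow> real ^ 'i" where
  "act w v = foldr reflection (SOME p. word p = w) v"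

definition roots :: "(real ^ 'i) set" where
  "roots = {act w (simple_root i) | w i. w \<in> carrier W}"

definition positive_roots :: "(real ^ 'i) set" where
  "positive_roots = {\<beta> \<in> roots. \<forall>i. 0 \<le> \<beta> $ i}"


subsection \<open>Convex sets, toggles and promotion\<close>

definition half_space :: "real ^ 'i \<Rightarrow> 'w set" where
  "half_space \<beta> = {w \<in> carrier W. act w \<beta> \<in> positive_roots}"

definition convex_subset :: "'w set \<Rightarrow> bool" where
  "convex_subset L \<longleftrightarrow> (\<exists>A \<subseteq> roots. L = carrier W \<inter> (\<Inter>\<beta>\<in>A. half_space \<beta>))"

definition R :: "'w set \<Rightarrow> (real ^ 'i) set" where
  "R L = {\<beta> \<in> roots. L \<subseteq> half_space \<beta>}"

definition toggle :: "'w set \<Rightarrow> 'i \<Rightarrow> 'w \<Rightarrow> 'w" where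
  "toggle L i u = (if act (inv u) (simple_root i) \<in> R L then u else s i \<otimes> u)"

text \<open>
  A list \<open>p = [i\<^sub>1, \<dots>, i\<^sub>n]\<close> enumerating the index set gives the Coxeter element
  \<open>s i\<^sub>n \<otimes> \<dots> \<otimes> s i\<^sub>1\<close>; the toggles are applied in the order \<open>i\<^sub>1, \<dots>, i\<^sub>n\<close>.
\<close>

definition ordering_of :: "'i list \<Rightarrow> 'w \<Rightarrow> bool" where
  "ordering_of p c \<longleftrightarrow> distinct p \<and> set p = UNIV \<and> word (rev p) = c"

definition coxeter_element :: "'w \<Rightarrow> bool" where
  "coxeter_element c \<longleftrightarrow> (\<exists>p. ordering_of p c)"

text \<open>
  All orderings giving the same Coxeter element differ by swaps of adjacent commuting indices and
  hence give the same composition of toggles, so that the choice is immaterial.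
\<close>

definition promotion :: "'w set \<Rightarrow> 'w \<Rightarrow> 'w \<Rightarrow> 'w" where
  "promotion L c = fold (toggle L) (SOME p. ordering_of p c)"

definition periodic_point :: "('w \<Rightarrow> 'w) \<Rightarrow> 'w \<Rightarrow> bool" where
  "periodic_point f u \<longleftrightarrow> u \<in> carrier W \<and> (\<exists>K\<ge>1. (f ^^ K) u = u)"

definition heavy :: "'w set \<Rightarrow> 'w \<Rightarrow> bool" where
  "heavy L c \<longleftrightarrow> (\<forall>u. periodic_point (promotion L c) u \<longrightarrow> u \<in> L)"

definition futuristic_element :: "'w \<Rightarrow> bool" where
  "futuristic_element c \<longleftrightarrow> (\<forall>L. convex_subset L \<and> L \<noteq> {} \<longrightarrow> heavy L c)"

definition futuristic :: bool where
  "futuristic \<longleftrightarrow> (\<forall>c. coxeter_element c \<longrightarrow> futuristic_element c)"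

definition ancient :: bool where
  "ancient \<longleftrightarrow> (\<forall>c. coxeter_element c \<longrightarrow> \<not> futuristic_element c)"


subsection \<open>The action is well defined\<close>

lemma word_Nil [simp]: "word [] = \<one>"
  and word_Cons [simp]: "word (i # p) = s i \<otimes> word p"
  by (simp_all add: word_def)

lemma word_closed [simp]: "word p \<in> carrier W"
  by (induction p) (auto simp: s_closed)

lemma word_append: "word (p @ q) = word p \<otimes> word q"
  by (induction p) (auto simp: s_closed m_assoc)

lemma s_square: "s i \<otimes> s i = \<one>"
  using pow_ord_eq_1[OF s_closed[of i]] by (simp add: s_order s_closed numeral_2_eq_2)

lemma inv_s: "inv (s i) = s i"
  using s_square s_closed inv_equality by blast

lemma word_surj: "w \<in> carrier W \<Longrightarrow> \<exists>p. word p = w"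
proof -
  assume "w \<in> carrier W"
  then have "w \<in> generate W (range s)"
    by (simp add: s_generate)
  then show ?thesis
  proof induction
    case one
    then show ?case by (metis word_Nil)
  next
    case (incl h)
    then obtain i where "h = s i" by auto
    then have "word [i] = h" by (simp add: s_closed)
    then show ?case by blast
  next
    case (inv h)
    then obtain i where "h = s i" by auto
    then have "word [i] = inv h" by (simp add: s_closed inv_s)
    then show ?case by blast
  next
    case (eng h1 h2)
    then show ?case by (metis word_append)
  qed
qed

lemma m_self: "m i i = 1"
  by (simp add: m_def s_square)

lemma m_ge_2:
  assumes "i \<noteq> j" "m i j \<noteq> 0"
  shows "m i j \<ge> 2"
proof -
  have "m i j \<noteq> 1"
  proof
    assume "m i j = 1"
    then have "s i \<otimes> s j = \<one>"
      by (metis m_def s_closed m_closed ord_eq_1)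
    then have "s i = s j"
      by (metis inv_s inv_equality s_closed)
    then show False using s_inj assms(1) by (auto dest: injD)
  qed
  then show ?thesis using assms(2) by linarith
qed

lemma m_sym: "m i j = m j i"
proof -
  have "inv (s i \<otimes> s j) = s j \<otimes> s i"
    by (simp add: inv_mult_group s_closed inv_s)
  then show ?thesis
    by (metis m_def m_closed ord_inv s_closed)
qed

lemma B_add: "B (x + y) z = B x z + B y z"
  by (simp add: B_def algebra_simps sum.distrib)

lemma B_scale: "B (a *\<^sub>R x) z = a * B x z"
  by (simp add: B_def sum_distrib_left mult.assoc)

lemma B_diff: "B (x - y) z = B x z - B y z"
  by (simp add: B_def algebra_simps sum_subtractf)

lemma B_simple_root:
  "B (simple_root i) (simple_root j) = (if m i j = 0 then - 1 else - cos (pi / real (m i j)))"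
proof -
  define f where "f k l = (if m k l = 0 then - 1 else - cos (pi / real (m k l)))" for k l
  have "B (simple_root i) (simple_root j)
      = (\<Sum>k\<in>UNIV. \<Sum>l\<in>UNIV. if l = j then (if k = i then f k l else 0) else 0)"
    unfolding B_def simple_root_def f_def[symmetric] by (intro sum.cong) (auto simp: axis_def)
  then show ?thesis by (simp add: f_def)
qed

lemma reflection_reflection: "reflection i (reflection i v) = v"
  by (simp add: reflection_def B_diff B_scale B_simple_root m_self algebra_simps)

lemma braid_reflection:
  assumes "m i j \<noteq> 0"
  shows "((reflection i \<circ> reflection j) ^^ (m i j)) v = v"
proof (cases "i = j")
  case True
  then show ?thesis by (simp add: m_self reflection_reflection)
next
  case False
  define \<theta> where "\<theta> = pi / real (m i j)"
  have m2: "m i j \<ge> 2" using m_ge_2 False assms by blast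
  have \<theta>: "0 < \<theta>" "\<theta> < pi" "real (m i j) * \<theta> = pi"
    using m2 by (auto simp: \<theta>_def field_simps)
  then have S: "sin \<theta> > 0" by (simp add: sin_gt_zero)
  define T where "T = reflection i \<circ> reflection j"
  let ?a = "simple_root i" and ?b = "simple_root j"
  have Bs: "B ?a ?a = 1" "B ?b ?b = 1" "B ?a ?b = - cos \<theta>" "B ?b ?a = - cos \<theta>"
    using assms m_sym[of j i] by (auto simp: B_simple_root m_self \<theta>_def)
  have step: "B (T u) ?a = - B u ?a - 2 * cos \<theta> * B u ?b"
      "B (T u) ?b = - B u ?b - 2 * cos \<theta> * B (T u) ?a" for u
    by (simp_all add: T_def reflection_def B_diff B_scale Bs) (simp_all add: algebra_simps)
  have sin_step: "sin (x + \<theta>) = 2 * cos \<theta> * sin x - sin (x - \<theta>)" for x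
    by (simp add: sin_add sin_diff)
  have closed: "sin \<theta> * B ((T ^^ k) v) ?a
        = - sin (2 * real k * \<theta> - \<theta>) * B v ?a - sin (2 * real k * \<theta>) * B v ?b \<and>
      sin \<theta> * B ((T ^^ k) v) ?b
        = sin (2 * real k * \<theta>) * B v ?a + sin (2 * real k * \<theta> + \<theta>) * B v ?b" for k
  proof (induction k)
    case 0
    then show ?case by simp
  next
    case (Suc k)
    let ?x = "2 * real k * \<theta>"
    have e: "2 * real (Suc k) * \<theta> = ?x + \<theta> + \<theta>"
      by (simp add: algebra_simps)
    note a1 = sin_step[of ?x] and a2 = sin_step[of "?x + \<theta>"] and a3 = sin_step[of "?x + \<theta> + \<theta>"]
    have 1: "sin \<theta> * B ((T ^^ Suc k) v) ?a = - sin (?x + \<theta>) * B v ?a - sin (?x + \<theta> + \<theta>) * B v ?b"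
    proof -
      have "sin \<theta> * B ((T ^^ Suc k) v) ?a
          = - (sin \<theta> * B ((T ^^ k) v) ?a) - 2 * cos \<theta> * (sin \<theta> * B ((T ^^ k) v) ?b)"
        by (simp add: step(1) algebra_simps)
      also have "\<dots> = - (2 * cos \<theta> * sin ?x - sin (?x - \<theta>)) * B v ?a
          - (2 * cos \<theta> * sin (?x + \<theta>) - sin (?x + \<theta> - \<theta>)) * B v ?b"
        using Suc by (simp add: algebra_simps)
      finally show ?thesis by (simp only: a1 a2)
    qed
    have "sin \<theta> * B ((T ^^ Suc k) v) ?b
        = - (sin \<theta> * B ((T ^^ k) v) ?b) - 2 * cos \<theta> * (sin \<theta> * B ((T ^^ Suc k) v) ?a)"
      unfolding funpow.simps(2) comp_apply by (subst step(2)) (simp add: right_diff_distrib)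
    also have "\<dots> = (2 * cos \<theta> * sin (?x + \<theta>) - sin (?x + \<theta> - \<theta>)) * B v ?a
        + (2 * cos \<theta> * sin (?x + \<theta> + \<theta>) - sin (?x + \<theta> + \<theta> - \<theta>)) * B v ?b"
      unfolding 1 using Suc by (simp add: algebra_simps)
    finally have 2: "sin \<theta> * B ((T ^^ Suc k) v) ?b
        = sin (?x + \<theta> + \<theta>) * B v ?a + sin (?x + \<theta> + \<theta> + \<theta>) * B v ?b"
      by (simp only: a2 a3)
    show ?case unfolding e add_diff_cancel_right' using 1 2 by blast
  qed
  have span: "\<exists>p q. (T ^^ k) v = v + p *\<^sub>R ?a + q *\<^sub>R ?b" for k
  proof (induction k)
    case 0
    have "(T ^^ 0) v = v + 0 *\<^sub>R ?a + 0 *\<^sub>R ?b" by simp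
    then show ?case by blast
  next
    case (Suc k)
    then obtain p q where "(T ^^ k) v = v + p *\<^sub>R ?a + q *\<^sub>R ?b" by blast
    moreover have "\<exists>x y. T u = u + x *\<^sub>R ?a + y *\<^sub>R ?b" for u
    proof -
      have "T u = u + (- 2 * B (reflection j u) ?a) *\<^sub>R ?a + (- 2 * B u ?b) *\<^sub>R ?b"
        unfolding T_def comp_def by (subst reflection_def) (simp add: reflection_def[of j u])
      then show ?thesis by blast
    qed
    ultimately obtain x y where
      "(T ^^ Suc k) v = v + p *\<^sub>R ?a + q *\<^sub>R ?b + x *\<^sub>R ?a + y *\<^sub>R ?b"
      by (metis comp_apply funpow.simps(2))
    then have "(T ^^ Suc k) v = v + (p + x) *\<^sub>R ?a + (q + y) *\<^sub>R ?b"
      by (simp add: algebra_simps)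
    then show ?case by blast
  qed
  obtain p q where pq: "(T ^^ m i j) v = v + p *\<^sub>R ?a + q *\<^sub>R ?b"
    using span by blast
  have 2: "2 * real (m i j) * \<theta> = 2 * pi" using \<theta>(3) by simp
  have "B ((T ^^ m i j) v) ?a = B v ?a" "B ((T ^^ m i j) v) ?b = B v ?b"
    using closed[of "m i j"] S unfolding 2 by (auto simp: sin_diff sin_add)
  then have rel: "p = q * cos \<theta>" "q = p * cos \<theta>"
    unfolding pq by (simp_all add: B_add B_scale Bs)
  have "p * (1 - (cos \<theta>)\<^sup>2) = p - (p * cos \<theta>) * cos \<theta>"
      "q * (1 - (cos \<theta>)\<^sup>2) = q - (q * cos \<theta>) * cos \<theta>"
    by (simp_all add: right_diff_distrib power2_eq_square)
  then have "p * (1 - (cos \<theta>)\<^sup>2) = 0" "q * (1 - (cos \<theta>)\<^sup>2) = 0"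
    by (simp_all flip: rel)
  moreover have "1 - (cos \<theta>)\<^sup>2 \<noteq> 0"
    using S by (simp flip: sin_squared_eq)
  ultimately have "p = 0" "q = 0" by simp_all
  then show ?thesis using pq by (simp add: T_def)
qed

lemma foldr_reflection_replicate:
  "foldr reflection (concat (replicate k [i, j])) v = ((reflection i \<circ> reflection j) ^^ k) v"
  by (induction k) auto

lemma coxeter_equiv_reflection:
  "coxeter_equiv m p q \<Longrightarrow> foldr reflection p v = foldr reflection q v"
proof (induction arbitrary: v rule: coxeter_equiv.induct)
  case (relation i j p q)
  then show ?case by (simp add: foldr_reflection_replicate braid_reflection)
qed auto

lemma word_eq_iff: "word p = word q \<longleftrightarrow> coxeter_equiv m p q"
proof
  assume "word p = word q"
  then show "coxeter_equiv m p q"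
    using presentation[of p q] by (simp add: word_def m_def[abs_def])
next
  assume "coxeter_equiv m p q"
  then show "word p = word q"
  proof induction
    case (relation i j p q)
    have "word (concat (replicate k [i, j])) = (s i \<otimes> s j) [^] k" for k
    proof (induction k)
      case (Suc k)
      then show ?case
        using nat_pow_Suc2[of "s i \<otimes> s j" k] by (simp add: s_closed m_assoc del: nat_pow_Suc)
    qed simp
    then have "word (concat (replicate (m i j) [i, j])) = \<one>"
      by (simp add: m_def s_closed)
    then show ?case by (simp add: word_append)
  qed auto
qed

lemma act_word: "act (word p) v = foldr reflection p v"
proof -
  have "word (SOME q. word q = word p) = word p" by (rule someI) simp
  then show ?thesis
    unfolding act_def by (simp add: word_eq_iff coxeter_equiv_reflection)
qed

lemma act_s: "act (s i) v = v - (2 * B v (simple_root i)) *\<^sub>R simple_root i"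
  using act_word[of "[i]" v] by (simp add: s_closed reflection_def)

lemma act_one: "act \<one> v = v"
  using act_word[of "[]" v] by simp

lemma act_mult:
  assumes "x \<in> carrier W" "y \<in> carrier W"
  shows "act (x \<otimes> y) v = act x (act y v)"
proof -
  obtain p q where "word p = x" "word q = y" using word_surj assms by metis
  then show ?thesis using act_word[of "p @ q" v] act_word[of p] act_word[of q]
    by (auto simp: word_append)
qed

end

end

theory Submission
  imports Defs
begin

text \<open>
  On a tree, any two Coxeter elements are related by source-to-sink moves, and these preserve
  heaviness; so the order in which the toggles are applied can be chosen freely.

  If \<open>W\<close> is finite, take a bipartite order. Let \<open>u\<close> be a periodic point outside \<open>L\<close>. The roots \<open>\<beta>\<close>
  with \<open>L\<close> in \<open>H\<^sub>\<beta>\<^sup>+\<close> but \<open>u\<close> outside of it do not change along the orbit. The coordinates of the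
  sum of the positive roots form a strictly superharmonic function on the tree; multiplied by the
  solution of a recurrence \<open>z (j + 2) = (2 - \<epsilon>) z (j + 1) - z j\<close>, it gives a functional that
  stays positive on \<open>- u \<beta>\<close> for some such \<open>\<beta>\<close>, although the functional becomes nonpositive on all
  positive roots.

  If \<open>W\<close> is infinite, its tree contains an affine diagram \<open>\<tilde>D\<close>, \<open>\<tilde>E\<^sub>6\<close>, \<open>\<tilde>E\<^sub>7\<close> or \<open>\<tilde>E\<^sub>8\<close>.
  The set \<open>L\<close> is the convex hull of two elements \<open>w\<^sub>1, w\<^sub>2\<close> of the affine parabolic subgroup, so that
  a wall is crossed exactly if it separates \<open>w\<^sub>1\<close> from \<open>w\<^sub>2\<close>. They are chosen such that the orbit of
  the identity runs through the powers of a Coxeter element of a finite parabolic subgroup, while a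
  root separates the identity from both of them.
\<close>

section \<open>Trees\<close>

text \<open>A toggle never leaves a half-space that contains \<open>L\<close>, so the set of roots
  separating the moving point from \<open>L\<close> can only shrink; on a periodic orbit it is
  therefore constant. In the finite case strictness is decisive. A positive superharmonic function
  on an affine diagram is always harmonic, which would mean \<epsilon> = 0, and then the recurrence
  with the same starting values runs through 1, 3, 5, ... and never becomes nonpositive. In the
  infinite case a single element as \<open>L\<close> would not do: every move would cross a wall
  between the point and that element, so the number of such walls would drop until the orbit ends
  there. A wall between two elements of \<open>L\<close>, however, may be crossed back and forth.
  Both elements are given by functionals that are positive on the null vector of the affine diagram.
  Such a functional is negative on only finitely many positive roots of the parabolic subgroup, so
  an element sorts it into the dominant chamber. What remains of the counterexample is a finite
  number of sign checks on vectors of values at the vertices.\<close>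

locale tree_graph =
  fixes E :: "'i::finite \<Rightarrow> 'i \<Rightarrow> bool"
  assumes tree: "is_tree E"
begin

lemma E_sym: "E i j \<longleftrightarrow> E j i"
  using tree by (auto simp: is_tree_def simple_graph_def symp_def)

lemma E_irrefl [simp]: "\<not> E i i"
  using tree by (auto simp: is_tree_def simple_graph_def irreflp_def)

definition simple_path :: "'i list \<Rightarrow> bool" where
  "simple_path p \<longleftrightarrow> p \<noteq> [] \<and> distinct p \<and> successively E p"

lemma simple_path_rev [simp]: "simple_path (rev p) \<longleftrightarrow> simple_path p"
proof -
  have "(\<lambda>x y. E y x) = E" using E_sym by blast
  then have "successively (\<lambda>x y. E y x) p = successively E p" by (rule arg_cong)
  then show ?thesis by (simp add: simple_path_def successively_rev)
qed

lemma simple_path_infix: "simple_path (x @ y @ z) \<Longrightarrow> y \<noteq> [] \<Longrightarrow> simple_path y"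
  by (auto simp: simple_path_def successively_append_iff)

lemma simple_path_nth: "simple_path p \<Longrightarrow> Suc i < length p \<Longrightarrow> E (p ! i) (p ! Suc i)"
  by (auto simp: simple_path_def successively_conv_nth)

text \<open>A chord would close the stretch of the path between its ends to a cycle.\<close>

lemma no_chord:
  assumes p: "simple_path p" and ij: "i < j" "j < length p" and e: "E (p ! i) (p ! j)"
  shows "j = Suc i"
proof (rule ccontr)
  assume n: "j \<noteq> Suc i"
  define q where "q = take (Suc j - i) (drop i p)"
  have len: "length q = Suc j - i" using ij by (simp add: q_def)
  then have ne: "q \<noteq> []" using ij by auto
  have "p = take i p @ q @ drop (Suc j - i) (drop i p)"
    by (simp add: q_def del: drop_drop)
  then have q: "simple_path q" using simple_path_infix p ne by metis
  have "hd q = p ! i" "last q = p ! j"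
    using ij len ne by (simp_all add: hd_conv_nth last_conv_nth) (simp_all add: q_def)
  then have "graph_cycle E q"
    using q len n ij e by (auto simp: graph_cycle_def simple_path_def E_sym)
  then show False using tree by (auto simp: is_tree_def)
qed

lemma adjacent_on_path:
  assumes "simple_path p" "i < length p" "j < length p"
  shows "E (p ! i) (p ! j) \<longleftrightarrow> j = Suc i \<or> i = Suc j"
  using assms no_chord[of p i j] no_chord[of p j i] simple_path_nth[of p i] simple_path_nth[of p j]
    E_sym[of "p ! i" "p ! j"]
  by (metis E_irrefl nat_neq_iff)

lemma simple_path_length: "simple_path p \<Longrightarrow> length p \<le> CARD('i)"
  by (metis simple_path_def distinct_card card_mono finite subset_UNIV)

lemma ex_longest_path:
  assumes "simple_path p" "Q p"
  obtains q where "simple_path q" "Q q" "\<And>r. simple_path r \<Longrightarrow> Q r \<Longrightarrow> length r \<le> length q"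
proof -
  have "\<exists>q. (simple_path q \<and> Q q) \<and> (\<forall>r. simple_path r \<and> Q r \<longrightarrow> length r \<le> length q)"
    by (rule ex_has_greatest_nat[where b = "Suc CARD('i)"])
      (use assms simple_path_length in \<open>auto simp: less_Suc_eq_le\<close>)
  then show ?thesis using that by blast
qed

text \<open>The first vertex of a longest path inside \<open>A\<close> qualifies: a neighbour off
  the path would prolong it, and a neighbour beyond the second vertex would give a chord. If
  \<open>l\<close> is isolated in \<open>A\<close>, then \<open>n\<close> carries no
  information.\<close>

lemma ex_leaf:
  assumes "A \<noteq> {}"
  obtains l n where "l \<in> A" "\<And>x. x \<in> A \<Longrightarrow> E l x \<Longrightarrow> x = n"
proof -
  obtain a where "a \<in> A" using assms by blast
  then have "simple_path [a]" "set [a] \<subseteq> A" by (auto simp: simple_path_def)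
  then obtain p where p: "simple_path p" "set p \<subseteq> A"
      "\<And>r. simple_path r \<Longrightarrow> set r \<subseteq> A \<Longrightarrow> length r \<le> length p"
    using ex_longest_path[where p = "[a]" and Q = "\<lambda>p. set p \<subseteq> A"] by blast
  have ne: "p \<noteq> []" using p(1) by (simp add: simple_path_def)
  have "x = p ! 1" if x: "x \<in> A" "E (hd p) x" for x
  proof -
    have "x \<in> set p"
    proof (rule ccontr)
      assume "x \<notin> set p"
      then have "simple_path (x # p)"
        using p(1) x(2) by (cases p) (auto simp: simple_path_def E_sym)
      then show False using p(2) p(3)[of "x # p"] x(1) by auto
    qed
    then obtain j where j: "j < length p" "x = p ! j" by (auto simp: in_set_conv_nth)
    then show ?thesis
      using adjacent_on_path[OF p(1), of 0 j] x(2) ne by (simp add: hd_conv_nth)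
  qed
  moreover have "hd p \<in> A" using ne p(2) by auto
  ultimately show ?thesis using that[of "hd p" "p ! 1"] by blast
qed

text \<open>An isolated \<open>l\<close> also receives some \<open>n\<close> in \<open>A\<close>,
  because the comparison of orderings needs a vertex to which \<open>l\<close> can be glued.\<close>

lemma forest_induct [case_names empty insert]:
  assumes "P {}"
    and step: "\<And>A l n. l \<notin> A \<Longrightarrow> A = {} \<or> n \<in> A \<Longrightarrow> (\<And>x. x \<in> A \<Longrightarrow> E l x \<Longrightarrow> x = n) \<Longrightarrow> P A \<Longrightarrow>
      P (insert l A)"
  shows "P A"
proof -
  have "finite A" by simp
  then show ?thesis
  proof (induction A rule: finite_psubset_induct)
    case (psubset A)
    show ?case
    proof (cases "A = {}")
      case True
      then show ?thesis using assms(1) by simp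
    next
      case False
      then obtain l n where l: "l \<in> A" "\<And>x. x \<in> A \<Longrightarrow> E l x \<Longrightarrow> x = n"
        using ex_leaf by metis
      have P: "P (A - {l})" using psubset(2)[of "A - {l}"] l(1) by blast
      have "\<exists>n. (A - {l} = {} \<or> n \<in> A - {l}) \<and> (\<forall>x\<in>A - {l}. E l x \<longrightarrow> x = n)"
        using l by (cases "n \<in> A - {l}") blast+
      then obtain n' where "A - {l} = {} \<or> n' \<in> A - {l}" "\<And>x. x \<in> A - {l} \<Longrightarrow> E l x \<Longrightarrow> x = n'"
        by blast
      then have "P (insert l (A - {l}))" by (intro step[OF _ _ _ P]) auto
      then show ?thesis using l(1) by (simp add: insert_absorb)
    qed
  qed
qed

lemma ex_colouring: "\<exists>col :: 'i \<Rightarrow> bool. \<forall>i j. E i j \<longrightarrow> col i \<noteq> col j"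
proof -
  have "\<exists>col :: 'i \<Rightarrow> bool. \<forall>i\<in>A. \<forall>j\<in>A. E i j \<longrightarrow> col i \<noteq> col j" for A
  proof (induction A rule: forest_induct)
    case empty
    then show ?case by simp
  next
    case (insert A l n)
    from insert(4) obtain col :: "'i \<Rightarrow> bool"
      where col: "\<forall>i\<in>A. \<forall>j\<in>A. E i j \<longrightarrow> col i \<noteq> col j" by (elim exE)
    have "\<forall>i\<in>insert l A. \<forall>j\<in>insert l A. E i j \<longrightarrow> (col(l := \<not> col n)) i \<noteq> (col(l := \<not> col n)) j"
      using col insert(1,3) by (metis E_irrefl E_sym fun_upd_apply insertE)
    then show ?case by (rule exI[of _ "col(l := \<not> col n)"])
  qed
  from this[of UNIV] show ?thesis by simp
qed

text \<open>Two branches at \<open>v\<close> with different first vertices cannot meet again: the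
  first vertex of \<open>q\<close> that lies on \<open>p\<close> would close a cycle through
  \<open>v\<close>.\<close>

lemma simple_path_join:
  assumes p: "simple_path (v # p)" and q: "simple_path (v # q)"
    and ne: "p \<noteq> []" "q \<noteq> []" "hd p \<noteq> hd q"
  shows "simple_path (rev p @ v # q)"
proof -
  have "set p \<inter> set q = {}"
  proof (rule ccontr)
    assume "set p \<inter> set q \<noteq> {}"
    then have ex: "\<exists>k. k < length q \<and> q ! k \<in> set p" by (metis disjoint_iff in_set_conv_nth)
    define k where "k = (LEAST k. k < length q \<and> q ! k \<in> set p)"
    have k: "k < length q" "q ! k \<in> set p" using LeastI_ex[OF ex] by (auto simp: k_def)
    have min: "q ! k' \<notin> set p" if "k' < k" for k'
      using not_less_Least[of k' "\<lambda>k. k < length q \<and> q ! k \<in> set p"] that k by (auto simp: k_def)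
    obtain j where j: "j < length p" "p ! j = q ! k" using k by (auto simp: in_set_conv_nth)
    \<comment> \<open>From \<open>v\<close> along \<open>p\<close> to the meeting vertex
      \<open>p ! j = q ! k\<close>, then back along \<open>q\<close>; the meeting vertex is taken
      from \<open>p\<close> only. The list ends in \<open>q ! 0\<close> even if
      \<open>k = 0\<close>, and it has at least three vertices because different first vertices
      exclude \<open>j = k = 0\<close>.\<close>
    define C where "C = (v # take (Suc j) p) @ rev (take k q)"
    have s1: "simple_path (v # take (Suc j) p)"
      using simple_path_infix[of "[]" "v # take (Suc j) p" "drop (Suc j) p"] p by simp
    have s2: "successively E (rev (take k q))"
    proof (cases "k = 0")
      case False
      have "simple_path (take k q)"
        using simple_path_infix[of "[v]" "take k q" "drop k q"] q False k ne(2) by auto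
      then have "simple_path (rev (take k q))" by simp
      then show ?thesis unfolding simple_path_def by blast
    qed simp
    have s3: "k \<noteq> 0 \<Longrightarrow> E (last (v # take (Suc j) p)) (hd (rev (take k q)))"
    proof -
      assume "k \<noteq> 0"
      moreover have "last (take (Suc j) p) = q ! k"
        using j by (simp add: take_Suc_conv_app_nth)
      moreover have "last (take k q) = q ! (k - 1)"
        using \<open>k \<noteq> 0\<close> k ne(2) by (simp add: last_conv_nth min_def)
      moreover have "E (q ! k) (q ! (k - 1))"
        using simple_path_nth[OF q, of k] \<open>k \<noteq> 0\<close> k by (cases k) (auto simp: E_sym)
      ultimately show ?thesis using j ne(1) by (simp add: hd_rev)
    qed
    have "successively E C"
      unfolding C_def using s1 s2 s3
      by (cases "k = 0") (auto simp only: successively_append_iff simple_path_def take_0 rev.simps append_Nil2)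
    moreover have "distinct C"
    proof -
      have "set (take k q) \<inter> set p = {}"
        using min k by (fastforce simp: in_set_conv_nth[of _ "take k q"])
      then have "set (take k q) \<inter> set (take (Suc j) p) = {}"
        using set_take_subset[of "Suc j" p] by blast
      moreover have "v \<notin> set (take k q)" "distinct (take k q)"
        using q set_take_subset[of k q] by (auto simp: simple_path_def)
      moreover have "v \<notin> set (take (Suc j) p)" "distinct (take (Suc j) p)"
        using p set_take_subset[of "Suc j" p] by (auto simp: simple_path_def)
      ultimately show ?thesis by (auto simp: C_def)
    qed
    moreover have "last C = q ! 0"
    proof (cases "k = 0")
      case True
      then show ?thesis using j ne(1) by (simp add: C_def take_Suc_conv_app_nth)
    next
      case False
      then have "take k q \<noteq> []" using ne(2) by simp
      then show ?thesis using k False ne by (simp add: C_def last_rev hd_conv_nth)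
    qed
    moreover have "E (q ! 0) v"
      using simple_path_nth[OF q, of 0] ne(2) by (simp add: E_sym)
    moreover have "3 \<le> length C"
    proof -
      have "\<not> (j = 0 \<and> k = 0)" using ne j by (metis hd_conv_nth)
      then show ?thesis using j k by (auto simp: C_def min_def)
    qed
    moreover have "hd C = v" by (simp add: C_def)
    ultimately have "graph_cycle E C" by (simp add: graph_cycle_def)
    then show False using tree by (auto simp: is_tree_def)
  qed
  moreover have "simple_path (rev (v # p))" using p by (simp del: rev.simps)
  then have "successively E (rev p @ [v])" by (simp add: simple_path_def)
  moreover have "successively E (v # q)" using q by (simp add: simple_path_def)
  ultimately show ?thesis
    using p q by (auto simp: simple_path_def successively_append_iff)
qed

lemma ex_simple_path: "\<exists>p. simple_path p \<and> hd p = a \<and> last p = b"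
proof -
  have "E\<^sup>*\<^sup>* a b" using tree by (simp add: is_tree_def graph_connected_def)
  then show ?thesis
  proof (induction rule: rtranclp_induct)
    case base
    have "simple_path [a]" by (simp add: simple_path_def)
    then show ?case by force
  next
    case (step b c)
    then obtain p where p: "simple_path p" "hd p = a" "last p = b" by blast
    show ?case
    proof (cases "c \<in> set p")
      case True
      then obtain x y where "p = x @ c # y" by (meson split_list)
      then have "p = [] @ (x @ [c]) @ y" by simp
      then have "simple_path (x @ [c])" using simple_path_infix p(1) by (metis snoc_eq_iff_butlast)
      moreover have "hd (x @ [c]) = a" using p(2) \<open>p = x @ c # y\<close> by (cases x) auto
      ultimately show ?thesis by force
    next
      case False
      then have "simple_path (p @ [c])"
        using p step(2) by (auto simp: simple_path_def successively_append_iff)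
      moreover have "hd (p @ [c]) = a" using p by (auto simp: simple_path_def)
      ultimately show ?thesis by force
    qed
  qed
qed


subsection \<open>Orderings of the vertices\<close>

text \<open>A swap does not change the Coxeter element of the ordering, and a rotation conjugates
  it; rotating by one letter exchanges a source and a sink of the associated acyclic
  orientation.\<close>

inductive flip :: "'i list \<Rightarrow> 'i list \<Rightarrow> bool" where
  swap: "\<not> E i j \<Longrightarrow> flip (p @ i # j # q) (p @ j # i # q)"
| rotate: "flip (p @ q) (q @ p)"

lemma flip_set: "flip p q \<Longrightarrow> set p = set q"
  by (induction rule: flip.induct) auto

lemma flips_set: "flip\<^sup>*\<^sup>* p q \<Longrightarrow> set p = set q"
  by (induction rule: rtranclp_induct) (auto dest: flip_set)

lemma flips_slide:
  assumes "\<And>x. x \<in> set q \<Longrightarrow> \<not> E l x"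
  shows "flip\<^sup>*\<^sup>* (p @ q @ l # r) (p @ l # q @ r)"
  using assms
proof (induction q arbitrary: r rule: rev_induct)
  case Nil
  then show ?case by simp
next
  case (snoc x q)
  have "flip ((p @ q) @ x # l # r) ((p @ q) @ l # x # r)"
    using snoc.prems E_sym by (intro flip.swap) auto
  then show ?case using snoc.IH[of "x # r"] snoc.prems
    by (auto intro: converse_rtranclp_into_rtranclp)
qed

definition insert_after :: "'i \<Rightarrow> 'i \<Rightarrow> 'i list \<Rightarrow> 'i list" where
  "insert_after n l p = concat (map (\<lambda>x. if x = n then [n, l] else [x]) p)"

lemma insert_after_append: "insert_after n l (p @ q) = insert_after n l p @ insert_after n l q"
  and insert_after_Cons: "insert_after n l (x # p) = (if x = n then [n, l] else [x]) @ insert_after n l p"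
  by (simp_all add: insert_after_def)

lemma insert_after_notin: "n \<notin> set p \<Longrightarrow> insert_after n l p = p"
  by (induction p) (auto simp: insert_after_def)

text \<open>The block \<open>n, l\<close> moves like the single letter \<open>n\<close>: no letter
  other than \<open>n\<close> is adjacent to \<open>l\<close>, so whatever passes \<open>n\<close>
  passes \<open>l\<close> as well.\<close>

lemma flip_insert_after:
  assumes "flip p q" "\<And>x. x \<in> set p \<Longrightarrow> E l x \<Longrightarrow> x = n"
  shows "flip\<^sup>*\<^sup>* (insert_after n l p) (insert_after n l q)"
  using assms
proof (induction rule: flip.induct)
  case (swap i j p q)
  define p' q' where "p' = insert_after n l p" and "q' = insert_after n l q"
  consider "i = j" | "i \<noteq> n" "j \<noteq> n" | "i = n" "j \<noteq> n" | "j = n" "i \<noteq> n" by blast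
  then show ?case
  proof cases
    case 2
    then have "flip (insert_after n l (p @ i # j # q)) (insert_after n l (p @ j # i # q))"
      using flip.swap[OF swap(1), of p' q'] by (simp add: insert_after_append insert_after_Cons p'_def q'_def)
    then show ?thesis by blast
  next
    case 3
    have "\<not> E l j" using swap(2)[of j] 3 by auto
    then have "flip\<^sup>*\<^sup>* (p' @ [n, l] @ j # q') (p' @ j # [n, l] @ q')"
      using swap(1) 3 by (intro flips_slide) (auto simp: E_sym[of _ j])
    then show ?thesis
      using 3 by (simp add: insert_after_append insert_after_Cons flip: p'_def q'_def)
  next
    case 4
    have "\<not> E l i" using swap(2)[of i] 4 by auto
    then have "flip (p' @ i # n # l # q') (p' @ n # i # l # q')"
        "flip ((p' @ [n]) @ i # l # q') ((p' @ [n]) @ l # i # q')"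
      using swap(1) 4 E_sym[of l i] by (auto intro!: flip.swap simp del: append_assoc)
    then have "flip\<^sup>*\<^sup>* (p' @ i # n # l # q') (p' @ n # l # i # q')"
      by (auto intro: converse_rtranclp_into_rtranclp)
    then show ?thesis
      using 4 by (simp add: insert_after_append insert_after_Cons flip: p'_def q'_def)
  qed auto
next
  case (rotate p q)
  then show ?case using flip.rotate by (auto simp: insert_after_append)
qed

lemma flips_insert_after:
  assumes "flip\<^sup>*\<^sup>* p q" "\<And>x. x \<in> set p \<Longrightarrow> E l x \<Longrightarrow> x = n"
  shows "flip\<^sup>*\<^sup>* (insert_after n l p) (insert_after n l q)"
  using assms
proof (induction rule: rtranclp_induct)
  case base
  then show ?case by blast
next
  case (step q r)
  have "flip\<^sup>*\<^sup>* (insert_after n l q) (insert_after n l r)"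
    using step(2,4) flips_set[OF step(1)] by (intro flip_insert_after) auto
  then show ?case using step by (meson rtranclp_trans)
qed

lemma flip_sym: "flip p q \<Longrightarrow> flip q p"
  by (induction rule: flip.induct) (auto intro: flip.intros simp: E_sym)

lemma flips_sym: "flip\<^sup>*\<^sup>* p q \<Longrightarrow> flip\<^sup>*\<^sup>* q p"
  by (induction rule: rtranclp_induct) (auto intro: converse_rtranclp_into_rtranclp flip_sym)

text \<open>A rotation brings \<open>l\<close> to the end of the list. Only \<open>n\<close> can be
  adjacent to it, so it slides left until it stands right behind \<open>n\<close>.\<close>

lemma flips_remove:
  assumes "distinct p" "set p = insert l A" "l \<notin> A" "n \<in> A" "\<And>x. x \<in> A \<Longrightarrow> E l x \<Longrightarrow> x = n"
  obtains r where "distinct r" "set r = A" "flip\<^sup>*\<^sup>* p (insert_after n l r)"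
proof -
  obtain p1 p2 where p: "p = p1 @ l # p2" using assms(2) by (metis insertI1 split_list)
  define r where "r = p2 @ p1"
  have r: "distinct r" "set r = A" using assms(1,2,3) p by (auto simp: r_def)
  obtain r1 r2 where r12: "r = r1 @ n # r2" using r assms(4) by (metis split_list)
  have n: "n \<notin> set r1" "n \<notin> set r2" using r r12 by auto
  have ins: "insert_after n l r = r1 @ n # l # r2"
    using n by (simp add: r12 insert_after_append insert_after_Cons insert_after_notin)
  have l: "\<not> E l x" if "x \<in> set r2" for x using assms(5)[of x] that r r12 n by auto
  have "flip p (r @ [l])" using flip.rotate[of "p1 @ [l]" p2] p by (simp add: r_def)
  moreover have "flip\<^sup>*\<^sup>* (r @ [l]) (insert_after n l r)"
    using flips_slide[of r2 l "r1 @ [n]" "[]"] l by (simp add: ins) (simp add: r12)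
  ultimately show ?thesis using that[OF r] by (meson converse_rtranclp_into_rtranclp)
qed

text \<open>
  Coxeter elements correspond to acyclic orientations, and on a forest any two of these are
  connected by source-to-sink moves. In the induction, a vertex \<open>l\<close> with a single neighbour \<open>n\<close> is
  glued to \<open>n\<close>.
\<close>

lemma flips_orderings:
  assumes "distinct p" "distinct q" "set p = A" "set q = A"
  shows "flip\<^sup>*\<^sup>* p q"
  using assms
proof (induction A arbitrary: p q rule: forest_induct)
  case empty
  then show ?case by simp
next
  case (insert A l n)
  show ?case
  proof (cases "A = {}")
    case True
    have "p = [l]" if "distinct p" "set p = {l}" for p
      using that by (cases p; cases "tl p") auto
    then have "p = q" using insert.prems True by metis
    then show ?thesis by simp
  next
    case False
    then have n: "n \<in> A" using insert.hyps by blast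
    obtain r where r: "distinct r" "set r = A" "flip\<^sup>*\<^sup>* p (insert_after n l r)"
      using flips_remove[of p l A n] insert.hyps insert.prems n by metis
    obtain r' where r': "distinct r'" "set r' = A" "flip\<^sup>*\<^sup>* q (insert_after n l r')"
      using flips_remove[of q l A n] insert.hyps insert.prems n by metis
    have "flip\<^sup>*\<^sup>* r r'" using insert.IH r r' by blast
    then have "flip\<^sup>*\<^sup>* (insert_after n l r) (insert_after n l r')"
      using insert.hyps r by (intro flips_insert_after) auto
    then show ?thesis using r(3) flips_sym[OF r'(3)] by (meson rtranclp_trans)
  qed
qed


subsection \<open>Trees without an affine subdiagram\<close>

definition nbrs :: "'i \<Rightarrow> 'i set" where
  "nbrs i = {j. E i j}"

definition joined :: "'i \<Rightarrow> 'i list \<Rightarrow> 'i list \<Rightarrow> bool" where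
  "joined v p q \<longleftrightarrow> simple_path (rev p @ v # q)"

lemma joined_take: "joined v p q \<Longrightarrow> joined v (take a p) (take b q)"
proof -
  assume "joined v p q"
  moreover have "rev p @ v # q = rev (drop a p) @ (rev (take a p) @ v # take b q) @ drop b q"
    by (metis append.assoc append_Cons append_take_drop_id rev_append)
  ultimately show "joined v (take a p) (take b q)"
    unfolding joined_def using simple_path_infix by (metis Nil_is_append_conv list.distinct(1))
qed

text \<open>The diagrams \<open>\<tilde>D\<close>, with a path \<open>P\<close> and two legs at each of its ends.\<close>

definition double_fork :: "'i list \<Rightarrow> 'i \<Rightarrow> 'i \<Rightarrow> 'i \<Rightarrow> 'i \<Rightarrow> bool" where
  "double_fork P a b c d \<longleftrightarrow> P \<noteq> [] \<and> a \<noteq> b \<and> c \<noteq> d \<and>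
     simple_path (a # P @ [c]) \<and> simple_path (a # P @ [d]) \<and>
     simple_path (b # P @ [c]) \<and> simple_path (b # P @ [d])"

definition tripod :: "'i \<Rightarrow> 'i list \<Rightarrow> 'i list \<Rightarrow> 'i list \<Rightarrow> bool" where
  "tripod v p q r \<longleftrightarrow> joined v p q \<and> joined v p r \<and> joined v q r"

text \<open>The triples are the arm lengths, without the branch vertex, of the affine diagrams of
  types \<open>E6\<close>, \<open>E7\<close> and \<open>E8\<close>.\<close>

definition affine_tripod :: bool where
  "affine_tripod \<longleftrightarrow> (\<exists>v p q r. tripod v p q r \<and>
     (length p, length q, length r) \<in> {(2, 2, 2), (1, 3, 3), (1, 2, 5)})"

text \<open>In the simply laced case \<open>2 * B\<close> has the matrix "twice the identity minus
  adjacency", so on a connected graph such an \<open>f\<close> certifies that \<open>B\<close> is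
  positive definite. Strictness at \<open>i0\<close> excludes the affine diagrams.\<close>

definition superharmonic :: "('i \<Rightarrow> real) \<Rightarrow> 'i \<Rightarrow> bool" where
  "superharmonic f i0 \<longleftrightarrow> (\<forall>i. f i > 0) \<and> (\<forall>i. (\<Sum>j\<in>nbrs i. f j) \<le> 2 * f i) \<and> (\<Sum>j\<in>nbrs i0. f j) < 2 * f i0"

section \<open>Degrees and arms: an affine diagram or a superharmonic function\<close>

lemma ex_distinct_in_set:
  assumes "k \<le> card A"
  obtains xs where "distinct xs" "length xs = k" "set xs \<subseteq> A"
proof -
  obtain B where "B \<subseteq> A" "card B = k" "finite B" using obtain_subset_with_card_n[OF assms] .
  moreover then obtain xs where "set xs = B" "distinct xs" using finite_distinct_list by blast
  ultimately show ?thesis using that[of xs] distinct_card by force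
qed

text \<open>The path of a double fork may be a single vertex; four legs at one centre form the
  affine diagram of type \<open>D4\<close>.\<close>

lemma double_fork_if_degree_4:
  assumes "4 \<le> card (nbrs v)"
  shows "\<exists>P a b c d. double_fork P a b c d"
proof -
  obtain xs where xs: "distinct xs" "length xs = 4" "set xs \<subseteq> nbrs v" using ex_distinct_in_set[OF assms] .
  then obtain a b c d where "xs = [a, b, c, d]"
    by (auto simp: numeral_eq_Suc length_Suc_conv)
  then have "double_fork [v] a b c d"
    using xs E_sym by (auto simp: double_fork_def simple_path_def nbrs_def)
  then show ?thesis by blast
qed

lemma simple_path_extend:
  assumes "simple_path (v # p)" "E v x" "p = [] \<or> hd p \<noteq> x"
  shows "simple_path (x # v # p)"
proof (cases "p = []")
  case True
  then show ?thesis using assms E_sym by (auto simp: simple_path_def)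
next
  case False
  have "simple_path [v, x]" using assms(2) by (auto simp: simple_path_def)
  then show ?thesis using simple_path_join[of v "[x]" p] assms False by auto
qed

text \<open>At either end of the path from \<open>v\<close> to \<open>w\<close>, one of three
  neighbours may be the next vertex of the path; the other two serve as legs.\<close>

lemma double_fork_if_two_branch_points:
  assumes "v \<noteq> w" "3 \<le> card (nbrs v)" "3 \<le> card (nbrs w)"
  shows "\<exists>P a b c d. double_fork P a b c d"
proof -
  obtain P where P: "simple_path P" "hd P = v" "last P = w" using ex_simple_path by blast
  have two: "\<exists>a b. a \<noteq> b \<and> E u a \<and> E u b \<and> a \<noteq> x \<and> b \<noteq> x" if "3 \<le> card (nbrs u)" for u x
  proof -
    have "2 \<le> card (nbrs u - {x})" using that by (auto simp: card_Diff_singleton_if)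
    then obtain xs where xs: "distinct xs" "length xs = 2" "set xs \<subseteq> nbrs u - {x}"
      using ex_distinct_in_set by blast
    then obtain a b where "xs = [a, b]" by (auto simp: numeral_eq_Suc length_Suc_conv)
    then show ?thesis using xs by (auto simp: nbrs_def)
  qed
  obtain x p where p: "P = v # x # p"
    using P assms(1) by (cases P; cases "tl P") (auto simp: simple_path_def)
  obtain y q where q: "rev P = w # y # q"
    using P assms(1) by (cases "rev P"; cases "tl (rev P)") (auto simp: simple_path_def)
  obtain a b where ab: "a \<noteq> b" "E v a" "E v b" "a \<noteq> x" "b \<noteq> x" using two assms(2) by blast
  obtain c d where cd: "c \<noteq> d" "E w c" "E w d" "c \<noteq> y" "d \<noteq> y" using two assms(3) by blast
  have *: "simple_path (a # P @ [c])" if "E v a" "a \<noteq> x" "E w c" "c \<noteq> y" for a c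
  proof -
    have "simple_path (a # P)" using simple_path_extend[of v "x # p" a] P(1) that p by simp
    then have "simple_path (rev (a # P))" by (simp del: rev.simps)
    then have "simple_path (c # rev (a # P))"
      using simple_path_extend[of w "y # q @ [a]" c] that q by simp
    then have "simple_path (rev (c # rev (a # P)))" by (simp del: rev.simps)
    then show ?thesis by simp
  qed
  have "double_fork P a b c d" using ab cd * p by (simp add: double_fork_def)
  then show ?thesis by blast
qed

text \<open>A longest path beginning with \<open>v, x\<close> is the whole branch of the tree behind
  \<open>x\<close>: its inner vertices have no third neighbour by \<open>deg\<close>, and its last
  vertex is a leaf by maximality.\<close>

lemma ex_arm:
  assumes "E v x" and deg: "\<And>u. u \<noteq> v \<Longrightarrow> card (nbrs u) \<le> 2"
  obtains q where "simple_path (v # x # q)"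
    "\<And>j. j \<le> length q \<Longrightarrow> nbrs ((v # x # q) ! Suc j) =
       insert ((v # x # q) ! j) (if j < length q then {(v # x # q) ! Suc (Suc j)} else {})"
proof -
  have "simple_path [v, x]" using assms(1) by (auto simp: simple_path_def)
  then obtain L where L: "simple_path L" "take 2 L = [v, x]"
      "\<And>r. simple_path r \<Longrightarrow> take 2 r = [v, x] \<Longrightarrow> length r \<le> length L"
    using ex_longest_path[where p = "[v, x]" and Q = "\<lambda>p. take 2 p = [v, x]"] by auto
  obtain q where q: "L = v # x # q" using L(2) by (metis append_Cons append_Nil append_take_drop_id)
  have d: "distinct L" using L(1) by (simp add: simple_path_def)
  have "nbrs (L ! Suc j) = insert (L ! j) (if j < length q then {L ! Suc (Suc j)} else {})"
    if j: "j \<le> length q" for j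
  proof (cases "j < length q")
    case True
    have "{L ! j, L ! Suc (Suc j)} \<subseteq> nbrs (L ! Suc j)"
      using adjacent_on_path[OF L(1), of "Suc j" j] adjacent_on_path[OF L(1), of "Suc j" "Suc (Suc j)"] True q
      by (simp add: nbrs_def)
    moreover have "L ! j \<noteq> L ! Suc (Suc j)"
      using d True q by (subst nth_eq_iff_index_eq) auto
    then have "card {L ! j, L ! Suc (Suc j)} = 2" by simp
    moreover have "L ! Suc j \<noteq> L ! 0"
      using d True q by (subst nth_eq_iff_index_eq) auto
    then have "card (nbrs (L ! Suc j)) \<le> 2" using deg q by simp
    ultimately have "nbrs (L ! Suc j) = {L ! j, L ! Suc (Suc j)}"
      by (metis card_seteq finite)
    then show ?thesis using True by simp
  next
    case False
    then have j': "Suc (Suc j) = length L" using j q by simp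
    have "y = L ! j" if y: "E (L ! Suc j) y" for y
    proof -
      have "y \<in> set L"
      proof (rule ccontr)
        assume "y \<notin> set L"
        moreover have "L \<noteq> []" using j' by auto
        then have "last L = L ! Suc j" using last_conv_nth[of L] by (simp flip: j')
        ultimately have "simple_path (L @ [y])"
          using L(1) y by (auto simp: simple_path_def successively_append_iff)
        then show False using L(3)[of "L @ [y]"] q by simp
      qed
      then obtain k where "k < length L" "y = L ! k" by (auto simp: in_set_conv_nth)
      then show ?thesis using adjacent_on_path[OF L(1), of "Suc j" k] y j' by auto
    qed
    moreover have "E (L ! Suc j) (L ! j)" using adjacent_on_path[OF L(1), of "Suc j" j] j' by simp
    ultimately have "nbrs (L ! Suc j) = {L ! j}" unfolding nbrs_def by blast
    then show ?thesis using False by simp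
  qed
  then show ?thesis using that[of q] L(1) q by simp
qed

lemma superharmonic_if_degrees_le_2:
  assumes "\<And>u. card (nbrs u) \<le> 2"
  shows "\<exists>i0. superharmonic (\<lambda>_. 1) i0"
proof -
  obtain l n where "\<And>x. E l x \<Longrightarrow> x = n" using ex_leaf[of UNIV] by auto
  then have "nbrs l \<subseteq> {n}" by (auto simp: nbrs_def)
  then have "card (nbrs l) \<le> 1" using card_mono[of "{n}"] by simp
  then show ?thesis
    using assms by (auto simp: superharmonic_def intro!: exI[of _ l])
qed

definition arm :: "'i \<Rightarrow> 'i list \<Rightarrow> bool" where
  "arm v L \<longleftrightarrow> simple_path L \<and> hd L = v \<and> 2 \<le> length L \<and>
     (\<forall>j. Suc j < length L \<longrightarrow>
       nbrs (L ! Suc j) = insert (L ! j) (if Suc (Suc j) < length L then {L ! Suc (Suc j)} else {}))"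

text \<open>Let \<open>f\<close> fall linearly along each arm from 1 at \<open>v\<close> to 0 one
  step beyond the end. Then \<open>f\<close> is harmonic away from \<open>v\<close>, also at the
  leaves, and at \<open>v\<close> the neighbours add up to 3 minus the sum of the reciprocal
  lengths, where lengths include \<open>v\<close>. This is the classical condition 1/a + 1/b + 1/c >
  1.\<close>

lemma ex_superharmonic_on_arms:
  assumes arms: "\<And>k. k \<in> {0, 1, 2::nat} \<Longrightarrow> arm v (L k)"
    and nbrs_v: "nbrs v = (\<lambda>k. L k ! 1) ` {0, 1, 2}"
    and inj: "inj_on (\<lambda>k. L k ! 1) {0, 1, 2}"
    and lengths: "(\<Sum>k\<in>{0, 1, 2}. 1 / real (length (L k))) > 1"
  shows "\<exists>f. superharmonic f v"
proof -
  let ?K = "{0, 1, 2::nat}"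
  have path: "simple_path (L k)" and len: "2 \<le> length (L k)" and hd: "L k ! 0 = v" if "k \<in> ?K" for k
    using arms[OF that] by (auto simp: arm_def simple_path_def hd_conv_nth)
  have disj: "j = 0 \<and> j' = 0"
    if k: "k \<in> ?K" "k' \<in> ?K" "k \<noteq> k'" and j: "j < length (L k)" "j' < length (L k')" and e: "L k ! j = L k' ! j'"
    for k k' j j'
  proof -
    obtain p where p: "L k = v # p" "p \<noteq> []" using path[OF k(1)] len[OF k(1)] hd[OF k(1)]
      by (cases "L k"; cases "tl (L k)") auto
    obtain p' where p': "L k' = v # p'" "p' \<noteq> []" using path[OF k(2)] len[OF k(2)] hd[OF k(2)]
      by (cases "L k'"; cases "tl (L k')") auto
    have "hd p \<noteq> hd p'"
      using inj_onD[OF inj, of k k'] k p p' by (auto simp: hd_conv_nth)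
    then have "simple_path (rev p @ v # p')"
      using simple_path_join[of v p p'] path[OF k(1)] path[OF k(2)] p p' by simp
    then have d: "v \<notin> set p" "v \<notin> set p'" "set p \<inter> set p' = {}" by (auto simp: simple_path_def)
    have "j = 0 \<or> L k ! j \<in> set p" "j' = 0 \<or> L k' ! j' \<in> set p'"
      using j p p' by (auto simp: nth_Cons split: nat.splits)
    then show ?thesis using d e p p' by (cases j; cases j') auto
  qed
  \<comment> \<open>The choice of arm and position does not matter: distinct arms share only
    \<open>v\<close>, where the position is 0 and the value 1.\<close>
  define f where "f i = (let kj = (SOME kj. fst kj \<in> ?K \<and> snd kj < length (L (fst kj)) \<and> L (fst kj) ! snd kj = i)
    in 1 - real (snd kj) / real (length (L (fst kj))))" for i
  have f: "f (L k ! j) = 1 - real j / real (length (L k))" if kj: "k \<in> ?K" "j < length (L k)" for k j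
  proof -
    define kj' where "kj' = (SOME kj'. fst kj' \<in> ?K \<and> snd kj' < length (L (fst kj')) \<and> L (fst kj') ! snd kj' = L k ! j)"
    have *: "fst kj' \<in> ?K \<and> snd kj' < length (L (fst kj')) \<and> L (fst kj') ! snd kj' = L k ! j"
      unfolding kj'_def by (rule someI[of _ "(k, j)"]) (use kj in auto)
    have **: "f (L k ! j) = 1 - real (snd kj') / real (length (L (fst kj')))"
      unfolding f_def kj'_def Let_def ..
    show ?thesis
    proof (cases "fst kj' = k")
      case True
      then have "snd kj' = j"
        using * kj path[OF kj(1)] nth_eq_iff_index_eq[of "L k" "snd kj'" j] by (simp add: simple_path_def)
      then show ?thesis using True ** by simp
    next
      case False
      then have "j = 0 \<and> snd kj' = 0" using disj[of k "fst kj'" j "snd kj'"] * kj by metis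
      then show ?thesis using ** by simp
    qed
  qed
  have cover: "\<exists>k\<in>?K. \<exists>j<length (L k). i = L k ! j" for i
  proof -
    have "E\<^sup>*\<^sup>* v i" using tree by (simp add: is_tree_def graph_connected_def)
    then show ?thesis
    proof (induction rule: rtranclp_induct)
      case base
      show ?case using hd[of 0] len[of 0] by (intro bexI[of _ 0] exI[of _ 0]) auto
    next
      case (step y z)
      then obtain k j where kj: "k \<in> ?K" "j < length (L k)" "y = L k ! j" by blast
      have z: "z \<in> nbrs y" using step by (simp add: nbrs_def)
      show ?case
      proof (cases j)
        case 0
        then have "z \<in> (\<lambda>k. L k ! 1) ` ?K" using z kj hd[OF kj(1)] nbrs_v by simp
        then obtain k' where "k' \<in> ?K" "z = L k' ! 1" by blast
        then show ?thesis using len[of k'] by (intro bexI[of _ k'] exI[of _ 1]) auto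
      next
        case (Suc i)
        then have "nbrs y = insert (L k ! i) (if Suc (Suc i) < length (L k) then {L k ! Suc (Suc i)} else {})"
          using arms[OF kj(1)] kj by (auto simp: arm_def)
        then have "z = L k ! i \<or> Suc (Suc i) < length (L k) \<and> z = L k ! Suc (Suc i)"
          using z by (auto split: if_splits)
        then show ?thesis using kj Suc Suc_lessD by blast
      qed
    qed
  qed
  have at_v: "(\<Sum>j\<in>nbrs v. f j) = 3 - (\<Sum>k\<in>?K. 1 / real (length (L k)))"
  proof -
    have f1: "f (L k ! 1) = 1 - 1 / real (length (L k))" if "k \<in> ?K" for k
      using f[OF that, of 1] len[OF that] by simp
    have "(\<Sum>j\<in>nbrs v. f j) = (\<Sum>k\<in>?K. f (L k ! 1))"
      unfolding nbrs_v by (rule sum.reindex[OF inj, unfolded comp_def])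
    also have "\<dots> = (\<Sum>k\<in>?K. 1 - 1 / real (length (L k)))"
      using f1 by (intro sum.cong) auto
    finally show ?thesis by (simp add: sum_subtractf)
  qed
  have fv: "f v = 1" using f[of 0 0] hd[of 0] len[of 0] by force
  have "f i > 0 \<and> (\<Sum>j\<in>nbrs i. f j) \<le> 2 * f i" for i
  proof -
    obtain k j where kj: "k \<in> ?K" "j < length (L k)" "i = L k ! j" using cover[of i] by blast
    show ?thesis
    proof (cases j)
      case 0
      then have "i = v" using kj hd by simp
      then show ?thesis using at_v fv lengths by simp
    next
      case (Suc l)
      let ?n = "real (length (L k))"
      have n: "?n > 0" using kj(2) by linarith
      have nb: "nbrs i = insert (L k ! l) (if Suc (Suc l) < length (L k) then {L k ! Suc (Suc l)} else {})"
        using arms[OF kj(1)] kj Suc by (auto simp: arm_def)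
      have fi: "f i = 1 - real (Suc l) / ?n" and fl: "f (L k ! l) = 1 - real l / ?n"
        using f[of k "Suc l"] f[of k l] kj Suc by simp_all
      have "real (Suc l) < ?n" using kj Suc by (simp only: of_nat_less_iff)
      then have pos: "f i > 0" unfolding fi using n by simp
      show ?thesis
      proof (cases "Suc (Suc l) < length (L k)")
        case True
        have "L k ! l \<noteq> L k ! Suc (Suc l)"
          using path[OF kj(1)] True by (subst nth_eq_iff_index_eq) (auto simp: simple_path_def)
        then have "(\<Sum>j\<in>nbrs i. f j) = f (L k ! l) + f (L k ! Suc (Suc l))"
          using nb True by simp
        also have "\<dots> = 2 * f i"
          using f[of k "Suc (Suc l)"] True kj(1) n by (simp add: fi fl field_simps)
        finally show ?thesis using pos by simp
      next
        case False
        then have "length (L k) = Suc (Suc l)" using kj Suc by linarith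
        then have "f (L k ! l) = 2 * f i" by (simp add: fi fl field_simps)
        then show ?thesis using nb False pos by simp
      qed
    qed
  qed
  moreover have "(\<Sum>j\<in>nbrs v. f j) < 2 * f v" using at_v fv lengths by simp
  ultimately show ?thesis unfolding superharmonic_def by blast
qed

lemma affine_tripodI:
  assumes "tripod v p q r" "a \<le> length p" "b \<le> length q" "c \<le> length r"
    "(a, b, c) \<in> {(2, 2, 2), (1, 3, 3), (1, 2, 5)}"
  shows affine_tripod
proof -
  have "tripod v (take a p) (take b q) (take c r)"
    using assms(1) joined_take by (simp add: tripod_def)
  moreover have "(length (take a p), length (take b q), length (take c r)) = (a, b, c)"
    using assms by simp
  ultimately show ?thesis using assms(5) unfolding affine_tripod_def by metis
qed

text \<open>The remaining triples are \<open>(1, 1, c)\<close>, which is type \<open>D\<close>, and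
  \<open>(1, 2, c)\<close> with \<open>c \<le> 4\<close>, which gives types \<open>E6\<close>,
  \<open>E7\<close> and \<open>E8\<close>; these are the finite diagrams with a branch
  vertex.\<close>

lemma arm_lengths:
  fixes a b c :: nat
  assumes "1 \<le> a" "a \<le> b" "b \<le> c"
  shows "2 \<le> a \<or> 3 \<le> b \<or> 2 \<le> b \<and> 5 \<le> c \<or>
    1 / real (Suc a) + 1 / real (Suc b) + 1 / real (Suc c) > 1"
proof (cases "2 \<le> a \<or> 3 \<le> b \<or> 2 \<le> b \<and> 5 \<le> c")
  case False
  then consider "a = 1" "b = 1" | "a = 1" "b = 2" "c \<le> 4" using assms by linarith
  then show ?thesis
  proof cases
    case 2
    then have "real c \<le> 4" by simp
    then show ?thesis using 2 by (simp add: field_simps)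
  qed simp
qed blast

lemma three_arms:
  assumes "arm v L1" "arm v L2" "arm v L3"
    and nbrs_v: "nbrs v = {L1 ! 1, L2 ! 1, L3 ! 1}"
    and distinct: "L1 ! 1 \<noteq> L2 ! 1" "L1 ! 1 \<noteq> L3 ! 1" "L2 ! 1 \<noteq> L3 ! 1"
    and len: "length L1 \<le> length L2" "length L2 \<le> length L3"
  shows "affine_tripod \<or> (\<exists>f. superharmonic f v)"
proof -
  have *: "\<exists>p. L = v # p \<and> p \<noteq> [] \<and> hd p = L ! 1 \<and> simple_path (v # p)" if "arm v L" for L
    using that by (cases L; cases "tl L") (auto simp: arm_def)
  obtain p1 where p1: "L1 = v # p1" "p1 \<noteq> []" "hd p1 = L1 ! 1" "simple_path (v # p1)"
    using *[OF assms(1)] by blast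
  obtain p2 where p2: "L2 = v # p2" "p2 \<noteq> []" "hd p2 = L2 ! 1" "simple_path (v # p2)"
    using *[OF assms(2)] by blast
  obtain p3 where p3: "L3 = v # p3" "p3 \<noteq> []" "hd p3 = L3 ! 1" "simple_path (v # p3)"
    using *[OF assms(3)] by blast
  have t: "tripod v p1 p2 p3"
    using simple_path_join p1 p2 p3 distinct by (auto simp: tripod_def joined_def)
  have l: "1 \<le> length p1" "length p1 \<le> length p2" "length p2 \<le> length p3"
    using p1 p2 p3 len by (auto simp: Suc_le_eq)
  from arm_lengths[OF l] consider "2 \<le> length p1" | "3 \<le> length p2" | "2 \<le> length p2" "5 \<le> length p3"
    | "1 / real (length L1) + 1 / real (length L2) + 1 / real (length L3) > 1"
    using p1 p2 p3 by auto
  then show ?thesis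
  proof cases
    case 1
    then show ?thesis using affine_tripodI[OF t, of 2 2 2] l by simp
  next
    case 2
    then show ?thesis using affine_tripodI[OF t, of 1 3 3] l by simp
  next
    case 3
    then show ?thesis using affine_tripodI[OF t, of 1 2 5] l by simp
  next
    case 4
    define L where "L k = (if k = 0 then L1 else if k = 1 then L2 else L3)" for k :: nat
    have "\<exists>f. superharmonic f v"
    proof (rule ex_superharmonic_on_arms[where L = L])
      show "arm v (L k)" for k using assms by (simp add: L_def)
      show "nbrs v = (\<lambda>k. L k ! 1) ` {0, 1, 2}" using nbrs_v by (auto simp: L_def)
      show "inj_on (\<lambda>k. L k ! 1) {0, 1, 2}" using distinct by (auto simp: L_def inj_on_def)
      show "(\<Sum>k\<in>{0, 1, 2}. 1 / real (length (L k))) > 1" using 4 by (simp add: L_def)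
    qed
    then show ?thesis by blast
  qed
qed

text \<open>The case split of the ADE classification: without a branch vertex the tree is a path;
  two branch vertices, or one of degree at least 4, give an affine \<open>D\<close>; for a single
  trivalent vertex the arm lengths decide.\<close>

theorem affine_subdiagram_or_superharmonic:
  "(\<exists>P a b c d. double_fork P a b c d) \<or> affine_tripod \<or> (\<exists>f i0. superharmonic f i0)"
proof (cases "\<exists>v. 3 \<le> card (nbrs v)")
  case False
  then have "card (nbrs u) \<le> 2" for u by (metis not_less_eq_eq numeral_2_eq_2 numeral_3_eq_3)
  then show ?thesis using superharmonic_if_degrees_le_2 by blast
next
  case True
  then obtain v where v: "3 \<le> card (nbrs v)" by blast
  show ?thesis
  proof (cases "(\<exists>w. w \<noteq> v \<and> 3 \<le> card (nbrs w)) \<or> 4 \<le> card (nbrs v)")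
    case True
    then show ?thesis
      using v double_fork_if_degree_4[of v] double_fork_if_two_branch_points by metis
  next
    case False
    then have deg: "card (nbrs u) \<le> 2" if "u \<noteq> v" for u using that by (metis not_less_eq_eq numeral_2_eq_2 numeral_3_eq_3)
    have "card (nbrs v) = 3" using v False by linarith
    then obtain x y z where xyz: "nbrs v = {x, y, z}" "x \<noteq> y" "x \<noteq> z" "y \<noteq> z"
      by (auto simp: card_3_iff)
    have "\<exists>L. arm v L \<and> L ! 1 = u" if u: "E v u" for u
    proof -
      obtain q where q: "simple_path (v # u # q)" "\<And>j. j \<le> length q \<Longrightarrow> nbrs ((v # u # q) ! Suc j) =
         insert ((v # u # q) ! j) (if j < length q then {(v # u # q) ! Suc (Suc j)} else {})"
        using ex_arm[OF u deg] by blast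
      then have "arm v (v # u # q)" unfolding arm_def by (auto simp only: list.sel length_Cons) auto
      then show ?thesis by force
    qed
    moreover have "E v x" "E v y" "E v z" using xyz(1) by (auto simp: nbrs_def)
    ultimately obtain L1 L2 L3 where L: "arm v L1" "L1 ! 1 = x" "arm v L2" "L2 ! 1 = y" "arm v L3" "L3 ! 1 = z"
      by metis
    consider "length L1 \<le> length L2" "length L2 \<le> length L3" | "length L1 \<le> length L3" "length L3 \<le> length L2"
      | "length L2 \<le> length L1" "length L1 \<le> length L3" | "length L2 \<le> length L3" "length L3 \<le> length L1"
      | "length L3 \<le> length L1" "length L1 \<le> length L2" | "length L3 \<le> length L2" "length L2 \<le> length L1"
      by linarith
    then have "affine_tripod \<or> (\<exists>f. superharmonic f v)"
    proof cases
      case 1 then show ?thesis using three_arms[of v L1 L2 L3] L xyz by auto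
    next
      case 2 then show ?thesis using three_arms[of v L1 L3 L2] L xyz by auto
    next
      case 3 then show ?thesis using three_arms[of v L2 L1 L3] L xyz by auto
    next
      case 4 then show ?thesis using three_arms[of v L2 L3 L1] L xyz by auto
    next
      case 5 then show ?thesis using three_arms[of v L3 L1 L2] L xyz by auto
    next
      case 6 then show ?thesis using three_arms[of v L3 L2 L1] L xyz by auto
    qed
    then show ?thesis by blast
  qed
qed

end

section \<open>Roots of a simply laced Coxeter system\<close>

locale simply_laced_system = coxeter_system W s
  for W :: "('w, 'b) monoid_scheme" (structure) and s :: "'i::finite \<Rightarrow> 'w" +
  assumes laced: simply_laced
begin

lemma adj_sym: "adj i j \<longleftrightarrow> adj j i"
  by (auto simp: adj_def m_sym)

lemma adj_irrefl [simp]: "\<not> adj i i"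
  by (simp add: adj_def)

lemma m_eq: "m i j = (if i = j then 1 else if adj i j then 3 else 2)"
proof (cases "i = j \<or> adj i j")
  case True
  then show ?thesis
    using laced by (auto simp: simply_laced_def m_self)
next
  case False
  then have "m i j \<noteq> 0" "m i j < 3" by (auto simp: adj_def)
  then show ?thesis using False m_ge_2[of i j] by auto
qed

definition neighbours :: "'i \<Rightarrow> 'i set" where
  "neighbours i = {j. adj i j}"

lemma B_simple_root_right: "B x (simple_root i) = x $ i - (\<Sum>j\<in>neighbours i. x $ j) / 2"
proof -
  have "B x (simple_root i) = (\<Sum>k\<in>UNIV. x $ k * (if k = i then 1 else if adj i k then - 1 / 2 else 0))"
  proof -
    have "(\<Sum>l\<in>UNIV. x $ k * simple_root i $ l * (if m k l = 0 then - 1 else - cos (pi / real (m k l))))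
        = x $ k * (if k = i then 1 else if adj i k then - 1 / 2 else 0)" for k
    proof -
      have "(\<Sum>l\<in>UNIV. x $ k * simple_root i $ l * (if m k l = 0 then - 1 else - cos (pi / real (m k l))))
          = (\<Sum>l\<in>UNIV. if l = i then x $ k * (if m k i = 0 then - 1 else - cos (pi / real (m k i))) else 0)"
        by (intro sum.cong) (auto simp: simple_root_def axis_def)
      also have "\<dots> = x $ k * (if m k i = 0 then - 1 else - cos (pi / real (m k i)))"
        by simp
      also have "\<dots> = x $ k * (if k = i then 1 else if adj i k then - 1 / 2 else 0)"
        by (auto simp: m_eq adj_sym[of k i] cos_60)
      finally show ?thesis .
    qed
    then show ?thesis by (simp add: B_def)
  qed
  also have "\<dots> = (\<Sum>k\<in>UNIV. (if k = i then x $ k else 0) + (if k \<in> neighbours i then - (x $ k / 2) else 0))"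
    by (intro sum.cong) (auto simp: neighbours_def)
  also have "\<dots> = x $ i - (\<Sum>j\<in>neighbours i. x $ j) / 2"
    by (simp add: sum.distrib sum.If_cases sum_negf sum_divide_distrib)
  finally show ?thesis .
qed

lemma reflection_nth:
  "reflection i v $ k = (if k = i then (\<Sum>j\<in>neighbours i. v $ j) - v $ i else v $ k)"
  unfolding reflection_def B_simple_root_right by (simp add: simple_root_def axis_def)

lemma reflection_simple_root:
  "reflection i (simple_root j) =
     (if i = j then - simple_root i else if adj i j then simple_root j + simple_root i else simple_root j)"
proof -
  have "B (simple_root j) (simple_root i) = (if i = j then 1 else if adj i j then - 1 / 2 else 0)"
    by (auto simp: B_simple_root m_eq adj_sym[of j i] cos_60)
  then show ?thesis by (simp add: reflection_def scaleR_2)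
qed

lemma reflection_add: "reflection i (x + y) = reflection i x + reflection i y"
  and reflection_scale: "reflection i (a *\<^sub>R x) = a *\<^sub>R reflection i x"
  by (simp_all add: reflection_def B_add B_scale algebra_simps)

lemma act_add: "w \<in> carrier W \<Longrightarrow> act w (x + y) = act w x + act w y"
proof -
  have "foldr reflection p (x + y) = foldr reflection p x + foldr reflection p y" for p
    by (induction p) (auto simp: reflection_add)
  then show "w \<in> carrier W \<Longrightarrow> act w (x + y) = act w x + act w y"
    using word_surj act_word by metis
qed

lemma act_scale: "w \<in> carrier W \<Longrightarrow> act w (a *\<^sub>R x) = a *\<^sub>R act w x"
proof -
  have "foldr reflection p (a *\<^sub>R x) = a *\<^sub>R foldr reflection p x" for p
    by (induction p) (auto simp: reflection_scale)
  then show "w \<in> carrier W \<Longrightarrow> act w (a *\<^sub>R x) = a *\<^sub>R act w x"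
    using word_surj act_word by metis
qed

lemma act_minus: "w \<in> carrier W \<Longrightarrow> act w (- x) = - act w x"
  using act_scale[of w "- 1" x] by simp

lemma act_s_reflection: "act (s i) v = reflection i v"
  using act_word[of "[i]"] by (simp add: s_closed)

lemma act_inv_cancel: "w \<in> carrier W \<Longrightarrow> act w (act (inv w) x) = x"
  and act_inv_cancel': "w \<in> carrier W \<Longrightarrow> act (inv w) (act w x) = x"
  by (simp_all flip: act_mult add: act_one)

lemma act_mult_s:
  assumes "w \<in> carrier W"
  shows "act (w \<otimes> s j) (simple_root i) =
    (if i = j then - act w (simple_root i)
     else if adj i j then act w (simple_root i) + act w (simple_root j)
     else act w (simple_root i))"
  using assms by (simp add: act_mult s_closed act_s_reflection reflection_simple_root act_minus act_add adj_sym)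


subsection \<open>Length and the sign of a root\<close>

definition len :: "'w \<Rightarrow> nat" where
  "len w = (LEAST n. \<exists>p. word p = w \<and> length p = n)"

lemma len_word_le: "len (word p) \<le> length p"
  unfolding len_def by (rule Least_le) auto

lemma reduced_word:
  assumes "w \<in> carrier W"
  obtains p where "word p = w" "length p = len w"
proof -
  have "\<exists>n p. word p = w \<and> length p = n" using word_surj[OF assms] by blast
  then have "\<exists>p. word p = w \<and> length p = len w"
    unfolding len_def by (rule LeastI_ex)
  then show ?thesis using that by blast
qed

lemma word_snoc: "word (p @ [i]) = word p \<otimes> s i"
  by (simp add: word_append s_closed)

lemma mult_s_s [simp]: "w \<in> carrier W \<Longrightarrow> w \<otimes> s i \<otimes> s i = w"
  by (simp add: m_assoc s_closed s_square)

lemma len_mult_s_le: "w \<in> carrier W \<Longrightarrow> len (w \<otimes> s i) \<le> Suc (len w)"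
  by (metis reduced_word word_snoc len_word_le length_append_singleton)

lemma ex_descent:
  assumes "w \<in> carrier W" "w \<noteq> \<one>"
  obtains j where "len (w \<otimes> s j) < len w"
proof -
  obtain p where p: "word p = w" "length p = len w" using reduced_word assms by blast
  then obtain q j where "p = q @ [j]" using assms by (cases p rule: rev_cases) auto
  then have "w \<otimes> s j = word q" "len w = Suc (length q)"
    using p by (auto simp: word_snoc)
  then show ?thesis using that len_word_le[of q] by (metis less_Suc_eq_le)
qed

definition nonneg :: "real ^ 'i \<Rightarrow> bool" where
  "nonneg v \<longleftrightarrow> (\<forall>i. 0 \<le> v $ i)"

lemma nonneg_add: "nonneg x \<Longrightarrow> nonneg y \<Longrightarrow> nonneg (x + y)"
  by (simp add: nonneg_def)

lemma nonneg_simple_root: "nonneg (simple_root i)"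
  by (simp add: nonneg_def simple_root_def axis_def)

lemma braid:
  assumes "adj i j"
  shows "s i \<otimes> s j \<otimes> s i = s j \<otimes> s i \<otimes> s j"
proof -
  have "m i j = 3" "i \<noteq> j" using assms m_eq[of i j] by (auto split: if_splits)
  then have "(s i \<otimes> s j) [^] (3::nat) = \<one>"
    using pow_ord_eq_1[of "s i \<otimes> s j"] by (simp add: s_closed m_def)
  then have "s i \<otimes> s j \<otimes> s i \<otimes> (s j \<otimes> s i \<otimes> s j) = \<one>"
    by (simp add: numeral_3_eq_3 s_closed m_assoc)
  then have "inv (s j \<otimes> s i \<otimes> s j) = s i \<otimes> s j \<otimes> s i"
    by (intro inv_equality) (auto simp: s_closed)
  then show ?thesis
    by (simp add: inv_mult_group s_closed inv_s m_assoc)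
qed

lemma commute:
  assumes "\<not> adj i j"
  shows "s i \<otimes> s j = s j \<otimes> s i"
proof (cases "i = j")
  case False
  then have "m i j = 2" using assms m_eq[of i j] by auto
  then have "(s i \<otimes> s j) [^] (2::nat) = \<one>"
    using pow_ord_eq_1[of "s i \<otimes> s j"] by (simp add: s_closed m_def)
  then have "s i \<otimes> s j \<otimes> (s i \<otimes> s j) = \<one>"
    by (simp add: numeral_2_eq_2 s_closed m_assoc)
  then have "inv (s i \<otimes> s j) = s i \<otimes> s j"
    by (intro inv_equality) (auto simp: s_closed)
  then show ?thesis
    by (simp add: inv_mult_group s_closed inv_s)
qed auto

text \<open>
  The last letter \<open>j\<close> of a reduced word of \<open>w\<close> is stripped off, and for \<open>j\<close> adjacent to \<open>i\<close> possibly
  also a letter \<open>i\<close> in front of it; the braid relation ensures that no further case arises.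
\<close>

lemma act_simple_root_nonneg:
  "w \<in> carrier W \<Longrightarrow> len w \<le> len (w \<otimes> s i) \<Longrightarrow> nonneg (act w (simple_root i))"
proof (induction "len w" arbitrary: w i rule: less_induct)
  case less
  note w = less.prems(1)
  note IH = less.hyps
  show ?case
  proof (cases "w = \<one>")
    case True
    then show ?thesis by (simp add: act_one nonneg_simple_root)
  next
    case False
    then obtain j where j: "len (w \<otimes> s j) < len w" using w ex_descent by blast
    define v where "v = w \<otimes> s j"
    have v: "v \<in> carrier W" "w = v \<otimes> s j" "len v < len w"
      using w j by (auto simp: v_def s_closed)
    have lw: "len w = Suc (len v)" using len_mult_s_le[OF v(1), of j] v by simp
    have ij: "i \<noteq> j" using j less.prems by auto
    show ?thesis
    proof (cases "adj i j")
      case False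
      have "w \<otimes> s i = v \<otimes> s i \<otimes> s j"
        using commute[OF False] v by (simp add: m_assoc s_closed)
      then have "len w \<le> Suc (len (v \<otimes> s i))"
        using less.prems(2) len_mult_s_le[of "v \<otimes> s i" j] v by (simp add: s_closed)
      then have "nonneg (act v (simple_root i))" using IH[of v i] v lw by simp
      then show ?thesis using False ij v(1) by (simp add: v(2) act_mult_s)
    next
      case True
      have wi: "act w (simple_root i) = act v (simple_root i) + act v (simple_root j)"
        using True ij v(1) by (simp add: v(2) act_mult_s)
      have vj: "nonneg (act v (simple_root j))"
        using IH[of v j] v j by simp
      show ?thesis
      proof (cases "len v \<le> len (v \<otimes> s i)")
        case True
        then show ?thesis using wi vj IH[of v i] v by (simp add: nonneg_add)
      next
        case False
        define x where "x = v \<otimes> s i"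
        have x: "x \<in> carrier W" "v = x \<otimes> s i" "len x < len v"
          using v False by (auto simp: x_def s_closed)
        have "w \<otimes> s i = x \<otimes> (s i \<otimes> s j \<otimes> s i)"
          using v x by (simp add: m_assoc s_closed)
        also have "\<dots> = x \<otimes> s j \<otimes> s i \<otimes> s j"
          unfolding braid[OF \<open>adj i j\<close>] using x by (simp add: m_assoc s_closed)
        finally have "len (w \<otimes> s i) \<le> Suc (Suc (len (x \<otimes> s j)))"
          using len_mult_s_le[of "x \<otimes> s j \<otimes> s i" j] len_mult_s_le[of "x \<otimes> s j" i] x
          by (simp add: s_closed)
        then have "len x \<le> len (x \<otimes> s j)"
          using less.prems(2) lw x(3) by simp
        then have "nonneg (act x (simple_root j))"
          using IH[of x j] x v by simp
        moreover have "act w (simple_root i) = act x (simple_root j)"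
          using x \<open>adj i j\<close> ij by (simp add: wi) (simp add: x(2) act_mult_s adj_sym)
        ultimately show ?thesis by simp
      qed
    qed
  qed
qed

lemma act_simple_root_nonpos:
  assumes "w \<in> carrier W" "len (w \<otimes> s i) < len w"
  shows "nonneg (- act w (simple_root i))"
proof -
  have "nonneg (act (w \<otimes> s i) (simple_root i))"
    using assms by (intro act_simple_root_nonneg) (auto simp: s_closed)
  then show ?thesis using assms by (simp add: act_mult_s)
qed

section \<open>Signs, norms and integrality of roots\<close>

lemma rootsI: "w \<in> carrier W \<Longrightarrow> act w (simple_root i) \<in> roots"
  by (auto simp: roots_def)

lemma simple_root_in_roots: "simple_root i \<in> roots"
  using rootsI[OF one_closed, of i] by (simp add: act_one)

lemma act_roots: "w \<in> carrier W \<Longrightarrow> \<beta> \<in> roots \<Longrightarrow> act w \<beta> \<in> roots"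
  unfolding roots_def by (force simp flip: act_mult)

lemma reflection_roots: "\<beta> \<in> roots \<Longrightarrow> reflection i \<beta> \<in> roots"
  using act_roots[OF s_closed] by (simp add: act_s_reflection)

lemma minus_roots: "\<beta> \<in> roots \<Longrightarrow> - \<beta> \<in> roots"
proof -
  assume "\<beta> \<in> roots"
  then obtain w i where w: "w \<in> carrier W" "\<beta> = act w (simple_root i)" by (auto simp: roots_def)
  then have "- \<beta> = act (w \<otimes> s i) (simple_root i)" by (simp add: act_mult_s)
  then show ?thesis using rootsI[of "w \<otimes> s i"] w by (simp add: s_closed)
qed

lemma roots_sign: "\<beta> \<in> roots \<Longrightarrow> nonneg \<beta> \<or> nonneg (- \<beta>)"
  unfolding roots_def using act_simple_root_nonneg act_simple_root_nonpos by (fastforce simp: not_le)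

lemma positive_roots_eq: "positive_roots = {\<beta> \<in> roots. nonneg \<beta>}"
  by (simp add: positive_roots_def nonneg_def)

lemma B_sym: "B x y = B y x"
  unfolding B_def by (subst sum.swap, intro sum.cong) (auto simp: m_sym mult.commute)

lemma B_reflection: "B (reflection i x) (reflection i y) = B x y"
proof -
  have r: "B z (x - a *\<^sub>R y) = B z x - a * B z y" for z x y a
    using B_diff[of x "a *\<^sub>R y" z] B_scale[of a y z] by (simp add: B_sym)
  show ?thesis
    unfolding reflection_def r B_diff B_scale
    by (simp add: B_simple_root m_self B_sym[of "simple_root i"] algebra_simps)
qed

lemma B_roots: "\<beta> \<in> roots \<Longrightarrow> B \<beta> \<beta> = 1"
proof -
  have "B (foldr reflection p \<beta>) (foldr reflection p \<beta>) = B \<beta> \<beta>" for p \<beta>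
    by (induction p) (auto simp: B_reflection)
  then have "w \<in> carrier W \<Longrightarrow> B (act w \<beta>) (act w \<beta>) = B \<beta> \<beta>" for w \<beta>
    using word_surj act_word by metis
  then show "\<beta> \<in> roots \<Longrightarrow> B \<beta> \<beta> = 1"
    by (auto simp: roots_def B_simple_root m_self)
qed

lemma roots_nonzero: "\<beta> \<in> roots \<Longrightarrow> \<beta> \<noteq> 0"
  using B_roots B_scale[of 0 0] by force

text \<open>Simply laced reflections have integer matrices. Integrality is what later turns a bound
  on coordinates into finiteness.\<close>

lemma roots_Ints: "\<beta> \<in> roots \<Longrightarrow> \<beta> $ k \<in> \<int>"
proof -
  have "\<forall>k. foldr reflection p (simple_root i) $ k \<in> \<int>" for p i
    by (induction p) (auto simp: reflection_nth simple_root_def axis_def)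
  then have "w \<in> carrier W \<Longrightarrow> act w (simple_root i) $ k \<in> \<int>" for w i
    using word_surj act_word by metis
  then show "\<beta> \<in> roots \<Longrightarrow> \<beta> $ k \<in> \<int>"
    by (auto simp: roots_def)
qed

lemma not_nonneg_minus: "\<beta> \<in> roots \<Longrightarrow> nonneg \<beta> \<Longrightarrow> \<not> nonneg (- \<beta>)"
  using roots_nonzero[of \<beta>] by (auto simp: nonneg_def vec_eq_iff intro: order.antisym)

lemma positive_roots_minus: "\<beta> \<in> roots \<Longrightarrow> - \<beta> \<in> positive_roots \<longleftrightarrow> \<beta> \<notin> positive_roots"
  using roots_sign not_nonneg_minus minus_roots by (fastforce simp: positive_roots_eq)

lemma positive_rootI: "\<beta> \<in> roots \<Longrightarrow> 0 < \<beta> $ k \<Longrightarrow> \<beta> \<in> positive_roots"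
  using roots_sign[of \<beta>] by (auto simp: positive_roots_eq nonneg_def dest: spec[of _ k])

lemma simple_root_positive: "simple_root i \<in> positive_roots"
  by (simp add: positive_roots_eq simple_root_in_roots nonneg_simple_root)

text \<open>A positive root other than \<alpha>_i has a positive coordinate away from
  \<open>i\<close>, since a multiple of \<alpha>_i with norm 1 and nonnegative coefficient is
  \<alpha>_i itself. The reflection keeps that coordinate, and one positive coordinate determines
  the sign of a root.\<close>

lemma reflection_positive:
  assumes "\<beta> \<in> positive_roots" "\<beta> \<noteq> simple_root i"
  shows "reflection i \<beta> \<in> positive_roots"
proof -
  have b: "\<beta> \<in> roots" "nonneg \<beta>" using assms by (auto simp: positive_roots_eq)
  have "\<exists>k. k \<noteq> i \<and> \<beta> $ k > 0"
  proof (rule ccontr)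
    assume "\<not> ?thesis"
    then have "\<beta> $ k = 0" if "k \<noteq> i" for k
      using b(2) that by (meson nonneg_def not_le order.antisym)
    then have e: "\<beta> = (\<beta> $ i) *\<^sub>R simple_root i"
      by (auto simp: vec_eq_iff simple_root_def axis_def)
    have "B (a *\<^sub>R x) (a *\<^sub>R x) = a\<^sup>2 * B x x" for a x
      using B_sym[of x "a *\<^sub>R x"] by (simp add: B_scale power2_eq_square)
    from this[of "\<beta> $ i" "simple_root i"] have "(\<beta> $ i)\<^sup>2 = 1"
      using B_roots[OF b(1)] by (simp add: B_simple_root m_self flip: e)
    then have "\<beta> $ i = 1" using b(2) by (auto simp: nonneg_def power2_eq_1_iff dest: spec[of _ i])
    then show False using e assms(2) by simp
  qed
  then obtain k where "k \<noteq> i" "\<beta> $ k > 0" by blast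
  then show ?thesis
    using positive_rootI[OF reflection_roots[OF b(1)], of i k] by (simp add: reflection_nth)
qed

text \<open>A nontrivial \<open>w\<close> has a descent \<open>j\<close>, and it makes the simple
  root at \<open>j\<close> negative. In particular the action is faithful.\<close>

lemma eq_one_if_simple_roots_positive:
  assumes "w \<in> carrier W" "\<And>i. act w (simple_root i) \<in> positive_roots"
  shows "w = \<one>"
proof (rule ccontr)
  assume "w \<noteq> \<one>"
  then obtain j where "len (w \<otimes> s j) < len w" using ex_descent assms(1) by blast
  then have "nonneg (- act w (simple_root j))" using act_simple_root_nonpos assms(1) by blast
  then show False using not_nonneg_minus assms(2)[of j] by (auto simp: positive_roots_eq)
qed

lemma finite_if_finite_roots:
  assumes "finite roots"
  shows "finite (carrier W)"
proof (rule inj_on_finite)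
  show "inj_on (\<lambda>w. restrict (\<lambda>i. act w (simple_root i)) UNIV) (carrier W)"
  proof (rule inj_onI)
    fix x y assume xy: "x \<in> carrier W" "y \<in> carrier W"
      "restrict (\<lambda>i. act x (simple_root i)) UNIV = restrict (\<lambda>i. act y (simple_root i)) UNIV"
    then have "act x (simple_root i) = act y (simple_root i)" for i by (metis UNIV_I restrict_apply')
    then have "act (inv x \<otimes> y) (simple_root i) = simple_root i" for i
      using xy by (metis act_inv_cancel' act_mult inv_closed)
    then have "inv x \<otimes> y = \<one>"
      using xy by (intro eq_one_if_simple_roots_positive) (auto simp: simple_root_positive)
    then show "x = y" using xy by (metis inv_equality inv_inv inv_closed)
  qed
  show "(\<lambda>w. restrict (\<lambda>i. act w (simple_root i)) UNIV) ` carrier W \<subseteq> PiE UNIV (\<lambda>_. roots)"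
    by (auto intro: rootsI)
  show "finite (PiE (UNIV :: 'i set) (\<lambda>_. roots))"
    using assms by (intro finite_PiE) auto
qed

end

section \<open>Toggles and the choice of the Coxeter element\<close>

locale simply_laced_tree_system = simply_laced_system W s
  for W :: "('w, 'b) monoid_scheme" (structure) and s :: "'i::finite \<Rightarrow> 'w" +
  assumes adj_tree: "is_tree adj"
begin

sublocale tree_graph adj
  by unfold_locales (rule adj_tree)

lemma nbrs_eq: "nbrs = neighbours"
  by (simp add: nbrs_def neighbours_def fun_eq_iff)

lemma act_s_mult: "u \<in> carrier W \<Longrightarrow> act (s i \<otimes> u) v = reflection i (act u v)"
  by (simp add: act_mult s_closed act_s_reflection)

lemma act_inv_s_mult: "u \<in> carrier W \<Longrightarrow> act (inv (s i \<otimes> u)) v = act (inv u) (reflection i v)"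
  by (simp add: act_mult s_closed act_s_reflection inv_mult_group inv_s)

lemma toggle_closed: "u \<in> carrier W \<Longrightarrow> toggle L i u \<in> carrier W"
  by (simp add: toggle_def s_closed)

lemma fold_toggle_closed: "u \<in> carrier W \<Longrightarrow> fold (toggle L) p u \<in> carrier W"
  by (induction p arbitrary: u) (auto simp: toggle_closed)

lemma funpow_toggle_closed: "u \<in> carrier W \<Longrightarrow> (fold (toggle L) p ^^ K) u \<in> carrier W"
  by (induction K) (auto simp: fold_toggle_closed)

section \<open>Convex sets under toggles, and heaviness of an ordering\<close>

lemma convex_subset_closed: "convex_subset L \<Longrightarrow> L \<subseteq> carrier W"
  by (auto simp: convex_subset_def)

lemma R_iff: "convex_subset L \<Longrightarrow> \<beta> \<in> R L \<longleftrightarrow> \<beta> \<in> roots \<and> (\<forall>w\<in>L. act w \<beta> \<in> positive_roots)"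
  using convex_subset_closed by (fastforce simp: R_def half_space_def)

lemma mem_convex_iff:
  assumes "convex_subset L" "u \<in> carrier W"
  shows "u \<in> L \<longleftrightarrow> (\<forall>\<beta>\<in>R L. act u \<beta> \<in> positive_roots)"
proof
  assume "u \<in> L"
  then show "\<forall>\<beta>\<in>R L. act u \<beta> \<in> positive_roots" using assms by (auto simp: R_iff)
next
  assume *: "\<forall>\<beta>\<in>R L. act u \<beta> \<in> positive_roots"
  obtain A where A: "A \<subseteq> roots" "L = carrier W \<inter> (\<Inter>\<beta>\<in>A. half_space \<beta>)"
    using assms by (auto simp: convex_subset_def)
  then have "A \<subseteq> R L" by (auto simp: R_def)
  then show "u \<in> L" using * A assms(2) by (auto simp: half_space_def)
qed

text \<open>Crossing the wall of \<alpha>_i takes \<open>u\<close> out of only one half-space, that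
  of \<open>act (inv u) (simple_root i)\<close>, and the toggle crosses only if this root is not in
  \<open>R L\<close>.\<close>

lemma toggle_positive:
  assumes "u \<in> carrier W" "\<beta> \<in> R L" "act u \<beta> \<in> positive_roots"
  shows "act (toggle L i u) \<beta> \<in> positive_roots"
proof (cases "act (inv u) (simple_root i) \<in> R L")
  case True
  then show ?thesis using assms by (simp add: toggle_def)
next
  case False
  then have "act u \<beta> \<noteq> simple_root i" using assms act_inv_cancel' by metis
  then show ?thesis using False assms reflection_positive by (simp add: toggle_def act_s_mult)
qed

lemma toggle_convex: "convex_subset L \<Longrightarrow> u \<in> L \<Longrightarrow> toggle L i u \<in> L"
  using mem_convex_iff toggle_positive toggle_closed convex_subset_closed by (meson subsetD)

lemma fold_toggle_convex: "convex_subset L \<Longrightarrow> u \<in> L \<Longrightarrow> fold (toggle L) p u \<in> L"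
  by (induction p arbitrary: u) (auto simp: toggle_convex)

lemma funpow_toggle_convex: "convex_subset L \<Longrightarrow> u \<in> L \<Longrightarrow> (fold (toggle L) p ^^ K) u \<in> L"
  by (induction K) (auto simp: fold_toggle_convex)

lemma toggle_commute:
  assumes "\<not> adj i j" "u \<in> carrier W"
  shows "toggle L i (toggle L j u) = toggle L j (toggle L i u)"
proof (cases "i = j")
  case False
  have "s i \<otimes> (s j \<otimes> u) = s j \<otimes> (s i \<otimes> u)"
    using commute[OF assms(1)] assms(2) by (simp add: s_closed flip: m_assoc)
  then show ?thesis
    using assms False by (auto simp: toggle_def act_inv_s_mult reflection_simple_root adj_sym)
qed simp

text \<open>Stated for an explicit ordering and all \<open>L\<close> at once, so that moves between
  orderings can be followed without the choice made in \<open>promotion\<close>.\<close>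

definition heavy_for :: "'i list \<Rightarrow> bool" where
  "heavy_for p \<longleftrightarrow> (\<forall>L u K. convex_subset L \<and> L \<noteq> {} \<and> u \<in> carrier W \<and> 1 \<le> K \<and>
     (fold (toggle L) p ^^ K) u = u \<longrightarrow> u \<in> L)"

lemma funpow_fold_append:
  "(fold f (p @ q) ^^ K) (fold f q u) = fold f q ((fold f (q @ p) ^^ K) u)"
  by (induction K) auto

text \<open>For a rotation, the toggles of \<open>q\<close> carry a periodic point of one order to a
  periodic point of the other. That point lies in \<open>L\<close>, and since toggles preserve
  \<open>L\<close>, continuing the period leads back to \<open>u\<close> inside
  \<open>L\<close>.\<close>

lemma heavy_for_flip:
  assumes "flip p q" "heavy_for p"
  shows "heavy_for q"
  using assms
proof (induction rule: flip.induct)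
  case (swap i j p q)
  have "fold (toggle L) (p @ j # i # q) u = fold (toggle L) (p @ i # j # q) u" if "u \<in> carrier W" for L u
    using toggle_commute[OF swap(1) fold_toggle_closed[OF that]] by simp
  then have *: "(fold (toggle L) (p @ j # i # q) ^^ K) u = (fold (toggle L) (p @ i # j # q) ^^ K) u"
    if "u \<in> carrier W" for L u K
    using that by (induction K) (auto simp: funpow_toggle_closed simp del: fold_append fold.simps)
  show ?case
    unfolding heavy_for_def
  proof (intro allI impI, elim conjE)
    fix L u K
    assume "convex_subset L" "L \<noteq> {}" "u \<in> carrier W" "1 \<le> K"
      "(fold (toggle L) (p @ j # i # q) ^^ K) u = u"
    moreover from this have "(fold (toggle L) (p @ i # j # q) ^^ K) u = u" by (simp only: *)
    ultimately show "u \<in> L" using swap(2) unfolding heavy_for_def by blast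
  qed
next
  case (rotate p q)
  show ?case
    unfolding heavy_for_def
  proof (intro allI impI, elim conjE)
    fix L u K
    assume *: "convex_subset L" "L \<noteq> {}" "u \<in> carrier W" "1 \<le> K" "(fold (toggle L) (q @ p) ^^ K) u = u"
    have "(fold (toggle L) (p @ q) ^^ K) (fold (toggle L) q u) = fold (toggle L) q u"
      using *(5) funpow_fold_append[of K "toggle L" p q u] by simp
    then have "fold (toggle L) q u \<in> L"
      using * rotate fold_toggle_closed unfolding heavy_for_def by meson
    then have "fold (toggle L) (q @ p) u \<in> L"
      using *(1) fold_toggle_convex[of L "fold (toggle L) q u" p] by simp
    then have "(fold (toggle L) (q @ p) ^^ (K - 1)) (fold (toggle L) (q @ p) u) \<in> L"
      using *(1) funpow_toggle_convex by blast
    moreover have "(fold (toggle L) (q @ p) ^^ (K - 1)) (fold (toggle L) (q @ p) u) = u"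
      using *(4,5) by (cases K) (simp_all add: funpow_swap1 del: fold_append)
    ultimately show "u \<in> L" by simp
  qed
qed

lemma heavy_for_orderings:
  assumes "distinct p" "set p = UNIV" "distinct q" "set q = UNIV" "heavy_for p"
  shows "heavy_for q"
proof -
  have "flip\<^sup>*\<^sup>* p q" using flips_orderings assms by blast
  then show ?thesis using assms(5)
    by (induction rule: rtranclp_induct) (auto intro: heavy_for_flip)
qed

text \<open>The right-hand side does not mention \<open>c\<close>: on a tree, one ordering decides
  the question for all Coxeter elements together.\<close>

lemma futuristic_element_iff:
  assumes "coxeter_element c" "distinct p" "set p = UNIV"
  shows "futuristic_element c \<longleftrightarrow> heavy_for p"
proof -
  define q where "q = (SOME q. ordering_of q c)"
  have "ordering_of q c"
    using assms(1) unfolding q_def coxeter_element_def by (rule someI_ex)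
  then have q: "distinct q" "set q = UNIV" by (auto simp: ordering_of_def)
  have "futuristic_element c \<longleftrightarrow> heavy_for q"
    unfolding futuristic_element_def heavy_def promotion_def periodic_point_def heavy_for_def q_def
    by blast
  then show ?thesis using heavy_for_orderings q assms by blast
qed

lemma futuristicI: "distinct p \<Longrightarrow> set p = UNIV \<Longrightarrow> heavy_for p \<Longrightarrow> futuristic"
  using futuristic_element_iff by (auto simp: futuristic_def)

lemma ancientI: "distinct p \<Longrightarrow> set p = UNIV \<Longrightarrow> \<not> heavy_for p \<Longrightarrow> ancient"
  using futuristic_element_iff by (auto simp: ancient_def)


subsection \<open>Linear functionals\<close>

definition ev :: "('i \<Rightarrow> real) \<Rightarrow> real ^ 'i \<Rightarrow> real" where
  "ev \<zeta> v = (\<Sum>i\<in>UNIV. \<zeta> i * v $ i)"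

text \<open>The contragredient action of \<open>s i\<close> in terms of values on the simple roots;
  this is the firing move at \<open>i\<close> in the numbers game.\<close>

definition dual_reflection :: "'i \<Rightarrow> ('i \<Rightarrow> real) \<Rightarrow> 'i \<Rightarrow> real" where
  "dual_reflection i \<zeta> j = (if j = i then - \<zeta> i else if adj i j then \<zeta> j + \<zeta> i else \<zeta> j)"

lemma ev_add: "ev \<zeta> (x + y) = ev \<zeta> x + ev \<zeta> y"
  and ev_minus: "ev \<zeta> (- x) = - ev \<zeta> x"
  and ev_scale: "ev \<zeta> (a *\<^sub>R x) = a * ev \<zeta> x"
  by (simp_all add: ev_def algebra_simps sum.distrib sum_negf sum_distrib_left)

lemma ev_diff: "ev \<zeta> (x - y) = ev \<zeta> x - ev \<zeta> y"
  using ev_add[of \<zeta> x "- y"] by (simp add: ev_minus)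

lemma ev_simple_root [simp]: "ev \<zeta> (simple_root i) = \<zeta> i"
proof -
  have "ev \<zeta> (simple_root i) = (\<Sum>k\<in>UNIV. if k = i then \<zeta> i else 0)"
    unfolding ev_def by (intro sum.cong) (auto simp: simple_root_def axis_def)
  then show ?thesis by simp
qed

lemma ev_reflection: "ev \<zeta> (reflection i v) = ev (dual_reflection i \<zeta>) v"
proof -
  have "ev (dual_reflection i \<zeta>) v
      = (\<Sum>j\<in>UNIV. \<zeta> j * v $ j + (if j = i then - 2 * \<zeta> i * v $ i else 0) + (if j \<in> neighbours i then \<zeta> i * v $ j else 0))"
    unfolding ev_def dual_reflection_def by (intro sum.cong) (auto simp: neighbours_def algebra_simps)
  also have "\<dots> = ev \<zeta> v - 2 * \<zeta> i * v $ i + \<zeta> i * (\<Sum>j\<in>neighbours i. v $ j)"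
    by (simp add: sum.distrib ev_def sum.If_cases sum_distrib_left)
  also have "\<dots> = ev \<zeta> (reflection i v)"
    unfolding reflection_def B_simple_root_right
    unfolding ev_diff ev_scale ev_simple_root by (simp add: algebra_simps)
  finally show ?thesis ..
qed

lemma ev_mono: "nonneg v \<Longrightarrow> (\<And>i. \<zeta> i \<le> \<xi> i) \<Longrightarrow> ev \<zeta> v \<le> ev \<xi> v"
  by (auto simp: ev_def nonneg_def intro!: sum_mono mult_right_mono)

lemma dual_reflection_involution: "dual_reflection i (dual_reflection i \<zeta>) = \<zeta>"
  by (auto simp: dual_reflection_def fun_eq_iff)

lemma ev_positive:
  assumes "\<beta> \<in> positive_roots" "\<And>i. 0 < \<zeta> i"
  shows "0 < ev \<zeta> \<beta>"
proof -
  have "\<beta> \<noteq> 0" "nonneg \<beta>" using assms roots_nonzero by (auto simp: positive_roots_eq)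
  then obtain k where "\<beta> $ k \<noteq> 0" by (auto simp: vec_eq_iff)
  with \<open>nonneg \<beta>\<close> have "0 < \<zeta> k * \<beta> $ k"
    using assms(2)[of k] by (auto simp: nonneg_def less_le)
  moreover have "0 \<le> \<zeta> i * \<beta> $ i" for i
    using \<open>nonneg \<beta>\<close> assms(2)[of i] by (auto simp: nonneg_def)
  ultimately show ?thesis unfolding ev_def by (intro sum_pos2[of UNIV k]) auto
qed


section \<open>Finite groups\<close>

definition sep :: "'w set \<Rightarrow> 'w \<Rightarrow> (real ^ 'i) set" where
  "sep L u = {\<beta> \<in> R L. act u \<beta> \<notin> positive_roots}"

lemma sep_toggle: "u \<in> carrier W \<Longrightarrow> sep L (toggle L i u) \<subseteq> sep L u"
  using toggle_positive by (auto simp: sep_def)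

lemma sep_fold: "u \<in> carrier W \<Longrightarrow> sep L (fold (toggle L) p u) \<subseteq> sep L u"
  by (induction p arbitrary: u) (use sep_toggle toggle_closed in \<open>auto, blast\<close>)

text \<open>
  If \<open>L\<close> lies on the near side of the wall of \<open>\<alpha>\<^sub>i\<close> seen from \<open>u\<close>, so that \<open>u\<close> stays, and the
  reflection in this wall would decrease \<open>- u \<beta>\<close>, then \<open>\<beta>\<close> is replaced by \<open>u\<inverse> s\<^sub>i u \<beta>\<close>.
\<close>

lemma sep_step:
  assumes L: "convex_subset L" "L \<noteq> {}" and u: "u \<in> carrier W"
    and const: "sep L (toggle L i u) = sep L u" and \<zeta>: "0 \<le> \<zeta> i"
    and \<beta>: "\<beta> \<in> sep L u" "0 < ev \<zeta> (- act u \<beta>)"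
  shows "\<exists>\<beta>\<in>sep L u. 0 < ev (dual_reflection i \<zeta>) (- act (toggle L i u) \<beta>)"
proof -
  define b where "b = act u \<beta>"
  have R: "\<beta> \<in> R L" and \<beta>_root: "\<beta> \<in> roots" using \<beta> L by (auto simp: sep_def R_iff)
  have b: "b \<in> roots" "- b \<in> positive_roots"
    using \<beta>(1) act_roots[OF u \<beta>_root] by (auto simp: sep_def b_def positive_roots_minus)
  have refl_minus: "reflection i (- b) = - reflection i b"
    using reflection_scale[of i "- 1" b] by simp
  have ev_refl: "ev (dual_reflection i \<zeta>) (- reflection i b) = ev \<zeta> (- b)"
    by (simp flip: ev_reflection refl_minus add: reflection_reflection)
  show ?thesis
  proof (cases "act (inv u) (simple_root i) \<in> R L")
    case False
    then have "act (toggle L i u) \<beta> = reflection i b"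
      using u by (simp add: toggle_def act_s_mult b_def)
    then show ?thesis using \<beta> ev_refl by (auto simp: b_def intro!: bexI[of _ \<beta>])
  next
    case True
    define \<gamma> where "\<gamma> = act (inv u) (simple_root i)"
    have t: "toggle L i u = u" using True by (simp add: toggle_def)
    show ?thesis
    proof (cases "B b (simple_root i) < 0")
      case False
      have "ev (dual_reflection i \<zeta>) (- b) = ev \<zeta> (- b + (2 * B b (simple_root i)) *\<^sub>R simple_root i)"
        by (simp flip: ev_reflection add: refl_minus) (simp add: reflection_def)
      also have "\<dots> = ev \<zeta> (- b) + 2 * B b (simple_root i) * \<zeta> i"
        by (simp only: ev_add ev_scale ev_simple_root)
      also have "\<dots> \<ge> ev \<zeta> (- b)" using False \<zeta> by simp
      finally show ?thesis using \<beta> by (auto simp: t b_def intro!: bexI[of _ \<beta>])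
    next
      case neg: True
      \<comment> \<open>The root \<delta> is \<beta> plus a positive multiple of \<gamma>, and both
        are positive on \<open>L\<close>; hence \<delta> is in \<open>R L\<close>. It still
        separates \<open>u\<close> unless \<open>- b\<close> is \<alpha>_i, which would put \<beta>
        and its negative \<gamma> both into \<open>R L\<close>.\<close>
      define \<delta> where "\<delta> = act (inv u) (reflection i b)"
      have u\<delta>: "act u \<delta> = reflection i b" using u by (simp add: \<delta>_def act_inv_cancel)
      have \<delta>_eq: "\<delta> = \<beta> + (- 2 * B b (simple_root i)) *\<^sub>R \<gamma>"
        using u act_add[of "inv u" b "(- 2 * B b (simple_root i)) *\<^sub>R simple_root i"]
        by (simp add: \<delta>_def \<gamma>_def reflection_def act_scale act_minus) (simp add: b_def act_inv_cancel')
      have "\<delta> \<in> R L"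
        unfolding R_iff[OF L(1)]
      proof (intro conjI ballI)
        show \<delta>_root: "\<delta> \<in> roots" using u b by (simp add: \<delta>_def act_roots reflection_roots)
        fix w assume w: "w \<in> L"
        then have wc: "w \<in> carrier W" using L convex_subset_closed by blast
        have "nonneg (act w \<beta>)" "nonneg (act w \<gamma>)"
          using R True w L by (auto simp: R_iff positive_roots_eq \<gamma>_def)
        moreover have "act w \<delta> = act w \<beta> + (- 2 * B b (simple_root i)) *\<^sub>R act w \<gamma>"
          unfolding \<delta>_eq using wc by (simp only: act_add act_scale)
        moreover have "nonneg ((- 2 * B b (simple_root i)) *\<^sub>R x)" if "nonneg x" for x
          using that neg by (auto simp: nonneg_def mult_nonpos_nonneg)
        ultimately have "nonneg (act w \<delta>)" by (simp only: nonneg_add)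
        then show "act w \<delta> \<in> positive_roots"
          using act_roots[OF wc \<delta>_root] by (simp add: positive_roots_eq)
      qed
      moreover have "act u \<delta> \<notin> positive_roots"
      proof -
        have "- b \<noteq> simple_root i"
        proof
          assume "- b = simple_root i"
          then have "\<gamma> = - act (inv u) b" using act_minus[of "inv u" b] u by (simp add: \<gamma>_def)
          then have "\<gamma> = - \<beta>" using u by (simp add: b_def act_inv_cancel')
          moreover obtain w where "w \<in> L" using L by blast
          moreover have "w \<in> carrier W" using \<open>w \<in> L\<close> L convex_subset_closed by blast
          ultimately show False
            using R True L act_minus[of w \<beta>] positive_roots_minus[of "act w \<beta>"]
            by (auto simp: R_iff \<gamma>_def act_roots)
        qed
        then have "- reflection i b \<in> positive_roots"
          using reflection_positive[OF b(2), of i] by (simp only: refl_minus simp_thms)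
        then show ?thesis
          using positive_roots_minus[OF reflection_roots[OF b(1)]] u\<delta> by simp
      qed
      ultimately have "\<delta> \<in> sep L u" by (simp add: sep_def)
      moreover have "0 < ev (dual_reflection i \<zeta>) (- act (toggle L i u) \<delta>)"
        using \<beta> ev_refl by (simp add: t u\<delta> b_def)
      ultimately show ?thesis by blast
    qed
  qed
qed

text \<open>Equality over the whole block forces equality at each toggle, because \<open>sep\<close>
  never grows. Firing one letter of an independent set leaves \<zeta> unchanged at the others, so
  the sign condition of \<open>sep_step\<close> persists.\<close>

lemma sep_fold_step:
  assumes L: "convex_subset L" "L \<noteq> {}"
  shows "u \<in> carrier W \<Longrightarrow> sep L (fold (toggle L) q u) = sep L u \<Longrightarrow> distinct q \<Longrightarrow>
    (\<And>i j. i \<in> set q \<Longrightarrow> j \<in> set q \<Longrightarrow> \<not> adj i j) \<Longrightarrow> (\<And>i. i \<in> set q \<Longrightarrow> 0 \<le> \<zeta> i) \<Longrightarrow>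
    \<exists>\<beta>\<in>sep L u. 0 < ev \<zeta> (- act u \<beta>) \<Longrightarrow>
    \<exists>\<beta>\<in>sep L u. 0 < ev (fold dual_reflection q \<zeta>) (- act (fold (toggle L) q u) \<beta>)"
proof (induction q arbitrary: u \<zeta>)
  case Nil
  then show ?case by simp
next
  case (Cons i q)
  let ?u = "toggle L i u"
  have u: "?u \<in> carrier W" using Cons.prems toggle_closed by blast
  have "sep L (fold (toggle L) q ?u) \<subseteq> sep L ?u" "sep L ?u \<subseteq> sep L u"
    using sep_fold[OF u] sep_toggle Cons.prems(1) by auto
  then have c: "sep L ?u = sep L u" "sep L (fold (toggle L) q ?u) = sep L ?u"
    using Cons.prems(2) by auto
  have "\<exists>\<beta>\<in>sep L ?u. 0 < ev (dual_reflection i \<zeta>) (- act ?u \<beta>)"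
    using sep_step[OF L Cons.prems(1) c(1), of \<zeta>] Cons.prems(5,6) c(1) by auto
  moreover have "0 \<le> dual_reflection i \<zeta> j" if "j \<in> set q" for j
    using Cons.prems(3-5) that by (auto simp: dual_reflection_def)
  ultimately have "\<exists>\<beta>\<in>sep L ?u. 0 < ev (fold dual_reflection q (dual_reflection i \<zeta>)) (- act (fold (toggle L) q ?u) \<beta>)"
    using Cons.IH[OF u c(2), of "dual_reflection i \<zeta>"] Cons.prems(3,4) by auto
  then show ?case using c(1) by simp
qed

lemma fold_dual_reflection:
  assumes "distinct q" "\<And>i j. i \<in> set q \<Longrightarrow> j \<in> set q \<Longrightarrow> \<not> adj i j"
  shows "fold dual_reflection q \<zeta> k =
    (if k \<in> set q then - \<zeta> k else \<zeta> k + (\<Sum>i\<in>set q \<inter> nbrs k. \<zeta> i))"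
  using assms
proof (induction q arbitrary: \<zeta>)
  case Nil
  then show ?case by simp
next
  case (Cons i q)
  have same: "dual_reflection i \<zeta> j = \<zeta> j" if "j \<in> set q" for j
    using Cons.prems that by (auto simp: dual_reflection_def)
  have "(\<Sum>j\<in>set q \<inter> nbrs k. dual_reflection i \<zeta> j) = (\<Sum>j\<in>set q \<inter> nbrs k. \<zeta> j)"
    using same by (intro sum.cong) auto
  moreover have "i \<notin> set q" using Cons.prems by simp
  moreover have "set (i # q) \<inter> nbrs k = (if adj i k then insert i (set q \<inter> nbrs k) else set q \<inter> nbrs k)"
    by (auto simp: nbrs_def adj_sym)
  moreover have "fold dual_reflection q (dual_reflection i \<zeta>) k =
      (if k \<in> set q then - dual_reflection i \<zeta> k
       else dual_reflection i \<zeta> k + (\<Sum>i'\<in>set q \<inter> nbrs k. dual_reflection i \<zeta> i'))"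
    using Cons.IH Cons.prems by auto
  moreover have "set q \<inter> nbrs i = {}" using Cons.prems by (auto simp: nbrs_def)
  moreover have "dual_reflection i \<zeta> i = - \<zeta> i"
      "k \<noteq> i \<Longrightarrow> dual_reflection i \<zeta> k = (if adj i k then \<zeta> k + \<zeta> i else \<zeta> k)"
    by (simp_all add: dual_reflection_def)
  ultimately show ?case
    using same by (cases "k = i") (auto simp: nbrs_def)
qed

section \<open>The strictly superharmonic weight and the bipartite argument\<close>

lemma linear_reflection: "linear (reflection i)"
  by (intro linearI reflection_add reflection_scale)

text \<open>The sum \<open>P\<close> of the positive roots: \<open>s\<^sub>i\<close> permutes the positive roots other than \<open>\<alpha>\<^sub>i\<close>.\<close>

lemma ex_strictly_superharmonic:
  assumes "finite (carrier W)"
  shows "\<exists>P :: 'i \<Rightarrow> real. \<forall>i. 1 \<le> P i \<and> (\<Sum>j\<in>nbrs i. P j) = 2 * P i - 2"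
proof -
  have "roots = (\<lambda>(w, i). act w (simple_root i)) ` (carrier W \<times> UNIV)"
    by (auto simp: roots_def)
  then have fin: "finite positive_roots" using assms by (simp add: positive_roots_def)
  define P where "P = \<Sum>positive_roots"
  have "1 \<le> P $ i \<and> (\<Sum>j\<in>nbrs i. P $ j) = 2 * P $ i - 2" for i
  proof
    let ?N = "positive_roots - {simple_root i}"
    have P: "P = simple_root i + \<Sum>?N"
      unfolding P_def by (rule sum.remove[OF fin simple_root_positive])
    have "0 \<le> (\<Sum>?N) $ i"
      unfolding sum_component by (intro sum_nonneg) (auto simp: positive_roots_eq nonneg_def)
    then show "1 \<le> P $ i" by (simp add: P simple_root_def axis_def)
    have "reflection i \<beta> \<in> ?N" if "\<beta> \<in> ?N" for \<beta>
    proof -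
      have "reflection i \<beta> \<noteq> simple_root i"
      proof
        assume "reflection i \<beta> = simple_root i"
        then have "\<beta> = - simple_root i"
          using reflection_reflection[of i \<beta>] reflection_simple_root[of i i] by simp
        then show False
          using that positive_roots_minus[OF simple_root_in_roots[of i]] simple_root_positive[of i] by simp
      qed
      then show ?thesis using that reflection_positive by auto
    qed
    then have "bij_betw (reflection i) ?N ?N"
      by (intro bij_betw_byWitness[where f' = "reflection i"]) (auto simp: reflection_reflection)
    then have "(\<Sum>\<beta>\<in>?N. reflection i \<beta>) = \<Sum>?N"
      by (rule sum.reindex_bij_betw)
    then have "reflection i P = - simple_root i + \<Sum>?N"
      by (simp add: P reflection_add linear_sum[OF linear_reflection] reflection_simple_root)
    then have "reflection i P $ i = P $ i - 2 * simple_root i $ i" by (simp add: P)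
    then show "(\<Sum>j\<in>nbrs i. P $ j) = 2 * P $ i - 2"
      by (simp add: reflection_nth nbrs_eq simple_root_def axis_def)
  qed
  then show ?thesis by (intro exI[of _ "($) P"]) blast
qed

text \<open>While \<open>z\<close> is positive it is strictly concave. If a difference is
  nonpositive, the next one is negative and \<open>z\<close> falls at least linearly. Otherwise
  \<open>z\<close> stays above \<open>z 0\<close>, so each difference drops by at least
  \<open>\<epsilon> * z 0\<close> and cannot remain positive.\<close>

lemma decreasing_recurrence:
  fixes z :: "nat \<Rightarrow> real"
  assumes rec: "\<And>j. z (Suc (Suc j)) = (2 - \<epsilon>) * z (Suc j) - z j" and \<epsilon>: "0 < \<epsilon>"
  shows "\<exists>j. z j \<le> 0"
proof (rule ccontr)
  assume "\<not> ?thesis"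
  then have pos: "0 < z j" for j by (simp add: not_le)
  define d where "d j = z (Suc j) - z j" for j
  have step: "d (Suc j) = d j - \<epsilon> * z (Suc j)" for j by (simp add: d_def rec algebra_simps)
  then have dec: "d (Suc j) < d j" for j using \<epsilon> pos[of "Suc j"] by simp
  have no_drop: "0 < d j" for j
  proof (rule ccontr)
    assume "\<not> 0 < d j"
    define \<eta> where "\<eta> = - d (Suc j)"
    have \<eta>: "0 < \<eta>" using dec[of j] \<open>\<not> 0 < d j\<close> by (simp add: \<eta>_def)
    have dk: "d (Suc j + k) \<le> - \<eta>" for k
    proof (induction k)
      case (Suc k)
      then show ?case using dec[of "Suc j + k"] by simp
    qed (simp add: \<eta>_def)
    have "z (Suc j + k) \<le> z (Suc j) - real k * \<eta>" for k
    proof (induction k)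
      case (Suc k)
      then show ?case using dk[of k] by (simp add: d_def algebra_simps)
    qed simp
    moreover obtain k where "z (Suc j) < real k * \<eta>" using \<eta> reals_Archimedean3 by blast
    ultimately have "z (Suc j + k) < 0" by (smt (verit))
    then show False using pos[of "Suc j + k"] by simp
  qed
  have inc: "z 0 \<le> z j" for j
  proof (induction j)
    case (Suc j)
    then show ?case using no_drop[of j] by (simp add: d_def)
  qed simp
  have "d k \<le> d 0 - real k * (\<epsilon> * z 0)" for k
  proof (induction k)
    case (Suc k)
    have "\<epsilon> * z 0 \<le> \<epsilon> * z (Suc k)" using inc \<epsilon> by simp
    then show ?case using Suc step[of k] by (simp add: algebra_simps)
  qed simp
  moreover obtain k where "d 0 < real k * (\<epsilon> * z 0)"
    using reals_Archimedean3[of "\<epsilon> * z 0"] \<epsilon> pos[of 0] by auto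
  ultimately show False using no_drop[of k] by (smt (verit))
qed

lemma heavy_for_bipartite:
  assumes fin: "finite (carrier W)"
    and col: "\<And>i j. adj i j \<Longrightarrow> col i \<noteq> col j"
    and q: "\<And>c. distinct (q c)" "\<And>c. set (q c) = {i. col i = c}"
  shows "heavy_for (q True @ q False)"
  unfolding heavy_for_def
proof (intro allI impI, elim conjE, rule ccontr)
  fix L u K
  assume L: "convex_subset L" "L \<noteq> {}" and u: "u \<in> carrier W" and K: "1 \<le> K"
    and per: "(fold (toggle L) (q True @ q False) ^^ K) u = u" and notin: "u \<notin> L"
  obtain P :: "'i \<Rightarrow> real" where P: "\<And>i. 1 \<le> P i" "\<And>i. (\<Sum>j\<in>nbrs i. P j) = 2 * P i - 2"
    using ex_strictly_superharmonic[OF fin] by blast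
  define M where "M = Max (range P)"
  have PM: "P i \<le> M" for i by (simp add: M_def)
  then have M: "1 \<le> M" using P(1) order_trans by blast
  \<comment> \<open>The defect of \<open>P\<close> is exactly 2 at every vertex, and
    \<open>P i \<le> M\<close>; so 2 / M is a factor that works uniformly.\<close>
  define \<epsilon> where "\<epsilon> = 2 / M"
  have \<epsilon>: "0 < \<epsilon>" using M by (simp add: \<epsilon>_def)
  have super: "(\<Sum>j\<in>nbrs i. P j) \<le> (2 - \<epsilon>) * P i" for i
  proof -
    have "\<epsilon> * P i \<le> 2" using PM[of i] M by (simp add: \<epsilon>_def field_simps)
    then show ?thesis using P(2)[of i] by (simp add: algebra_simps)
  qed
  \<comment> \<open>From the first step on, \<open>y\<close> is minus the preceding
    \<open>z\<close>, so both are nonpositive at the first \<open>J\<close> with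
    \<open>z J \<le> 0\<close>. The start 1, 1 makes \<open>\<zeta> 0\<close> positive on every
    positive root.\<close>
  define st where "st j = ((\<lambda>(z, y). (y + (2 - \<epsilon>) * z, - z)) ^^ j) (1, 1)" for j :: nat
  define z y where "z j = fst (st j)" and "y j = snd (st j)" for j
  have z0: "z 0 = 1" "y 0 = 1" by (simp_all add: z_def y_def st_def)
  have zS: "z (Suc j) = y j + (2 - \<epsilon>) * z j" "y (Suc j) = - z j" for j
    by (simp_all add: z_def y_def st_def split: prod.split)
  have ex: "\<exists>j. z j \<le> 0"
    by (rule decreasing_recurrence[OF _ \<epsilon>]) (simp add: zS)
  define J where "J = (LEAST j. z j \<le> 0)"
  have J1: "z J \<le> 0" unfolding J_def by (rule LeastI_ex[OF ex])
  have J2: "0 < z j" if "j < J" for j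
    using not_less_Least[of j "\<lambda>j. z j \<le> 0"] that unfolding J_def by (simp only: not_le)
  define v where "v j = rec_nat u (\<lambda>j x. fold (toggle L) (q (even j)) x) j" for j
  have v0: "v 0 = u" and vS: "v (Suc j) = fold (toggle L) (q (even j)) (v j)" for j
    by (simp_all add: v_def)
  have vc: "v j \<in> carrier W" for j
  proof (induction j)
    case 0
    show ?case using u by (simp only: v0)
  next
    case (Suc j)
    then show ?case unfolding vS by (rule fold_toggle_closed)
  qed
  have v2: "v (2 * k) = (fold (toggle L) (q True @ q False) ^^ k) u" for k
    by (induction k) (simp_all add: v0 vS)
  have anti: "sep L (v (j + k)) \<subseteq> sep L (v j)" for j k
  proof (induction k)
    case (Suc k)
    have "sep L (v (Suc (j + k))) \<subseteq> sep L (v (j + k))" unfolding vS by (rule sep_fold[OF vc])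
    then show ?case using Suc by simp
  qed simp
  \<comment> \<open>\<open>sep\<close> only shrinks along the half-steps \<open>v\<close>, and it
    returns to \<open>sep L u\<close> at every multiple of the period.\<close>
  have const: "sep L (v j) = sep L u" for j
  proof
    show "sep L (v j) \<subseteq> sep L u" using anti[of 0 j] v0 by simp
    have "(fold (toggle L) (q True @ q False) ^^ (K * j)) u = u"
      by (induction j) (simp_all add: funpow_add per del: fold_append)
    then have "v (2 * (K * j)) = u" using v2[of "K * j"] by simp
    moreover have "j \<le> 2 * (K * j)" using K by (cases K) auto
    ultimately show "sep L u \<subseteq> sep L (v j)" using anti[of j "2 * (K * j) - j"] by simp
  qed
  \<comment> \<open>The colour toggled next carries \<open>P i * z j\<close>, the other colour
    \<open>P i * y j\<close>. Firing the first colour negates its value, which gives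
    \<open>P i * y (Suc j)\<close>, and adds at most \<open>(2 - \<epsilon>) * P i * z j\<close> to
    the other, which gives the bound \<open>P i * z (Suc j)\<close>. An upper bound is enough
    because the functional is evaluated at positive roots.\<close>
  define \<zeta> where "\<zeta> j i = P i * (if col i = even j then z j else y j)" for j i
  have main: "\<exists>\<beta>\<in>sep L u. 0 < ev (\<zeta> j) (- act (v j) \<beta>)" if "j \<le> J" for j
    using that
  proof (induction j)
    case 0
    obtain \<beta> where \<beta>: "\<beta> \<in> sep L u" using notin mem_convex_iff[OF L(1) u] by (auto simp: sep_def)
    then have "- act u \<beta> \<in> positive_roots"
      using u L by (auto simp: sep_def R_iff positive_roots_minus act_roots)
    moreover have "0 < \<zeta> 0 i" for i using P(1)[of i] by (simp add: \<zeta>_def z0)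
    ultimately have "0 < ev (\<zeta> 0) (- act (v 0) \<beta>)" by (simp add: ev_positive v0)
    then show ?case using \<beta> by blast
  next
    case (Suc j)
    let ?q = "q (even j)"
    have zj: "0 < z j" using J2 Suc by simp
    have indep: "\<not> adj i i'" if "i \<in> set ?q" "i' \<in> set ?q" for i i'
      using col[of i i'] that by (auto simp: q)
    have "0 \<le> \<zeta> j i" if "i \<in> set ?q" for i
      using that zj P(1)[of i] by (auto simp: \<zeta>_def q)
    then have "\<exists>\<beta>\<in>sep L (v j). 0 < ev (fold dual_reflection ?q (\<zeta> j)) (- act (fold (toggle L) ?q (v j)) \<beta>)"
      using Suc const[of j] const[of "Suc j"] vc indep q(1)
      by (intro sep_fold_step[OF L]) (auto simp: vS)
    then obtain \<beta> where \<beta>: "\<beta> \<in> sep L u" "0 < ev (fold dual_reflection ?q (\<zeta> j)) (- act (v (Suc j)) \<beta>)"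
      using const[of j] by (auto simp: vS)
    have "- act (v (Suc j)) \<beta> \<in> positive_roots"
      using \<beta>(1) vc[of "Suc j"] L const[of "Suc j"] by (auto simp: sep_def R_iff positive_roots_minus act_roots)
    moreover have "fold dual_reflection ?q (\<zeta> j) i \<le> \<zeta> (Suc j) i" for i
    proof (cases "col i = even j")
      case True
      then show ?thesis
        using fold_dual_reflection[OF q(1) indep, where \<zeta> = "\<zeta> j" and k = i] by (simp add: q \<zeta>_def zS)
    next
      case False
      have nb: "col i' = even j" if "i' \<in> nbrs i" for i'
        using col[of i i'] that False by (auto simp: nbrs_def)
      then have "set ?q \<inter> nbrs i = nbrs i" by (auto simp: q)
      then have "fold dual_reflection ?q (\<zeta> j) i = P i * y j + (\<Sum>i'\<in>nbrs i. P i' * z j)"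
        using fold_dual_reflection[OF q(1) indep, where \<zeta> = "\<zeta> j" and k = i] False nb by (simp add: q \<zeta>_def)
      also have "(\<Sum>i'\<in>nbrs i. P i' * z j) = (\<Sum>i'\<in>nbrs i. P i') * z j"
        by (simp add: sum_distrib_right)
      also have "\<dots> \<le> (2 - \<epsilon>) * P i * z j" using super zj by (intro mult_right_mono) auto
      finally have "fold dual_reflection ?q (\<zeta> j) i \<le> P i * y j + (2 - \<epsilon>) * P i * z j" by simp
      moreover have "\<zeta> (Suc j) i = P i * (y j + (2 - \<epsilon>) * z j)"
        using False by (simp add: \<zeta>_def zS)
      ultimately show ?thesis by (simp add: algebra_simps)
    qed
    ultimately have "0 < ev (\<zeta> (Suc j)) (- act (v (Suc j)) \<beta>)"
      using ev_mono[of "- act (v (Suc j)) \<beta>" "fold dual_reflection ?q (\<zeta> j)" "\<zeta> (Suc j)"] \<beta>(2)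
      by (force simp: positive_roots_eq)
    then show ?case using \<beta>(1) by blast
  qed
  obtain \<beta> where \<beta>: "\<beta> \<in> sep L u" "0 < ev (\<zeta> J) (- act (v J) \<beta>)" using main[of J] by blast
  have "- act (v J) \<beta> \<in> positive_roots"
    using \<beta>(1) vc[of J] L const[of J] by (auto simp: sep_def R_iff positive_roots_minus act_roots)
  moreover have "\<zeta> J i \<le> 0" for i
  proof -
    have "J \<noteq> 0" using J1 z0(1) by (metis not_one_le_zero)
    then have "y J \<le> 0" using zS(2)[of "J - 1"] J2[of "J - 1"] by simp
    then show ?thesis using J1 P(1)[of i] by (auto simp: \<zeta>_def intro: mult_nonneg_nonpos)
  qed
  ultimately have "ev (\<zeta> J) (- act (v J) \<beta>) \<le> ev (\<lambda>_. 0) (- act (v J) \<beta>)"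
    by (intro ev_mono) (auto simp: positive_roots_eq)
  then show False using \<beta>(2) by (simp add: ev_def)
qed

theorem finite_futuristic:
  assumes "finite (carrier W)"
  shows futuristic
proof -
  obtain col :: "'i \<Rightarrow> bool" where col: "\<And>i j. adj i j \<Longrightarrow> col i \<noteq> col j" using ex_colouring by blast
  have "\<exists>q. distinct q \<and> set q = {i. col i = c}" for c
    using finite_distinct_list[of "{i. col i = c}"] by auto
  then obtain q where q: "\<And>c. distinct (q c)" "\<And>c. set (q c) = {i. col i = c}" by metis
  have "distinct (q True @ q False)" "set (q True @ q False) = UNIV" using q by auto
  then show ?thesis using futuristicI heavy_for_bipartite[OF assms col q] by blast
qed

end

section \<open>Infinite groups\<close>

context simply_laced_tree_system
begin

section \<open>The form \<open>B\<close> as a sum of squares, and bounds on roots\<close>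

definition supported :: "'i set \<Rightarrow> real ^ 'i \<Rightarrow> bool" where
  "supported J v \<longleftrightarrow> (\<forall>i. i \<notin> J \<longrightarrow> v $ i = 0)"

lemma B_expand: "B x y = (\<Sum>j\<in>UNIV. y $ j * B x (simple_root j))"
proof -
  have y: "y = (\<Sum>j\<in>UNIV. (y $ j) *\<^sub>R simple_root j)"
    by (simp add: vec_eq_iff simple_root_def axis_def if_distrib cong: if_cong)
  have "linear (\<lambda>v. B v x)" by (intro linearI) (simp_all add: B_add B_scale)
  then have "B (\<Sum>j\<in>UNIV. (y $ j) *\<^sub>R simple_root j) x = (\<Sum>j\<in>UNIV. B ((y $ j) *\<^sub>R simple_root j) x)"
    by (rule linear_sum)
  then have "B y x = (\<Sum>j\<in>UNIV. B ((y $ j) *\<^sub>R simple_root j) x)" by (simp only: flip: y)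
  moreover have "B ((y $ j) *\<^sub>R simple_root j) x = y $ j * B x (simple_root j)" for j
    using B_sym[of "simple_root j" x] by (simp add: B_scale)
  ultimately show ?thesis using B_sym[of x y] by simp
qed

text \<open>
  Weighted squares: a positive superharmonic function \<open>f\<close> on \<open>J\<close> exhibits the form \<open>B\<close> on \<open>J\<close> as a
  nonnegative combination of squares.
\<close>

lemma weighted_squares:
  assumes f: "\<And>i. i \<in> J \<Longrightarrow> 0 < f i" and x: "supported J x"
  defines "y \<equiv> \<lambda>i. x $ i / f i"
  shows "4 * B x x = (\<Sum>i\<in>J. \<Sum>j\<in>nbrs i \<inter> J. f i * f j * (y i - y j)\<^sup>2) +
    (\<Sum>i\<in>J. 2 * ((2 * f i - (\<Sum>j\<in>nbrs i \<inter> J. f j)) * f i * (y i)\<^sup>2))"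
proof -
  have xy: "x $ i = f i * y i" if "i \<in> J" for i using f[OF that] by (simp add: y_def)
  have B: "4 * B x x = (\<Sum>i\<in>J. 4 * (x $ i)\<^sup>2 - 2 * (\<Sum>j\<in>nbrs i \<inter> J. x $ i * x $ j))"
  proof -
    have "4 * B x x = (\<Sum>i\<in>UNIV. 4 * (x $ i * B x (simple_root i)))"
      by (subst B_expand) (simp add: sum_distrib_left)
    also have "\<dots> = (\<Sum>i\<in>J. 4 * (x $ i * B x (simple_root i)))"
      using x by (intro sum.mono_neutral_right) (auto simp: supported_def)
    also have "\<dots> = (\<Sum>i\<in>J. 4 * (x $ i)\<^sup>2 - 2 * (\<Sum>j\<in>nbrs i \<inter> J. x $ i * x $ j))"
    proof (rule sum.cong[OF HOL.refl])
      fix i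
      have "(\<Sum>j\<in>neighbours i. x $ j) = (\<Sum>j\<in>nbrs i \<inter> J. x $ j)"
        unfolding nbrs_eq using x by (intro sum.mono_neutral_right) (auto simp: supported_def)
      moreover have "(\<Sum>j\<in>nbrs i \<inter> J. x $ i * x $ j) = x $ i * (\<Sum>j\<in>nbrs i \<inter> J. x $ j)"
        by (simp add: sum_distrib_left)
      ultimately show "4 * (x $ i * B x (simple_root i)) = 4 * (x $ i)\<^sup>2 - 2 * (\<Sum>j\<in>nbrs i \<inter> J. x $ i * x $ j)"
        by (simp add: B_simple_root_right power2_eq_square algebra_simps)
    qed
    finally show ?thesis .
  qed
  \<comment> \<open>Every edge within \<open>J\<close> occurs in both directions, so the terms in
    \<open>y i\<close> and in \<open>y j\<close> have the same total.\<close>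
  have swap: "(\<Sum>i\<in>J. \<Sum>j\<in>nbrs i \<inter> J. f i * f j * (y j)\<^sup>2) = (\<Sum>i\<in>J. \<Sum>j\<in>nbrs i \<inter> J. f i * f j * (y i)\<^sup>2)"
  proof -
    have "(\<Sum>i\<in>J. \<Sum>j\<in>nbrs i \<inter> J. g i j) = (\<Sum>i\<in>J. \<Sum>j\<in>J. if adj i j then g i j else 0)"
      for g :: "'i \<Rightarrow> 'i \<Rightarrow> real"
      by (intro sum.cong HOL.refl sum.mono_neutral_cong_left) (auto simp: nbrs_def)
    moreover have "(\<Sum>i\<in>J. \<Sum>j\<in>J. if adj i j then f i * f j * (y j)\<^sup>2 else 0)
        = (\<Sum>i\<in>J. \<Sum>j\<in>J. if adj i j then f i * f j * (y i)\<^sup>2 else 0)"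
      by (subst sum.swap, intro sum.cong HOL.refl) (auto simp: adj_sym mult.commute)
    ultimately show ?thesis by (simp only:)
  qed
  have "(\<Sum>i\<in>J. \<Sum>j\<in>nbrs i \<inter> J. f i * f j * (y i - y j)\<^sup>2)
      = (\<Sum>i\<in>J. \<Sum>j\<in>nbrs i \<inter> J. f i * f j * (y i)\<^sup>2) + (\<Sum>i\<in>J. \<Sum>j\<in>nbrs i \<inter> J. f i * f j * (y j)\<^sup>2)
        - (\<Sum>i\<in>J. \<Sum>j\<in>nbrs i \<inter> J. 2 * (x $ i * x $ j))"
    unfolding sum.distrib[symmetric] sum_subtractf[symmetric]
    by (intro sum.cong HOL.refl) (auto simp: xy power2_eq_square algebra_simps)
  also have "\<dots> = (\<Sum>i\<in>J. 2 * (\<Sum>j\<in>nbrs i \<inter> J. f i * f j * (y i)\<^sup>2) - 2 * (\<Sum>j\<in>nbrs i \<inter> J. x $ i * x $ j))"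
    unfolding swap by (simp add: sum_subtractf sum_distrib_left)
  finally have "(\<Sum>i\<in>J. \<Sum>j\<in>nbrs i \<inter> J. f i * f j * (y i - y j)\<^sup>2)
      + (\<Sum>i\<in>J. 2 * ((2 * f i - (\<Sum>j\<in>nbrs i \<inter> J. f j)) * f i * (y i)\<^sup>2))
    = (\<Sum>i\<in>J. 2 * (\<Sum>j\<in>nbrs i \<inter> J. f i * f j * (y i)\<^sup>2) - 2 * (\<Sum>j\<in>nbrs i \<inter> J. x $ i * x $ j)
        + 2 * ((2 * f i - (\<Sum>j\<in>nbrs i \<inter> J. f j)) * f i * (y i)\<^sup>2))"
    by (simp add: sum.distrib)
  also have "\<dots> = (\<Sum>i\<in>J. 4 * (x $ i)\<^sup>2 - 2 * (\<Sum>j\<in>nbrs i \<inter> J. x $ i * x $ j))"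
  proof (rule sum.cong[OF HOL.refl])
    fix i assume "i \<in> J"
    have "(\<Sum>j\<in>nbrs i \<inter> J. f i * f j * (y i)\<^sup>2) = (\<Sum>j\<in>nbrs i \<inter> J. f j) * (f i * (y i)\<^sup>2)"
      by (simp add: sum_distrib_left sum_distrib_right mult_ac)
    then show "2 * (\<Sum>j\<in>nbrs i \<inter> J. f i * f j * (y i)\<^sup>2) - 2 * (\<Sum>j\<in>nbrs i \<inter> J. x $ i * x $ j)
        + 2 * ((2 * f i - (\<Sum>j\<in>nbrs i \<inter> J. f j)) * f i * (y i)\<^sup>2)
      = 4 * (x $ i)\<^sup>2 - 2 * (\<Sum>j\<in>nbrs i \<inter> J. x $ i * x $ j)"
      by (simp add: xy[OF \<open>i \<in> J\<close>] power2_eq_square algebra_simps)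
  qed
  finally show ?thesis using B by simp
qed

definition connected_on :: "'i set \<Rightarrow> bool" where
  "connected_on J \<longleftrightarrow> (\<forall>i\<in>J. \<forall>j\<in>J. (\<lambda>a b. adj a b \<and> a \<in> J \<and> b \<in> J)\<^sup>*\<^sup>* i j)"

definition superharmonic_on :: "'i set \<Rightarrow> ('i \<Rightarrow> real) \<Rightarrow> bool" where
  "superharmonic_on J f \<longleftrightarrow> (\<forall>i\<in>J. 0 < f i \<and> (\<Sum>j\<in>nbrs i \<inter> J. f j) \<le> 2 * f i)"

text \<open>A root has \<open>B \<beta> \<beta> = 1\<close>, so the weighted squares add up to 4.
  All of them are nonnegative, and each single one is at most 4.\<close>

lemma root_edge_bound:
  assumes "superharmonic_on J f" "\<beta> \<in> roots" "supported J \<beta>"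
  shows "i \<in> J \<Longrightarrow> j \<in> J \<Longrightarrow> adj i j \<Longrightarrow> f i * f j * (\<beta> $ i / f i - \<beta> $ j / f j)\<^sup>2 \<le> 4"
    and "i \<in> J \<Longrightarrow> 2 * ((2 * f i - (\<Sum>j\<in>nbrs i \<inter> J. f j)) * f i * (\<beta> $ i / f i)\<^sup>2) \<le> 4"
proof -
  define g h where "g i j = f i * f j * (\<beta> $ i / f i - \<beta> $ j / f j)\<^sup>2"
    and "h i = 2 * ((2 * f i - (\<Sum>j\<in>nbrs i \<inter> J. f j)) * f i * (\<beta> $ i / f i)\<^sup>2)" for i j
  have g0: "0 \<le> g i j" if "i \<in> J" "j \<in> J" for i j
    unfolding g_def using assms(1) that
    by (intro mult_nonneg_nonneg zero_le_power2) (auto simp: superharmonic_on_def less_imp_le)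
  have h0: "0 \<le> h i" if "i \<in> J" for i
    using assms(1) that by (auto simp: h_def superharmonic_on_def intro!: mult_nonneg_nonneg)
  have "(\<Sum>i\<in>J. \<Sum>j\<in>nbrs i \<inter> J. g i j) + (\<Sum>i\<in>J. h i) = 4"
    using weighted_squares[of J f \<beta>] assms B_roots[OF assms(2)]
    by (simp add: superharmonic_on_def g_def h_def)
  moreover have "0 \<le> (\<Sum>i\<in>J. h i)" "0 \<le> (\<Sum>i\<in>J. \<Sum>j\<in>nbrs i \<inter> J. g i j)"
    by (auto intro!: sum_nonneg g0 h0)
  ultimately have le: "(\<Sum>i\<in>J. \<Sum>j\<in>nbrs i \<inter> J. g i j) \<le> 4" "(\<Sum>i\<in>J. h i) \<le> 4" by auto
  show "f i * f j * (\<beta> $ i / f i - \<beta> $ j / f j)\<^sup>2 \<le> 4" if "i \<in> J" "j \<in> J" "adj i j"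
  proof -
    have "g i j \<le> (\<Sum>j\<in>nbrs i \<inter> J. g i j)"
      using that g0 by (intro member_le_sum) (auto simp: nbrs_def)
    also have "\<dots> \<le> (\<Sum>i\<in>J. \<Sum>j\<in>nbrs i \<inter> J. g i j)"
      using that g0 by (intro member_le_sum[of i J "\<lambda>i. \<Sum>j\<in>nbrs i \<inter> J. g i j"]) (auto intro!: sum_nonneg)
    finally show ?thesis using le by (simp add: g_def)
  qed
  show "2 * ((2 * f i - (\<Sum>j\<in>nbrs i \<inter> J. f j)) * f i * (\<beta> $ i / f i)\<^sup>2) \<le> 4" if "i \<in> J"
  proof -
    have "h i \<le> (\<Sum>i\<in>J. h i)" using that h0 by (intro member_le_sum) auto
    then show ?thesis using le unfolding h_def by linarith
  qed
qed

text \<open>The edge bounds add up along paths in \<open>J\<close>: the quotient of a root by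
  \<open>f\<close> is constant up to a bounded error. For an affine diagram this says that the roots
  stay close to the line of the null vector.\<close>

lemma root_spread_bound:
  assumes "superharmonic_on J f" "connected_on J"
  shows "\<exists>C. \<forall>\<beta>. \<beta> \<in> roots \<and> supported J \<beta> \<longrightarrow> (\<forall>i\<in>J. \<forall>j\<in>J. \<bar>\<beta> $ i / f i - \<beta> $ j / f j\<bar> \<le> C)"
proof -
  have "\<exists>C. \<forall>\<beta>. \<beta> \<in> roots \<and> supported J \<beta> \<longrightarrow> i \<in> J \<longrightarrow> j \<in> J \<longrightarrow> \<bar>\<beta> $ i / f i - \<beta> $ j / f j\<bar> \<le> C" for i j
  proof (cases "i \<in> J \<and> j \<in> J")
    case True
    then have "(\<lambda>a b. adj a b \<and> a \<in> J \<and> b \<in> J)\<^sup>*\<^sup>* i j" using assms(2) by (simp add: connected_on_def)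
    then have "\<exists>C. \<forall>\<beta>. \<beta> \<in> roots \<and> supported J \<beta> \<longrightarrow> \<bar>\<beta> $ i / f i - \<beta> $ j / f j\<bar> \<le> C"
    proof (induction rule: rtranclp_induct)
      case base
      show ?case by (intro exI[of _ 0]) simp
    next
      case (step a b)
      then obtain C where C: "\<And>\<beta>. \<beta> \<in> roots \<Longrightarrow> supported J \<beta> \<Longrightarrow> \<bar>\<beta> $ i / f i - \<beta> $ a / f a\<bar> \<le> C" by blast
      have pos: "0 < f a * f b" using step(2) assms(1) by (simp add: superharmonic_on_def)
      have "\<bar>\<beta> $ i / f i - \<beta> $ b / f b\<bar> \<le> C + sqrt (4 / (f a * f b))" if \<beta>: "\<beta> \<in> roots" "supported J \<beta>" for \<beta>
      proof -
        have "(\<beta> $ a / f a - \<beta> $ b / f b)\<^sup>2 \<le> 4 / (f a * f b)"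
          using root_edge_bound(1)[OF assms(1) \<beta>, of a b] step(2) pos by (simp add: field_simps)
        then have "\<bar>\<beta> $ a / f a - \<beta> $ b / f b\<bar> \<le> sqrt (4 / (f a * f b))"
          using real_le_rsqrt by (metis power2_abs)
        then show ?thesis using C[OF \<beta>] by linarith
      qed
      then show ?case by blast
    qed
    then show ?thesis by blast
  qed simp
  then obtain C where C: "\<And>i j \<beta>. \<beta> \<in> roots \<Longrightarrow> supported J \<beta> \<Longrightarrow> i \<in> J \<Longrightarrow> j \<in> J \<Longrightarrow>
      \<bar>\<beta> $ i / f i - \<beta> $ j / f j\<bar> \<le> C i j" by metis
  have "C i j \<le> (MAX (i, j)\<in>UNIV. C i j)" for i j
    by (rule Max_ge) (auto intro: image_eqI[of _ _ "(i, j)"])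
  then show ?thesis using C order_trans by meson
qed

lemma finite_integer_box: "finite {v :: real ^ 'i. \<forall>i. v $ i \<in> \<int> \<and> \<bar>v $ i\<bar> \<le> M}"
proof (rule finite_subset)
  define N where "N = \<lceil>M\<rceil>"
  show "{v :: real ^ 'i. \<forall>i. v $ i \<in> \<int> \<and> \<bar>v $ i\<bar> \<le> M}
      \<subseteq> (\<lambda>g. \<chi> i. real_of_int (g i)) ` PiE (UNIV :: 'i set) (\<lambda>_. {- N..N})"
  proof
    fix v :: "real ^ 'i" assume v: "v \<in> {v. \<forall>i. v $ i \<in> \<int> \<and> \<bar>v $ i\<bar> \<le> M}"
    define g where "g i = \<lfloor>v $ i\<rfloor>" for i
    have vg: "v $ i = real_of_int (g i)" for i using v by (auto simp: g_def Ints_def)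
    then have "v = (\<chi> i. real_of_int (g i))" by (simp add: vec_eq_iff)
    moreover have "g i \<in> {- N..N}" for i
    proof -
      have "\<bar>real_of_int (g i)\<bar> \<le> M" using v vg by (metis (mono_tags, lifting) mem_Collect_eq)
      then show ?thesis unfolding N_def by (simp add: abs_le_iff) linarith
    qed
    ultimately show "v \<in> (\<lambda>g. \<chi> i. real_of_int (g i)) ` PiE UNIV (\<lambda>_. {- N..N})" by auto
  qed
  show "finite ((\<lambda>g. \<chi> i. real_of_int (g i) :: real ^ 'i) ` PiE (UNIV :: 'i set) (\<lambda>_. {- N..N}))"
    by (intro finite_imageI finite_PiE) auto
qed

text \<open>The strict inequality bounds the coordinate of a root at \<open>i0\<close>, and the
  spread bound carries this to all vertices; only finitely many integer vectors remain.\<close>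

lemma finite_if_superharmonic:
  assumes "superharmonic f i0"
  shows "finite (carrier W)"
proof -
  have f: "superharmonic_on UNIV f" "\<And>i. 0 < f i" and strict: "0 < 2 * f i0 - (\<Sum>j\<in>nbrs i0. f j)"
    using assms by (auto simp: superharmonic_def superharmonic_on_def)
  have "connected_on UNIV"
    using adj_tree by (simp add: connected_on_def is_tree_def graph_connected_def)
  then obtain C where C: "\<And>\<beta> i j. \<beta> \<in> roots \<Longrightarrow> \<bar>\<beta> $ i / f i - \<beta> $ j / f j\<bar> \<le> C"
    using root_spread_bound[OF f(1)] by (auto simp: supported_def)
  define e where "e = 2 * ((2 * f i0 - (\<Sum>j\<in>nbrs i0. f j)) * f i0)"
  have e: "0 < e" using strict f by (simp add: e_def)
  define M where "M = Max (range f) * (C + sqrt (4 / e))"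
  have "\<bar>\<beta> $ i\<bar> \<le> M" if \<beta>: "\<beta> \<in> roots" for \<beta> i
  proof -
    have "e * (\<beta> $ i0 / f i0)\<^sup>2 = 2 * ((2 * f i0 - (\<Sum>j\<in>nbrs i0 \<inter> UNIV. f j)) * f i0 * (\<beta> $ i0 / f i0)\<^sup>2)"
      by (simp add: e_def)
    also have "\<dots> \<le> 4" using root_edge_bound(2)[OF f(1) \<beta>, of i0] by (simp only: supported_def UNIV_I simp_thms)
    finally have "e * (\<beta> $ i0 / f i0)\<^sup>2 \<le> 4" .
    then have "(\<beta> $ i0 / f i0)\<^sup>2 \<le> 4 / e" using e by (simp add: field_simps)
    then have "\<bar>\<beta> $ i0 / f i0\<bar> \<le> sqrt (4 / e)" using real_le_rsqrt by (metis power2_abs)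
    then have "\<bar>\<beta> $ i / f i\<bar> \<le> C + sqrt (4 / e)" using C[OF \<beta>, of i i0] by linarith
    moreover have "f i \<le> Max (range f)" by simp
    moreover from this have "0 \<le> Max (range f)" using f(2)[of i] by linarith
    ultimately have "f i * \<bar>\<beta> $ i / f i\<bar> \<le> Max (range f) * (C + sqrt (4 / e))"
      using f(2)[of i] by (intro mult_mono) auto
    then show ?thesis using f(2)[of i] by (simp add: M_def abs_mult)
  qed
  then have "roots \<subseteq> {v. \<forall>i. v $ i \<in> \<int> \<and> \<bar>v $ i\<bar> \<le> M}" using roots_Ints by auto
  then have "finite roots" using finite_integer_box by (rule finite_subset)
  then show ?thesis by (rule finite_if_finite_roots)
qed


subsection \<open>Chambers in an affine parabolic subgroup\<close>

text \<open>Harmonicity means that \<delta>, extended by 0, is orthogonal to all simple roots in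
  \<open>J\<close>: it is the null vector of the affine diagram, a multiple of the positive
  imaginary root.\<close>

definition affine_on :: "'i set \<Rightarrow> ('i \<Rightarrow> real) \<Rightarrow> bool" where
  "affine_on J \<delta> \<longleftrightarrow> J \<noteq> {} \<and> connected_on J \<and> (\<forall>i\<in>J. 0 < \<delta> i \<and> (\<Sum>j\<in>nbrs i \<inter> J. \<delta> j) = 2 * \<delta> i)"

text \<open>The walls of the parabolic subgroup of \<open>J\<close> that separate \<zeta> from the
  fundamental chamber.\<close>

definition negative_roots :: "'i set \<Rightarrow> ('i \<Rightarrow> real) \<Rightarrow> (real ^ 'i) set" where
  "negative_roots J \<zeta> = {\<beta> \<in> positive_roots. supported J \<beta> \<and> ev \<zeta> \<beta> < 0}"

lemma ev_supported: "supported J v \<Longrightarrow> ev \<zeta> v = (\<Sum>i\<in>J. \<zeta> i * v $ i)"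
  unfolding ev_def by (intro sum.mono_neutral_right) (auto simp: supported_def)

text \<open>A root supported on \<open>J\<close> is a multiple of \<delta> up to a bounded error, so
  \<zeta> takes on it that multiple of \<zeta>(\<delta>), again up to a bounded error. As
  \<zeta>(\<delta>) is positive, a negative value bounds the multiple, and integrality leaves
  finitely many roots.\<close>

lemma finite_negative_roots:
  assumes J: "affine_on J \<delta>" and \<zeta>: "0 < (\<Sum>i\<in>J. \<zeta> i * \<delta> i)"
  shows "finite (negative_roots J \<zeta>)"
proof -
  have \<delta>: "\<And>i. i \<in> J \<Longrightarrow> 0 < \<delta> i" and ne: "J \<noteq> {}" using J by (auto simp: affine_on_def)
  have "superharmonic_on J \<delta>" "connected_on J" using J by (auto simp: affine_on_def superharmonic_on_def)
  then obtain C where C: "\<And>\<beta> i j. \<beta> \<in> roots \<Longrightarrow> supported J \<beta> \<Longrightarrow> i \<in> J \<Longrightarrow> j \<in> J \<Longrightarrow>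
      \<bar>\<beta> $ i / \<delta> i - \<beta> $ j / \<delta> j\<bar> \<le> C" using root_spread_bound by blast
  obtain k where k: "k \<in> J" using ne by blast
  define S where "S = (\<Sum>i\<in>J. \<zeta> i * \<delta> i)"
  define D where "D = (\<Sum>i\<in>J. \<bar>\<zeta> i * \<delta> i\<bar> * C)"
  define M where "M = Max (insert 0 (\<delta> ` J)) * (D / S + C)"
  have "\<bar>\<beta> $ i\<bar> \<le> M" if \<beta>: "\<beta> \<in> negative_roots J \<zeta>" for \<beta> i
  proof -
    have b: "\<beta> \<in> roots" "supported J \<beta>" "nonneg \<beta>" "ev \<zeta> \<beta> < 0"
      using \<beta> by (auto simp: negative_roots_def positive_roots_eq)
    define y where "y i = \<beta> $ i / \<delta> i" for i
    have C0: "0 \<le> C" using C[OF b(1,2) k k] by simp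
    have "ev \<zeta> \<beta> = (\<Sum>i\<in>J. \<zeta> i * \<delta> i * y k + \<zeta> i * \<delta> i * (y i - y k))"
      unfolding ev_supported[OF b(2)]
    proof (rule sum.cong[OF HOL.refl])
      fix i assume "i \<in> J"
      then have "\<delta> i * y i = \<beta> $ i" using \<delta>[of i] by (simp add: y_def)
      then show "\<zeta> i * \<beta> $ i = \<zeta> i * \<delta> i * y k + \<zeta> i * \<delta> i * (y i - y k)"
        by (simp add: algebra_simps flip: \<open>\<delta> i * y i = \<beta> $ i\<close>)
    qed
    also have "\<dots> = S * y k + (\<Sum>i\<in>J. \<zeta> i * \<delta> i * (y i - y k))"
      by (simp add: sum.distrib S_def sum_distrib_right)
    finally have "ev \<zeta> \<beta> = S * y k + (\<Sum>i\<in>J. \<zeta> i * \<delta> i * (y i - y k))" .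
    moreover have "(\<Sum>i\<in>J. \<zeta> i * \<delta> i * (y i - y k)) \<ge> - D"
    proof -
      have "- (\<bar>\<zeta> i * \<delta> i\<bar> * C) \<le> \<zeta> i * \<delta> i * (y i - y k)" if "i \<in> J" for i
      proof -
        have "\<bar>\<zeta> i * \<delta> i * (y i - y k)\<bar> \<le> \<bar>\<zeta> i * \<delta> i\<bar> * C"
          unfolding abs_mult[of "\<zeta> i * \<delta> i"] using C[OF b(1,2) that k] by (intro mult_left_mono) (auto simp: y_def)
        then show ?thesis by linarith
      qed
      then show ?thesis unfolding D_def by (simp add: sum_mono flip: sum_negf)
    qed
    ultimately have "S * y k \<le> D" using b(4) by linarith
    then have yk: "y k \<le> D / S" using \<zeta> by (simp add: S_def field_simps)
    have y0: "0 \<le> y k" using b(3) \<delta>[OF k] by (simp add: y_def nonneg_def)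
    have M0: "0 \<le> Max (insert 0 (\<delta> ` J))" by (intro Max_ge) auto
    show ?thesis
    proof (cases "i \<in> J")
      case False
      then have "\<beta> $ i = 0" using b(2) by (simp add: supported_def)
      then show ?thesis using M0 C0 yk y0 by (auto simp: M_def intro!: mult_nonneg_nonneg)
    next
      case True
      have "y i \<le> D / S + C" using C[OF b(1,2) True k] yk by (simp add: y_def)
      then have "\<delta> i * y i \<le> M"
        unfolding M_def using True \<delta>[OF True] b(3) M0 by (intro mult_mono) (auto simp: y_def nonneg_def)
      moreover have "\<delta> i * y i = \<bar>\<beta> $ i\<bar>" using \<delta>[OF True] b(3) by (simp add: y_def nonneg_def)
      ultimately show ?thesis by simp
    qed
  qed
  then have "negative_roots J \<zeta> \<subseteq> {v. \<forall>i. v $ i \<in> \<int> \<and> \<bar>v $ i\<bar> \<le> M}"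
    using roots_Ints by (auto simp: negative_roots_def positive_roots_eq)
  then show ?thesis using finite_integer_box by (rule finite_subset)
qed

lemma supported_reflection: "i \<in> J \<Longrightarrow> supported J v \<Longrightarrow> supported J (reflection i v)"
  by (auto simp: supported_def reflection_nth)

lemma supported_act_word: "set q \<subseteq> J \<Longrightarrow> supported J v \<Longrightarrow> supported J (act (word q) v)"
  unfolding act_word by (induction q) (auto simp: supported_reflection)

lemma supported_simple_root: "i \<in> J \<Longrightarrow> supported J (simple_root i)"
  by (auto simp: supported_def simple_root_def axis_def)

lemma act_word_outside: "set q \<subseteq> J \<Longrightarrow> i \<notin> J \<Longrightarrow> act (word q) v $ i = v $ i"
  unfolding act_word by (induction q) (auto simp: reflection_nth)

lemma ev_act_word: "ev \<zeta> (act (word c) v) = ev (fold dual_reflection c \<zeta>) v"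
  unfolding act_word by (induction c arbitrary: \<zeta>) (auto simp: ev_reflection)

text \<open>The numbers game on \<open>J\<close>: firing a vertex with negative value removes its
  simple root from the negative roots and maps those of the new functional into the remaining old
  ones. Their number drops, so the game ends with a functional nonnegative on \<open>J\<close>; the
  fired letters, read backwards, form \<open>q\<close>.\<close>

lemma ex_chamber:
  assumes "finite (negative_roots J \<zeta>)"
  shows "\<exists>q. set q \<subseteq> J \<and> (\<forall>\<beta>\<in>roots. supported J \<beta> \<longrightarrow> 0 < ev \<zeta> \<beta> \<longrightarrow> act (word q) \<beta> \<in> positive_roots)"
  using assms
proof (induction "card (negative_roots J \<zeta>)" arbitrary: \<zeta> rule: less_induct)
  case less
  show ?case
  proof (cases "\<exists>i\<in>J. \<zeta> i < 0")
    case False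
    have "\<beta> \<in> positive_roots" if \<beta>: "\<beta> \<in> roots" "supported J \<beta>" "0 < ev \<zeta> \<beta>" for \<beta>
    proof (rule ccontr)
      assume "\<beta> \<notin> positive_roots"
      then have "nonneg (- \<beta>)" using \<beta>(1) positive_roots_minus by (auto simp: positive_roots_eq)
      then have "ev \<zeta> \<beta> \<le> 0"
        unfolding ev_supported[OF \<beta>(2)] using False
        by (intro sum_nonpos) (auto simp: nonneg_def not_less intro: mult_nonneg_nonpos)
      then show False using \<beta>(3) by simp
    qed
    then show ?thesis by (intro exI[of _ "[]"]) (simp add: act_one)
  next
    case True
    then obtain i where i: "i \<in> J" "\<zeta> i < 0" by blast
    let ?\<zeta> = "dual_reflection i \<zeta>"
    have sub: "negative_roots J ?\<zeta> \<subseteq> reflection i ` (negative_roots J \<zeta> - {simple_root i})"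
    proof
      fix \<beta> assume \<beta>: "\<beta> \<in> negative_roots J ?\<zeta>"
      then have b: "\<beta> \<in> positive_roots" "supported J \<beta>" "ev ?\<zeta> \<beta> < 0" by (auto simp: negative_roots_def)
      have "ev ?\<zeta> (simple_root i) > 0" using i by (simp add: dual_reflection_def)
      then have "\<beta> \<noteq> simple_root i" using b(3) by auto
      then have "reflection i \<beta> \<in> negative_roots J \<zeta>"
        using b reflection_positive supported_reflection[OF i(1)]
        by (auto simp: negative_roots_def ev_reflection)
      moreover have "reflection i \<beta> \<noteq> simple_root i"
      proof
        assume "reflection i \<beta> = simple_root i"
        then have "\<beta> = - simple_root i"
          using reflection_reflection[of i \<beta>] reflection_simple_root[of i i] by simp
        then show False
          using b(1) positive_roots_minus[OF simple_root_in_roots[of i]] simple_root_positive[of i] by simp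
      qed
      moreover have "\<beta> = reflection i (reflection i \<beta>)" by (simp add: reflection_reflection)
      ultimately show "\<beta> \<in> reflection i ` (negative_roots J \<zeta> - {simple_root i})" by blast
    qed
    have "simple_root i \<in> negative_roots J \<zeta>"
      using i by (simp add: negative_roots_def simple_root_positive supported_simple_root)
    then have "card (negative_roots J \<zeta> - {simple_root i}) < card (negative_roots J \<zeta>)"
      using less.prems by (intro card_Diff1_less)
    moreover have "card (negative_roots J ?\<zeta>) \<le> card (negative_roots J \<zeta> - {simple_root i})"
      using sub less.prems by (meson card_image_le card_mono finite_Diff finite_imageI order_trans)
    ultimately have lt: "card (negative_roots J ?\<zeta>) < card (negative_roots J \<zeta>)" by linarith
    have "finite (negative_roots J ?\<zeta>)"
      using sub less.prems by (meson finite_Diff finite_imageI finite_subset)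
    from less.hyps[OF lt this] obtain q where q: "set q \<subseteq> J"
      "\<And>\<beta>. \<beta> \<in> roots \<Longrightarrow> supported J \<beta> \<Longrightarrow> 0 < ev ?\<zeta> \<beta> \<Longrightarrow> act (word q) \<beta> \<in> positive_roots" by blast
    have "act (word (q @ [i])) \<beta> \<in> positive_roots"
      if "\<beta> \<in> roots" "supported J \<beta>" "0 < ev \<zeta> \<beta>" for \<beta>
    proof -
      have "ev ?\<zeta> (reflection i \<beta>) = ev \<zeta> \<beta>" by (simp add: ev_reflection dual_reflection_involution)
      then have "act (word q) (reflection i \<beta>) \<in> positive_roots"
        using q(2) that reflection_roots supported_reflection[OF i(1)] by simp
      then show ?thesis by (simp add: act_word)
    qed
    then show ?thesis using q(1) i(1) by (intro exI[of _ "q @ [i]"]) auto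
  qed
qed


subsection \<open>Trapped orbits\<close>

definition convex_closure :: "'w set \<Rightarrow> 'w set" where
  "convex_closure X = carrier W \<inter> (\<Inter>\<beta>\<in>{\<beta> \<in> roots. \<forall>x\<in>X. act x \<beta> \<in> positive_roots}. half_space \<beta>)"

lemma convex_closure_convex: "convex_subset (convex_closure X)"
  unfolding convex_subset_def convex_closure_def by blast

lemma R_closure:
  assumes "X \<subseteq> carrier W"
  shows "R (convex_closure X) = {\<beta> \<in> roots. \<forall>x\<in>X. act x \<beta> \<in> positive_roots}"
    and "X \<subseteq> convex_closure X"
proof -
  show *: "X \<subseteq> convex_closure X" using assms by (auto simp: convex_closure_def half_space_def)
  show "R (convex_closure X) = {\<beta> \<in> roots. \<forall>x\<in>X. act x \<beta> \<in> positive_roots}"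
  proof
    show "R (convex_closure X) \<subseteq> {\<beta> \<in> roots. \<forall>x\<in>X. act x \<beta> \<in> positive_roots}"
      using * by (auto simp: R_iff[OF convex_closure_convex])
    show "{\<beta> \<in> roots. \<forall>x\<in>X. act x \<beta> \<in> positive_roots} \<subseteq> R (convex_closure X)"
      by (auto simp: R_def convex_closure_def)
  qed
qed

text \<open>
  The letters at which the toggles move the point, for the convex hull of two points lying in the
  chambers of \<open>\<zeta>\<^sub>1\<close> and \<open>\<zeta>\<^sub>2\<close>; the functionals are transported along with the moving point.
\<close>

fun crossings :: "'i list \<Rightarrow> ('i \<Rightarrow> real) \<Rightarrow> ('i \<Rightarrow> real) \<Rightarrow> 'i list option" where
  "crossings [] \<zeta>\<^sub>1 \<zeta>\<^sub>2 = Some []"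
| "crossings (i # p) \<zeta>\<^sub>1 \<zeta>\<^sub>2 =
    (if 0 < \<zeta>\<^sub>1 i \<and> 0 < \<zeta>\<^sub>2 i then crossings p \<zeta>\<^sub>1 \<zeta>\<^sub>2
     else if \<zeta>\<^sub>1 i * \<zeta>\<^sub>2 i < 0
       then map_option ((#) i) (crossings p (dual_reflection i \<zeta>\<^sub>1) (dual_reflection i \<zeta>\<^sub>2))
     else None)"

lemma inv_word: "inv (word p) = word (rev p)"
  by (induction p) (auto simp: inv_mult_group s_closed inv_s word_append)

lemma positive_if_ev_positive:
  assumes "\<beta> \<in> roots" "\<And>i. 0 < \<zeta> i" "0 < ev \<zeta> \<beta>"
  shows "\<beta> \<in> positive_roots"
proof (rule ccontr)
  assume "\<beta> \<notin> positive_roots"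
  then have "- \<beta> \<in> positive_roots" using assms(1) positive_roots_minus by blast
  then show False using ev_positive[of "- \<beta>" \<zeta>] assms by (simp add: ev_minus)
qed

text \<open>The constant functional 1 lies inside the fundamental chamber, so \<open>word c\<close>
  keeps the simple roots of \<open>J\<close> positive if its transported values are positive. A
  simple root outside \<open>J\<close> keeps its own coordinate 1 and is positive anyway.\<close>

lemma word_eq_one:
  assumes c: "set c \<subseteq> J" and pos: "\<And>i. i \<in> J \<Longrightarrow> 0 < fold dual_reflection c (\<lambda>_. 1) i"
  shows "word (rev c) = \<one>"
proof -
  have "act (word c) (simple_root i) \<in> positive_roots" for i
  proof (cases "i \<in> J")
    case True
    then show ?thesis
      using pos[OF True] by (intro positive_if_ev_positive[where \<zeta> = "\<lambda>_. 1"] rootsI) (auto simp: ev_act_word)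
  next
    case False
    then have "act (word c) (simple_root i) $ i = 1"
      using act_word_outside[OF c False] by (simp add: simple_root_def axis_def)
    then show ?thesis using positive_rootI[of _ i] rootsI[of "word c" i] by simp
  qed
  then have "word c = \<one>" by (intro eq_one_if_simple_roots_positive) auto
  then show ?thesis using inv_word[of c] by simp
qed

text \<open>At the point \<open>word (rev c)\<close> the root tested by the toggle at
  \<open>i\<close> is \<open>act (word c) (simple_root i)\<close>, so the signs of the transported
  functionals at \<open>i\<close> tell on which sides of the wall the two points lie. A letter
  outside \<open>J\<close> is never crossed: its root has coordinate 1 there at both points.\<close>

lemma fold_toggle_crossings:
  assumes q: "set q\<^sub>1 \<subseteq> J" "set q\<^sub>2 \<subseteq> J"
    and chamber: "\<And>\<beta>. \<beta> \<in> roots \<Longrightarrow> supported J \<beta> \<Longrightarrow> 0 < ev \<zeta>\<^sub>1 \<beta> \<Longrightarrow> act (word q\<^sub>1) \<beta> \<in> positive_roots"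
      "\<And>\<beta>. \<beta> \<in> roots \<Longrightarrow> supported J \<beta> \<Longrightarrow> 0 < ev \<zeta>\<^sub>2 \<beta> \<Longrightarrow> act (word q\<^sub>2) \<beta> \<in> positive_roots"
  defines "L \<equiv> convex_closure {word q\<^sub>1, word q\<^sub>2}"
  shows "set c \<subseteq> J \<Longrightarrow>
    crossings (filter (\<lambda>i. i \<in> J) p) (fold dual_reflection c \<zeta>\<^sub>1) (fold dual_reflection c \<zeta>\<^sub>2) = Some d \<Longrightarrow>
    fold (toggle L) p (word (rev c)) = word (rev (c @ d)) \<and> set d \<subseteq> J"
proof (induction p arbitrary: c d)
  case Nil
  then show ?case by simp
next
  case (Cons i p)
  define v where "v = act (word c) (simple_root i)"
  have RL: "R L = {\<beta> \<in> roots. act (word q\<^sub>1) \<beta> \<in> positive_roots \<and> act (word q\<^sub>2) \<beta> \<in> positive_roots}"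
    unfolding L_def by (subst R_closure) auto
  have v: "v \<in> roots" by (simp add: v_def rootsI)
  have t: "toggle L i (word (rev c)) = (if v \<in> R L then word (rev c) else word (rev (c @ [i])))"
    using inv_word[of "rev c"] by (simp add: toggle_def v_def)
  show ?case
  proof (cases "i \<in> J")
    case False
    have "act (word q) v $ i = 1" if "set q \<subseteq> J" for q
      unfolding v_def using act_word_outside[OF that False] act_word_outside[OF Cons.prems(1) False]
      by (simp add: simple_root_def axis_def)
    then have "v \<in> R L"
      using v q positive_rootI[OF act_roots[OF word_closed v], of _ i] by (auto simp: RL)
    then show ?thesis using Cons False t by simp
  next
    case True
    have sup: "supported J v"
      unfolding v_def using Cons.prems(1) True supported_act_word supported_simple_root by blast
    have ev: "ev \<zeta> v = fold dual_reflection c \<zeta> i" for \<zeta> by (simp add: v_def ev_act_word)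
    let ?z1 = "fold dual_reflection c \<zeta>\<^sub>1" and ?z2 = "fold dual_reflection c \<zeta>\<^sub>2"
    consider "0 < ?z1 i" "0 < ?z2 i"
      | "\<not> (0 < ?z1 i \<and> 0 < ?z2 i)" "?z1 i * ?z2 i < 0"
      using Cons.prems(2) True by (auto split: if_splits)
    then show ?thesis
    proof cases
      case 1
      then have "v \<in> R L" using chamber sup v by (simp add: RL ev)
      then show ?thesis using Cons.IH[OF Cons.prems(1)] Cons.prems(2) True t 1 by simp
    next
      case 2
      have neg: "act (word q) v \<notin> positive_roots" if "act (word q) (- v) \<in> positive_roots" for q
        using that positive_roots_minus[of "act (word q) v"] v by (simp add: act_minus act_roots)
      have sup': "supported J (- v)" using sup by (simp add: supported_def)
      have "?z1 i < 0 \<or> ?z2 i < 0" using 2(2) by (auto simp: mult_less_0_iff)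
      then have "v \<notin> R L"
        using neg[of q\<^sub>1] neg[of q\<^sub>2] chamber[of "- v"] sup' minus_roots[OF v] by (auto simp: RL ev ev_minus)
      moreover obtain d' where d': "d = i # d'"
        "crossings (filter (\<lambda>i. i \<in> J) p) (fold dual_reflection (c @ [i]) \<zeta>\<^sub>1) (fold dual_reflection (c @ [i]) \<zeta>\<^sub>2) = Some d'"
        using Cons.prems(2) True 2 by (auto split: if_splits)
      ultimately show ?thesis using Cons.IH[of "c @ [i]" d'] Cons.prems(1) True t by simp
    qed
  qed
qed

lemma funpow_fold_replicate: "(fold f p ^^ K) u = fold f (concat (replicate K p)) u"
  by (induction K arbitrary: u) (simp_all add: funpow_Suc_right del: funpow.simps(2))

text \<open>\<open>pos\<close> provides the two points that span \<open>L\<close>,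
  \<open>run\<close> follows the identity through \<open>K\<close> promotions, and
  \<open>closed\<close> brings it back. The root given by \<open>h\<close> and
  \<open>i\<^sub>0\<close> is positive at the identity but negative at both points, so this periodic
  point is not in \<open>L\<close>.\<close>

lemma not_heavy_certificate:
  assumes J: "affine_on J \<delta>" and pos: "0 < (\<Sum>i\<in>J. \<zeta>\<^sub>1 i * \<delta> i)" "0 < (\<Sum>i\<in>J. \<zeta>\<^sub>2 i * \<delta> i)"
    and K: "1 \<le> K" and run: "crossings (filter (\<lambda>i. i \<in> J) (concat (replicate K p))) \<zeta>\<^sub>1 \<zeta>\<^sub>2 = Some c"
    and closed: "\<And>i. i \<in> J \<Longrightarrow> 0 < fold dual_reflection c (\<lambda>_. 1) i"
    and h: "set h \<subseteq> J" "i\<^sub>0 \<in> J"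
    and g: "ev \<zeta>\<^sub>1 (act (word h) (simple_root i\<^sub>0)) < 0" "ev \<zeta>\<^sub>2 (act (word h) (simple_root i\<^sub>0)) < 0"
      "0 < ev (\<lambda>_. 1) (act (word h) (simple_root i\<^sub>0))"
  shows "\<not> heavy_for p"
proof
  assume heavy: "heavy_for p"
  obtain q\<^sub>1 where q1: "set q\<^sub>1 \<subseteq> J"
      "\<And>\<beta>. \<beta> \<in> roots \<Longrightarrow> supported J \<beta> \<Longrightarrow> 0 < ev \<zeta>\<^sub>1 \<beta> \<Longrightarrow> act (word q\<^sub>1) \<beta> \<in> positive_roots"
    using ex_chamber[OF finite_negative_roots[OF J pos(1)]] by blast
  obtain q\<^sub>2 where q2: "set q\<^sub>2 \<subseteq> J"
      "\<And>\<beta>. \<beta> \<in> roots \<Longrightarrow> supported J \<beta> \<Longrightarrow> 0 < ev \<zeta>\<^sub>2 \<beta> \<Longrightarrow> act (word q\<^sub>2) \<beta> \<in> positive_roots"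
    using ex_chamber[OF finite_negative_roots[OF J pos(2)]] by blast
  define L where "L = convex_closure {word q\<^sub>1, word q\<^sub>2}"
  have "fold (toggle L) (concat (replicate K p)) (word (rev [])) = word (rev ([] @ c)) \<and> set c \<subseteq> J"
    unfolding L_def using run by (intro fold_toggle_crossings[OF q1(1) q2(1) q1(2) q2(2)]) auto
  moreover from this have "word (rev c) = \<one>" using word_eq_one[of c J] closed by blast
  ultimately have "(fold (toggle L) p ^^ K) \<one> = \<one>" by (simp add: funpow_fold_replicate)
  moreover have "L \<noteq> {}" using R_closure(2)[of "{word q\<^sub>1, word q\<^sub>2}"] by (auto simp: L_def)
  ultimately have one: "\<one> \<in> L"
    using heavy K convex_closure_convex unfolding heavy_for_def L_def by blast
  define \<gamma> where "\<gamma> = act (word h) (simple_root i\<^sub>0)"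
  have \<gamma>: "\<gamma> \<in> roots" "supported J \<gamma>"
    unfolding \<gamma>_def using h by (auto intro: rootsI supported_act_word supported_simple_root)
  have "\<gamma> \<in> positive_roots"
    using positive_if_ev_positive[OF \<gamma>(1), of "\<lambda>_. 1"] g(3) by (simp add: \<gamma>_def)
  moreover have "- \<gamma> \<in> R L"
    unfolding L_def using q1(2)[of "- \<gamma>"] q2(2)[of "- \<gamma>"] \<gamma> minus_roots g(1,2)
    by (subst R_closure) (auto simp: supported_def ev_minus \<gamma>_def)
  then have "- \<gamma> \<in> positive_roots"
    using one mem_convex_iff[of L \<one>] convex_closure_convex by (auto simp: L_def act_one)
  ultimately show False using positive_roots_minus[OF \<gamma>(1)] by blast
qed

lemma connected_onI:
  assumes "i0 \<in> J" "\<And>i. i \<in> J \<Longrightarrow> (\<lambda>a b. adj a b \<and> a \<in> J \<and> b \<in> J)\<^sup>*\<^sup>* i0 i"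
  shows "connected_on J"
proof -
  have "symp (\<lambda>a b. adj a b \<and> a \<in> J \<and> b \<in> J)\<^sup>*\<^sup>*"
    by (intro symp_rtranclp) (auto simp: symp_def adj_sym)
  then show ?thesis
    using assms(2) unfolding connected_on_def symp_def by (meson rtranclp_trans)
qed


subsection \<open>The diagrams \<open>\<tilde>D\<close>\<close>

lemma crossings_stay:
  "(\<And>i. i \<in> set q \<Longrightarrow> 0 < \<zeta>\<^sub>1 i \<and> 0 < \<zeta>\<^sub>2 i) \<Longrightarrow> crossings (q @ r) \<zeta>\<^sub>1 \<zeta>\<^sub>2 = crossings r \<zeta>\<^sub>1 \<zeta>\<^sub>2"
  by (induction q) auto

lemma crossings_independent:
  assumes "distinct q" "\<And>i j. i \<in> set q \<Longrightarrow> j \<in> set q \<Longrightarrow> \<not> adj i j"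
    "\<And>i. i \<in> set q \<Longrightarrow> \<zeta>\<^sub>1 i * \<zeta>\<^sub>2 i < 0"
  shows "crossings (q @ r) \<zeta>\<^sub>1 \<zeta>\<^sub>2 =
    map_option ((@) q) (crossings r (fold dual_reflection q \<zeta>\<^sub>1) (fold dual_reflection q \<zeta>\<^sub>2))"
  using assms
proof (induction q arbitrary: \<zeta>\<^sub>1 \<zeta>\<^sub>2)
  case Nil
  then show ?case by (cases "crossings r \<zeta>\<^sub>1 \<zeta>\<^sub>2") auto
next
  case (Cons i q)
  have same: "dual_reflection i \<zeta> j = \<zeta> j" if "j \<in> set q" for j \<zeta>
    using Cons.prems that by (auto simp: dual_reflection_def)
  have "crossings (q @ r) (dual_reflection i \<zeta>\<^sub>1) (dual_reflection i \<zeta>\<^sub>2) =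
      map_option ((@) q) (crossings r (fold dual_reflection q (dual_reflection i \<zeta>\<^sub>1)) (fold dual_reflection q (dual_reflection i \<zeta>\<^sub>2)))"
    using Cons.prems same by (intro Cons.IH) auto
  moreover have "\<zeta>\<^sub>1 i * \<zeta>\<^sub>2 i < 0" "\<not> (0 < \<zeta>\<^sub>1 i \<and> 0 < \<zeta>\<^sub>2 i)"
    using Cons.prems(3)[of i] by (auto simp: mult_less_0_iff)
  ultimately show ?case by (auto simp: option.map_comp comp_def)
qed

text \<open>Among the later vertices of the path only the next one is adjacent to \<open>y\<close>,
  so the reflection at \<open>y\<close> adds \<alpha>_y exactly once.\<close>

lemma act_path:
  assumes "simple_path (q @ [x])"
  shows "act (word q) (simple_root x) = (\<Sum>y\<in>set (q @ [x]). simple_root y)"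
  using assms
proof (induction q)
  case Nil
  then show ?case by (simp add: act_one)
next
  case (Cons y q)
  let ?S = "set (q @ [x])"
  have path: "simple_path (q @ [x])" using simple_path_infix[of "[y]" "q @ [x]" "[]"] Cons.prems by simp
  have y: "y \<notin> ?S" using Cons.prems by (auto simp: simple_path_def)
  have hd: "{z \<in> ?S. adj y z} = {hd (q @ [x])}"
  proof -
    have "z = hd (q @ [x])" if z: "z \<in> ?S" "adj y z" for z
    proof -
      obtain j where j: "j < length (q @ [x])" "z = (q @ [x]) ! j" using z(1) by (metis in_set_conv_nth)
      then have "Suc j = Suc 0"
        using adjacent_on_path[OF Cons.prems, of 0 "Suc j"] z(2) by simp
      then show ?thesis using j by (simp add: hd_conv_nth)
    qed
    moreover have "adj y (hd (q @ [x]))" using Cons.prems by (cases q) (auto simp: simple_path_def)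
    moreover have "hd (q @ [x]) \<in> ?S" by (cases q) auto
    ultimately show ?thesis by blast
  qed
  have "act (word (y # q)) (simple_root x) = reflection y (\<Sum>z\<in>?S. simple_root z)"
    using Cons.IH[OF path] by (simp add: act_word del: word_Cons set_append)
  also have "\<dots> = (\<Sum>z\<in>?S. reflection y (simple_root z))"
    by (rule linear_sum[OF linear_reflection])
  also have "\<dots> = (\<Sum>z\<in>?S. simple_root z + (if adj y z then simple_root y else 0))"
    using y by (intro sum.cong HOL.refl) (auto simp: reflection_simple_root)
  also have "\<dots> = (\<Sum>z\<in>?S. simple_root z) + (\<Sum>z\<in>{z \<in> ?S. adj y z}. simple_root y)"
    by (simp only: sum.distrib sum.inter_filter[OF finite_set])
  also have "\<dots> = (\<Sum>z\<in>set ((y # q) @ [x]). simple_root z)"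
    unfolding hd using y by (simp add: add.commute)
  finally show ?case .
qed

lemma ev_sum: "ev \<zeta> (\<Sum>y\<in>A. f y) = (\<Sum>y\<in>A. ev \<zeta> (f y))"
proof -
  have "linear (ev \<zeta>)" by (intro linearI) (auto simp: ev_add ev_scale)
  then show ?thesis by (rule linear_sum)
qed


lemma double_fork_adj:
  assumes "double_fork P a b c d"
  shows "distinct ([a, b, c, d] @ P)"
    and "\<And>i j. i \<in> {a, b, c, d} \<Longrightarrow> j \<in> {a, b, c, d} \<Longrightarrow> \<not> adj i j"
    and "\<And>x. x \<in> set P \<Longrightarrow> adj a x \<longleftrightarrow> x = hd P" "\<And>x. x \<in> set P \<Longrightarrow> adj b x \<longleftrightarrow> x = hd P"
    and "\<And>x. x \<in> set P \<Longrightarrow> adj c x \<longleftrightarrow> x = last P" "\<And>x. x \<in> set P \<Longrightarrow> adj d x \<longleftrightarrow> x = last P"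
    and "simple_path P"
proof -
  have ne: "P \<noteq> []" and ab: "a \<noteq> b" and cd: "c \<noteq> d"
    and ac: "simple_path (a # P @ [c])" and ad: "simple_path (a # P @ [d])"
    and bc: "simple_path (b # P @ [c])" and bd: "simple_path (b # P @ [d])"
    using assms by (auto simp: double_fork_def)
  show P: "simple_path P" using simple_path_infix[of "[a]" P "[c]"] ac ne by simp
  show d: "distinct ([a, b, c, d] @ P)" using ab cd ac ad bc bd by (auto simp: simple_path_def)
  have first: "adj x y \<longleftrightarrow> y = hd P" if xz: "simple_path (x # P @ [z])" and y: "y \<in> set P" for x y z
  proof -
    obtain j where j: "j < length P" "y = P ! j" using y by (metis in_set_conv_nth)
    then have "adj x y \<longleftrightarrow> j = 0"
      using adjacent_on_path[OF xz, of 0 "Suc j"] by (simp add: nth_append)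
    also have "\<dots> \<longleftrightarrow> y = hd P"
      using j P ne by (auto simp: hd_conv_nth simple_path_def nth_eq_iff_index_eq)
    finally show ?thesis .
  qed
  have ends: "\<not> adj x z" if xz: "simple_path (x # P @ [z])" for x z
    using adjacent_on_path[OF xz, of 0 "Suc (length P)"] ne by (simp add: nth_append)
  have rev: "simple_path (z # rev P @ [x])" if "simple_path (x # P @ [z])" for x z
    using that simple_path_rev[of "x # P @ [z]"] by simp
  \<comment> \<open>A common neighbour of two adjacent vertices would complete a triangle.\<close>
  have fork: "\<not> adj x y" if "adj x v" "adj y v" "x \<noteq> y" "x \<noteq> v" "y \<noteq> v" for x y v
  proof -
    have "simple_path [x, v, y]" using that by (auto simp: simple_path_def adj_sym)
    then show ?thesis using adjacent_on_path[of "[x, v, y]" 0 2] by simp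
  qed
  show A: "\<And>x. x \<in> set P \<Longrightarrow> adj a x \<longleftrightarrow> x = hd P" and Bb: "\<And>x. x \<in> set P \<Longrightarrow> adj b x \<longleftrightarrow> x = hd P"
    using first[OF ac] first[OF bc] by auto
  show Cc: "adj c x \<longleftrightarrow> x = last P" and D: "adj d x \<longleftrightarrow> x = last P" if "x \<in> set P" for x
  proof -
    have hd_rev: "hd (rev P) = last P" using ne by (simp add: hd_rev)
    have "adj z x \<longleftrightarrow> x = last P" if zy: "simple_path (z # rev P @ [y])" for z y
    proof -
      obtain j where j: "j < length (rev P)" "x = rev P ! j" using \<open>x \<in> set P\<close> by (metis in_set_conv_nth set_rev)
      then have "adj z x \<longleftrightarrow> j = 0"
        using adjacent_on_path[OF zy, of 0 "Suc j"] by (simp add: nth_append)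
      also have "\<dots> \<longleftrightarrow> x = hd (rev P)"
        using j P ne by (auto simp: hd_conv_nth[of "rev P"] simple_path_def nth_eq_iff_index_eq[of "rev P"])
      finally show ?thesis by (simp only: hd_rev)
    qed
    then show "adj c x \<longleftrightarrow> x = last P" "adj d x \<longleftrightarrow> x = last P" using rev[OF ac] rev[OF ad] by blast+
  qed
  have hl: "hd P \<in> set P" "last P \<in> set P" using ne by auto
  have "\<not> adj a b" using fork[of a "hd P" b] A Bb hl ab d by auto
  moreover have "\<not> adj c d" using fork[of c "last P" d] Cc D hl cd d by auto
  ultimately show "\<And>i j. i \<in> {a, b, c, d} \<Longrightarrow> j \<in> {a, b, c, d} \<Longrightarrow> \<not> adj i j"
    using ends[OF ac] ends[OF ad] ends[OF bc] ends[OF bd] adj_sym by auto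
qed

lemma double_fork_affine:
  assumes "double_fork P a b c d"
  defines "J \<equiv> set ([a, b, c, d] @ P)"
  shows "affine_on J (\<lambda>i. if i \<in> set P then 2 else 1)"
proof -
  note adj = double_fork_adj[OF assms(1)]
  let ?\<delta> = "\<lambda>i. if i \<in> set P then 2 else 1 :: real"
  have ne: "P \<noteq> []" using assms(1) by (simp add: double_fork_def)
  have hl: "hd P \<in> set P" "last P \<in> set P" using ne by auto
  have leaves: "nbrs i \<inter> J = {hd P}" if "i \<in> {a, b}" for i
    using that adj(2)[of i] adj(3,4) hl by (auto simp: nbrs_def J_def)
  have leaves': "nbrs i \<inter> J = {last P}" if "i \<in> {c, d}" for i
    using that adj(2)[of i] adj(5,6) hl by (auto simp: nbrs_def J_def)
  have sum_path: "(\<Sum>j\<in>nbrs (P ! k) \<inter> J. ?\<delta> j) = 4" if k: "k < length P" for k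
  proof -
    have dP: "distinct P" using adj(7) by (simp add: simple_path_def)
    have inP: "P ! k \<in> set P" using k by simp
    have hk: "P ! k = hd P \<longleftrightarrow> k = 0" and lk: "P ! k = last P \<longleftrightarrow> Suc k = length P"
      using k dP ne by (auto simp: hd_conv_nth last_conv_nth nth_eq_iff_index_eq)
    \<comment> \<open>\<open>A\<close> and \<open>C\<close> are the neighbours of
      \<open>P ! k\<close> towards either end: two legs of weight 1 or one path vertex of weight 2,
      so each side contributes 2.\<close>
    define A where "A = (if k = 0 then {a, b} else {P ! (k - 1)})"
    define C where "C = (if Suc k = length P then {c, d} else {P ! Suc k})"
    have *: "x \<in> set P \<Longrightarrow> adj (P ! k) x \<longleftrightarrow> k \<noteq> 0 \<and> x = P ! (k - 1) \<or> Suc k < length P \<and> x = P ! Suc k" for x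
    proof -
      assume "x \<in> set P"
      then obtain j where j: "j < length P" "x = P ! j" by (metis in_set_conv_nth)
      then have "adj (P ! k) x \<longleftrightarrow> j = Suc k \<or> k = Suc j" using adjacent_on_path[OF adj(7) k j(1)] by simp
      then show ?thesis using j k dP by (auto simp: nth_eq_iff_index_eq)
    qed
    have inA: "k \<noteq> 0 \<Longrightarrow> P ! (k - 1) \<in> set P" and inC: "Suc k \<noteq> length P \<Longrightarrow> P ! Suc k \<in> set P"
      using k by auto
    have notA: "x \<in> A \<longleftrightarrow> k = 0 \<and> x \<in> {a, b}" and notC: "x \<in> C \<longleftrightarrow> Suc k = length P \<and> x \<in> {c, d}"
      if "x \<notin> set P" for x
      using that inA inC by (cases "k = 0"; cases "Suc k = length P"; auto simp: A_def C_def)+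
    have "nbrs (P ! k) \<inter> J = A \<union> C"
    proof (rule Set.set_eqI)
      fix x
      consider "x \<in> {a, b}" | "x \<in> {c, d}" | "x \<in> set P" | "x \<notin> J" by (auto simp: J_def)
      then show "x \<in> nbrs (P ! k) \<inter> J \<longleftrightarrow> x \<in> A \<union> C"
      proof cases
        case 1
        then have "adj (P ! k) x \<longleftrightarrow> k = 0" using adj(3,4)[OF inP] hk adj_sym[of "P ! k" x] by auto
        moreover have "x \<notin> set P" "x \<notin> {c, d}" "x \<in> J" using 1 adj(1) by (auto simp: J_def)
        ultimately show ?thesis using 1 notA[of x] notC[of x] by (simp add: nbrs_def)
      next
        case 2
        then have "adj (P ! k) x \<longleftrightarrow> Suc k = length P" using adj(5,6)[OF inP] lk adj_sym[of "P ! k" x] by auto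
        moreover have "x \<notin> set P" "x \<notin> {a, b}" "x \<in> J" using 2 adj(1) by (auto simp: J_def)
        ultimately show ?thesis using 2 notA[of x] notC[of x] by (simp add: nbrs_def)
      next
        case 3
        then have "x \<notin> {a, b, c, d}" "x \<in> J" using adj(1) by (auto simp: J_def)
        then show ?thesis unfolding A_def C_def using *[OF 3] k by (auto simp: nbrs_def)
      next
        case 4
        then have "x \<notin> set P" "x \<notin> {a, b, c, d}" by (auto simp: J_def)
        then show ?thesis using 4 notA[of x] notC[of x] by auto
      qed
    qed
    moreover have "A \<inter> C = {}"
    proof -
      have leafP: "x \<in> set P \<Longrightarrow> x \<noteq> a \<and> x \<noteq> b \<and> x \<noteq> c \<and> x \<noteq> d" for x using adj(1) by auto
      have dis: "k \<noteq> 0 \<Longrightarrow> Suc k \<noteq> length P \<Longrightarrow> P ! (k - 1) \<noteq> P ! Suc k"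
        using k dP by (simp add: nth_eq_iff_index_eq)
      have "a \<noteq> c" "a \<noteq> d" "b \<noteq> c" "b \<noteq> d" using adj(1) by auto
      then show ?thesis
        using leafP[OF inA] leafP[OF inC] dis unfolding A_def C_def
        by (cases "k = 0"; cases "Suc k = length P") simp_all
    qed
    moreover have "(\<Sum>j\<in>A. ?\<delta> j) = 2"
    proof (cases "k = 0")
      case True
      then show ?thesis using adj(1) by (simp add: A_def)
    next
      case False
      then show ?thesis using inA by (simp add: A_def)
    qed
    moreover have "(\<Sum>j\<in>C. ?\<delta> j) = 2"
    proof (cases "Suc k = length P")
      case True
      then show ?thesis using adj(1) by (simp add: C_def)
    next
      case False
      then show ?thesis using inC by (simp add: C_def)
    qed
    moreover have "finite A" "finite C" by (auto simp: A_def C_def)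
    ultimately show ?thesis by (simp add: sum.union_disjoint)
  qed
  have "(\<Sum>j\<in>nbrs i \<inter> J. ?\<delta> j) = 2 * ?\<delta> i" if i: "i \<in> J" for i
  proof (cases "i \<in> set P")
    case True
    then obtain k where "k < length P" "i = P ! k" by (metis in_set_conv_nth)
    then show ?thesis using sum_path True by simp
  next
    case False
    then have "i \<in> {a, b} \<or> i \<in> {c, d}" using i by (auto simp: J_def)
    then show ?thesis using leaves leaves' hl False by auto
  qed
  moreover have "connected_on J"
  proof -
    define r where "r = (\<lambda>x y. adj x y \<and> x \<in> J \<and> y \<in> J)"
    have P: "r\<^sup>*\<^sup>* (hd P) (P ! k)" if "k < length P" for k
      using that
    proof (induction k)
      case 0
      then show ?case by (simp add: hd_conv_nth ne)
    next
      case (Suc k)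
      then have "r (P ! k) (P ! Suc k)" using simple_path_nth[OF adj(7)] by (auto simp: r_def J_def)
      moreover have "r\<^sup>*\<^sup>* (hd P) (P ! k)" using Suc by simp
      ultimately show ?case by (rule rtranclp.rtrancl_into_rtrancl[rotated])
    qed
    then have P': "r\<^sup>*\<^sup>* (hd P) x" if "x \<in> set P" for x using that by (auto simp: in_set_conv_nth)
    show ?thesis
    proof (rule connected_onI[of "hd P" J, folded r_def])
      show "hd P \<in> J" using hl by (simp add: J_def)
      fix i assume "i \<in> J"
      then consider "i \<in> set P" | "i \<in> {a, b}" | "i \<in> {c, d}" by (auto simp: J_def)
      then show "r\<^sup>*\<^sup>* (hd P) i"
      proof cases
        case 1
        then show ?thesis by (rule P')
      next
        case 2
        then have "r (hd P) i" using adj(3,4)[OF hl(1)] adj_sym[of "hd P" i] hl by (auto simp: r_def J_def)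
        then show ?thesis by (rule r_into_rtranclp)
      next
        case 3
        then have "r (last P) i" using adj(5,6)[OF hl(2)] adj_sym[of "last P" i] hl by (auto simp: r_def J_def)
        then show ?thesis using P'[OF hl(2)] by (rule rtranclp.rtrancl_into_rtrancl[rotated])
      qed
    qed
  qed
  moreover have "J \<noteq> {}" by (simp add: J_def)
  ultimately show ?thesis by (simp add: affine_on_def)
qed

text \<open>
  The legs are crossed back and forth, and the path is never crossed; the root separating the orbit
  from the convex set is the sum of the simple roots on the path from \<open>a\<close> to \<open>c\<close>.
\<close>

lemma double_fork_not_heavy:
  assumes "double_fork P a b c d"
  obtains p where "distinct p" "set p = UNIV" "\<not> heavy_for p"
proof -
  note adj = double_fork_adj[OF assms]
  define J where "J = set ([a, b, c, d] @ P)"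
  let ?leaves = "[a, b, c, d]"
  define k where "k = real (length P)"
  \<comment> \<open>The two legs at each end carry opposite values, so firing all four legs changes
    nothing on the path and merely replaces \<open>x, y\<close> by \<open>- x, - y\<close>. A second
    round restores the functional; this is why \<open>K = 2\<close> suffices.\<close>
  define \<zeta> where "\<zeta> x y i = (if i \<in> set P then 1 else if i = a then - x else if i = b then x
    else if i = c then - y else if i = d then y else 0)" for x y :: real and i :: 'i
  have \<zeta>: "\<And>i. i \<in> set P \<Longrightarrow> \<zeta> x y i = 1" "\<zeta> x y a = - x" "\<zeta> x y b = x" "\<zeta> x y c = - y" "\<zeta> x y d = y" for x y
    using adj(1) by (auto simp: \<zeta>_def)
  have dP: "distinct P" using adj(1) by simp
  obtain r where r: "distinct r" "set r = - J" using finite_distinct_list[of "- J"] by auto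
  define p where "p = r @ P @ ?leaves"
  have p: "distinct p" "set p = UNIV" using r adj(1) by (auto simp: p_def J_def)
  have filter: "filter (\<lambda>i. i \<in> J) p = P @ ?leaves"
  proof -
    have "filter (\<lambda>i. i \<in> J) r = []" using r by (auto simp: filter_empty_conv)
    moreover have "filter (\<lambda>i. i \<in> J) (P @ ?leaves) = P @ ?leaves" by (auto simp: filter_id_conv J_def)
    ultimately show ?thesis by (simp add: p_def)
  qed
  have indep: "distinct ?leaves" "\<And>i j. i \<in> set ?leaves \<Longrightarrow> j \<in> set ?leaves \<Longrightarrow> \<not> adj i j"
    using adj(1,2) by auto
  have sum_leaves: "(\<Sum>i\<in>set ?leaves \<inter> nbrs z. g i) = 0"
    if "z \<in> set P" "g a + g b = 0" "g c + g d = 0" for z and g :: "'i \<Rightarrow> real"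
  proof -
    define u v where "u = (z = hd P)" and "v = (z = last P)"
    have "adj z a \<longleftrightarrow> u" "adj z b \<longleftrightarrow> u" "adj z c \<longleftrightarrow> v" "adj z d \<longleftrightarrow> v"
      unfolding u_def v_def adj_sym[of z] using adj(3-6)[OF that(1)] by blast+
    then have *: "set ?leaves \<inter> nbrs z = (if u then {a, b} else {}) \<union> (if v then {c, d} else {})"
      by (cases u; cases v) (auto simp: nbrs_def)
    have "c \<notin> {d, a, b}" "d \<notin> {a, b}" "a \<noteq> b" using adj(1) by auto
    then show ?thesis
      unfolding * using that(2,3) by (cases u; cases v) simp_all
  qed
  have fd: "fold dual_reflection ?leaves \<xi> z =
      (if z \<in> set ?leaves then - \<xi> z else \<xi> z + (\<Sum>i\<in>set ?leaves \<inter> nbrs z. \<xi> i))" for \<xi> z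
    by (rule fold_dual_reflection[OF indep])
  have flip: "fold dual_reflection ?leaves (\<zeta> x y) i = \<zeta> (- x) (- y) i" if "i \<in> J" for x y i
  proof (cases "i \<in> set P")
    case True
    then have "i \<notin> set ?leaves" using adj(1) by auto
    then show ?thesis
      unfolding fd using True sum_leaves[of i "\<zeta> x y"] \<zeta> by (simp del: list.set)
  next
    case False
    then have "i \<in> set ?leaves" using that by (auto simp: J_def)
    then have "fold dual_reflection ?leaves (\<zeta> x y) i = - \<zeta> x y i" by (simp only: fd if_True)
    then show ?thesis using \<open>i \<in> set ?leaves\<close> by (auto simp: \<zeta>)
  qed
  have twice: "fold dual_reflection ?leaves (fold dual_reflection ?leaves \<xi>) i = \<xi> i" for \<xi> i
  proof (cases "i \<in> set ?leaves")
    case False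
    have "(\<Sum>j\<in>set ?leaves \<inter> nbrs i. fold dual_reflection ?leaves \<xi> j) = (\<Sum>j\<in>set ?leaves \<inter> nbrs i. - \<xi> j)"
      by (intro sum.cong HOL.refl) (simp only: fd Int_iff if_True)
    then have "fold dual_reflection ?leaves (fold dual_reflection ?leaves \<xi>) i =
        \<xi> i + (\<Sum>j\<in>set ?leaves \<inter> nbrs i. \<xi> j) + (\<Sum>j\<in>set ?leaves \<inter> nbrs i. - \<xi> j)"
      using False by (simp only: fd[of _ i] if_False)
    then show ?thesis by (simp only: sum_negf add.right_inverse add.assoc add_0_right)
  qed (simp only: fd if_True minus_minus)
  \<comment> \<open>On the root over \<open>a\<close>, \<open>P\<close> and \<open>c\<close> both
    functionals take the value \<open>- ?x + k + 1\<close>, here -2; any larger \<open>?x\<close>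
    would serve as well. At every leg one functional has absolute value \<open>?x\<close>, the other
    1, with opposite signs, so each leg is crossed.\<close>
  let ?x = "k + 3"
  have run: "crossings (P @ ?leaves @ P @ ?leaves) (\<zeta> ?x (- 1)) (\<zeta> (- 1) ?x) = Some (?leaves @ ?leaves)"
  proof -
    have k0: "0 \<le> k" by (simp add: k_def)
    let ?z1 = "fold dual_reflection ?leaves (\<zeta> ?x (- 1))" and ?z2 = "fold dual_reflection ?leaves (\<zeta> (- 1) ?x)"
    have z: "?z1 i = \<zeta> (- ?x) 1 i" "?z2 i = \<zeta> 1 (- ?x) i" if "i \<in> J" for i
      using flip[OF that] by simp_all
    have PJ: "i \<in> set P \<Longrightarrow> i \<in> J" "i \<in> set ?leaves \<Longrightarrow> i \<in> J" for i by (auto simp: J_def)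
    have "crossings (P @ ?leaves @ P @ ?leaves) (\<zeta> ?x (- 1)) (\<zeta> (- 1) ?x)
        = crossings (?leaves @ P @ ?leaves) (\<zeta> ?x (- 1)) (\<zeta> (- 1) ?x)"
      by (intro crossings_stay) (simp add: \<zeta>)
    also have "\<dots> = map_option ((@) ?leaves) (crossings (P @ ?leaves) ?z1 ?z2)"
      by (intro crossings_independent indep) (use k0 in \<open>auto simp: \<zeta> mult_less_0_iff\<close>)
    also have "crossings (P @ ?leaves) ?z1 ?z2 = crossings (?leaves @ []) ?z1 ?z2"
      using crossings_stay[of P ?z1 ?z2 ?leaves] z PJ(1) \<zeta>(1) by simp
    also have "\<dots> = map_option ((@) ?leaves) (crossings [] (fold dual_reflection ?leaves ?z1) (fold dual_reflection ?leaves ?z2))"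
    proof (intro crossings_independent indep)
      fix i assume i: "i \<in> set ?leaves"
      then show "?z1 i * ?z2 i < 0"
        unfolding z[OF PJ(2)[OF i]] using k0 by (auto simp: \<zeta> mult_less_0_iff)
    qed
    finally show ?thesis by simp
  qed
  have sum\<delta>: "(\<Sum>i\<in>J. \<zeta> x y i * (if i \<in> set P then 2 else 1)) = 2 * k" for x y
  proof -
    have "J = set ?leaves \<union> set P" "set ?leaves \<inter> set P = {}" using adj(1) by (auto simp: J_def)
    then have "(\<Sum>i\<in>J. \<zeta> x y i * (if i \<in> set P then 2 else 1))
        = (\<Sum>i\<in>set ?leaves. \<zeta> x y i * (if i \<in> set P then 2 else 1)) + (\<Sum>i\<in>set P. \<zeta> x y i * (if i \<in> set P then 2 else 1))"
      by (simp only: sum.union_disjoint[OF finite_set finite_set])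
    also have "(\<Sum>i\<in>set ?leaves. \<zeta> x y i * (if i \<in> set P then 2 else 1)) = 0"
      using adj(1) by (simp add: \<zeta>)
    also have "(\<Sum>i\<in>set P. \<zeta> x y i * (if i \<in> set P then 2 else 1)) = (\<Sum>i\<in>set P. 2)"
      by (intro sum.cong) (auto simp: \<zeta>)
    also have "\<dots> = 2 * k" using distinct_card[OF dP] by (simp add: k_def)
    finally show ?thesis by simp
  qed
  have ne: "P \<noteq> []" and path: "simple_path ((a # P) @ [c])" using assms by (auto simp: double_fork_def)
  have k1: "1 \<le> k" using ne by (simp add: k_def Suc_le_eq)
  have sum_path: "(\<Sum>i\<in>set ((a # P) @ [c]). g i) = g a + (\<Sum>i\<in>set P. g i) + g c" for g :: "'i \<Rightarrow> real"
    using adj(1) by (auto simp: add_ac)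
  have ev: "ev \<xi> (act (word (a # P)) (simple_root c)) = (\<Sum>i\<in>set ((a # P) @ [c]). \<xi> i)" for \<xi>
    unfolding act_path[OF path] ev_sum by simp
  have sum1: "(\<Sum>i\<in>set P. \<zeta> x y i) = k" for x y
  proof -
    have "(\<Sum>i\<in>set P. \<zeta> x y i) = (\<Sum>i\<in>set P. 1)" by (intro sum.cong) (auto simp: \<zeta>)
    then show ?thesis using distinct_card[OF dP] by (simp add: k_def)
  qed
  have "\<not> heavy_for p"
  proof (rule not_heavy_certificate[where K = 2 and c = "?leaves @ ?leaves" and h = "a # P" and i\<^sub>0 = c])
    show "affine_on J (\<lambda>i. if i \<in> set P then 2 else 1)"
      using double_fork_affine[OF assms] by (simp add: J_def)
    show "0 < (\<Sum>i\<in>J. \<zeta> ?x (- 1) i * (if i \<in> set P then 2 else 1))"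
      "0 < (\<Sum>i\<in>J. \<zeta> (- 1) ?x i * (if i \<in> set P then 2 else 1))"
      unfolding sum\<delta> using k1 by simp_all
    show "crossings (filter (\<lambda>i. i \<in> J) (concat (replicate 2 p))) (\<zeta> ?x (- 1)) (\<zeta> (- 1) ?x) = Some (?leaves @ ?leaves)"
      using run by (simp add: numeral_2_eq_2 filter)
    show "0 < fold dual_reflection (?leaves @ ?leaves) (\<lambda>_. 1) i" for i
      unfolding fold_append comp_apply twice by simp
    show "ev (\<zeta> ?x (- 1)) (act (word (a # P)) (simple_root c)) < 0"
      "ev (\<zeta> (- 1) ?x) (act (word (a # P)) (simple_root c)) < 0"
      unfolding ev sum_path sum1 by (simp_all add: \<zeta>)
    show "0 < ev (\<lambda>_. 1) (act (word (a # P)) (simple_root c))"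
      unfolding ev sum_path by (simp add: add_pos_nonneg sum_nonneg)
  qed (auto simp: J_def)
  then show ?thesis using that p by blast
qed

end

subsection \<open>The diagrams \<open>\<tilde>E\<close>\<close>

text \<open>
  For a fixed diagram, given by the lists of neighbours of the vertices \<open>0, \<dots>, n - 1\<close>, the
  hypotheses on the functionals are checked by computation.
\<close>

definition dual_reflection_list :: "nat list list \<Rightarrow> nat \<Rightarrow> int list \<Rightarrow> int list" where
  "dual_reflection_list nb a zs =
     map (\<lambda>b. if b = a then - zs ! a else if b \<in> set (nb ! a) then zs ! b + zs ! a else zs ! b) [0..<length zs]"

fun crossings_list :: "nat list list \<Rightarrow> nat list \<Rightarrow> int list \<Rightarrow> int list \<Rightarrow> nat list option" where
  "crossings_list nb [] xs ys = Some []"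
| "crossings_list nb (a # p) xs ys =
    (if 0 < xs ! a \<and> 0 < ys ! a then crossings_list nb p xs ys
     else if xs ! a * ys ! a < 0
       then map_option ((#) a) (crossings_list nb p (dual_reflection_list nb a xs) (dual_reflection_list nb a ys))
     else None)"

text \<open>The last condition encodes connectedness: every vertex reaches 0 through neighbours with
  smaller numbers.\<close>

definition affine_list :: "nat list list \<Rightarrow> int list \<Rightarrow> bool" where
  "affine_list nb ds \<longleftrightarrow> nb \<noteq> [] \<and> length ds = length nb \<and>
     (\<forall>a\<in>set [0..<length nb]. distinct (nb ! a) \<and> (\<forall>b\<in>set (nb ! a). b < length nb) \<and>
       0 < ds ! a \<and> sum_list (map ((!) ds) (nb ! a)) = 2 * ds ! a \<and>
       (a = 0 \<or> (\<exists>b\<in>set (nb ! a). b < a)))"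

text \<open>The hypotheses of \<open>not_heavy_certificate\<close> on integer lists. By
  \<open>ev_act_word\<close>, firing the letters of \<open>h\<close> and reading entry
  \<open>a\<close> evaluates a functional at the separating root.\<close>

definition trapped_list :: "nat list list \<Rightarrow> int list \<Rightarrow> int list \<Rightarrow> int list \<Rightarrow> nat \<Rightarrow> nat list \<Rightarrow> nat \<Rightarrow> bool" where
  "trapped_list nb ds xs ys K h a \<longleftrightarrow>
     length xs = length nb \<and> length ys = length nb \<and> 1 \<le> K \<and>
     0 < sum_list (map (\<lambda>b. xs ! b * ds ! b) [0..<length nb]) \<and>
     0 < sum_list (map (\<lambda>b. ys ! b * ds ! b) [0..<length nb]) \<and>
     (case crossings_list nb (concat (replicate K [0..<length nb])) xs ys of None \<Rightarrow> False
      | Some c \<Rightarrow> list_all (\<lambda>z. 0 < z) (fold (dual_reflection_list nb) c (replicate (length nb) 1))) \<and>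
     list_all (\<lambda>b. b < length nb) (a # h) \<and>
     fold (dual_reflection_list nb) h xs ! a < 0 \<and> fold (dual_reflection_list nb) h ys ! a < 0 \<and>
     0 < fold (dual_reflection_list nb) h (replicate (length nb) 1) ! a"

section \<open>Transfer of the integer computations to a diagram inside the tree\<close>

context simply_laced_tree_system
begin

definition diagram :: "'i list \<Rightarrow> nat list list \<Rightarrow> bool" where
  "diagram e nb \<longleftrightarrow> distinct e \<and> length e = length nb \<and>
     (\<forall>a<length e. \<forall>b<length e. adj (e ! a) (e ! b) \<longleftrightarrow> b \<in> set (nb ! a))"

definition represents :: "'i list \<Rightarrow> int list \<Rightarrow> ('i \<Rightarrow> real) \<Rightarrow> bool" where
  "represents e zs \<zeta> \<longleftrightarrow> length zs = length e \<and> (\<forall>b<length e. \<zeta> (e ! b) = real_of_int (zs ! b))"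

lemma ex_represents:
  assumes "distinct e" "length zs = length e"
  obtains \<zeta> where "represents e zs \<zeta>"
proof -
  define \<zeta> where "\<zeta> i = real_of_int (zs ! (THE b. b < length e \<and> e ! b = i))" for i
  have "(THE b'. b' < length e \<and> e ! b' = e ! b) = b" if "b < length e" for b
    using that assms(1) by (intro the_equality) (auto simp: nth_eq_iff_index_eq)
  then have "represents e zs \<zeta>" using assms(2) by (simp add: represents_def \<zeta>_def)
  then show ?thesis using that by blast
qed

lemma represents_dual_reflection:
  assumes "diagram e nb" "represents e zs \<zeta>" "a < length e"
  shows "represents e (dual_reflection_list nb a zs) (dual_reflection (e ! a) \<zeta>)"
  using assms
  by (auto simp: represents_def dual_reflection_list_def dual_reflection_def diagram_def nth_eq_iff_index_eq)

lemma represents_fold: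
  assumes "diagram e nb"
  shows "represents e zs \<zeta> \<Longrightarrow> \<forall>a\<in>set c. a < length e \<Longrightarrow>
    represents e (fold (dual_reflection_list nb) c zs) (fold dual_reflection (map ((!) e) c) \<zeta>)"
  by (induction c arbitrary: zs \<zeta>) (auto simp: represents_dual_reflection[OF assms])

lemma crossings_list:
  assumes "diagram e nb"
  shows "represents e xs \<zeta>\<^sub>1 \<Longrightarrow> represents e ys \<zeta>\<^sub>2 \<Longrightarrow> \<forall>a\<in>set p. a < length e \<Longrightarrow>
    crossings_list nb p xs ys = Some c \<Longrightarrow>
    crossings (map ((!) e) p) \<zeta>\<^sub>1 \<zeta>\<^sub>2 = Some (map ((!) e) c) \<and> set c \<subseteq> set p"
proof (induction p arbitrary: xs ys \<zeta>\<^sub>1 \<zeta>\<^sub>2 c)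
  case Nil
  then show ?case by simp
next
  case (Cons a p)
  have z: "\<zeta>\<^sub>1 (e ! a) = real_of_int (xs ! a)" "\<zeta>\<^sub>2 (e ! a) = real_of_int (ys ! a)"
    using Cons.prems by (auto simp: represents_def)
  have neg: "\<zeta>\<^sub>1 (e ! a) * \<zeta>\<^sub>2 (e ! a) < 0 \<longleftrightarrow> xs ! a * ys ! a < 0"
    unfolding z by (simp flip: of_int_mult)
  show ?case
  proof (cases "0 < xs ! a \<and> 0 < ys ! a")
    case True
    then show ?thesis using Cons.IH[of xs \<zeta>\<^sub>1 ys \<zeta>\<^sub>2 c] Cons.prems z by auto
  next
    case False
    then have lt: "xs ! a * ys ! a < 0" using Cons.prems(4) by (auto split: if_splits)
    then obtain c' where c': "c = a # c'"
        "crossings_list nb p (dual_reflection_list nb a xs) (dual_reflection_list nb a ys) = Some c'"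
      using Cons.prems(4) False by auto
    have "represents e (dual_reflection_list nb a xs) (dual_reflection (e ! a) \<zeta>\<^sub>1)"
        "represents e (dual_reflection_list nb a ys) (dual_reflection (e ! a) \<zeta>\<^sub>2)"
      using Cons.prems by (auto intro: represents_dual_reflection[OF assms])
    then have "crossings (map ((!) e) p) (dual_reflection (e ! a) \<zeta>\<^sub>1) (dual_reflection (e ! a) \<zeta>\<^sub>2) =
        Some (map ((!) e) c') \<and> set c' \<subseteq> set p"
      using Cons.IH c'(2) Cons.prems(3) by auto
    moreover have "\<not> (0 < \<zeta>\<^sub>1 (e ! a) \<and> 0 < \<zeta>\<^sub>2 (e ! a))" using False z by simp
    ultimately show ?thesis using lt neg c'(1) by auto
  qed
qed

lemma diagram_affine:
  assumes e: "diagram e nb" and ds: "affine_list nb ds" and \<delta>: "represents e ds \<delta>"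
  shows "affine_on (set e) \<delta>"
proof -
  have len: "length e = length nb" and dist: "distinct e" using e by (auto simp: diagram_def)
  have all: "distinct (nb ! a) \<and> (\<forall>b\<in>set (nb ! a). b < length nb) \<and> 0 < ds ! a \<and>
      sum_list (map ((!) ds) (nb ! a)) = 2 * ds ! a \<and> (a = 0 \<or> (\<exists>b\<in>set (nb ! a). b < a))"
    if "a < length e" for a
    using ds that len unfolding affine_list_def by (elim conjE) (drule bspec[of _ _ a], simp_all)
  have nb: "distinct (nb ! a)" "\<And>b. b \<in> set (nb ! a) \<Longrightarrow> b < length e" "0 < ds ! a"
      "sum_list (map ((!) ds) (nb ! a)) = 2 * ds ! a" "a \<noteq> 0 \<Longrightarrow> \<exists>b\<in>set (nb ! a). b < a"
    if "a < length e" for a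
    using all[OF that] len by simp_all
  have ne: "e \<noteq> []" using ds len by (auto simp: affine_list_def)
  have "0 < \<delta> (e ! a) \<and> (\<Sum>j\<in>nbrs (e ! a) \<inter> set e. \<delta> j) = 2 * \<delta> (e ! a)" if a: "a < length e" for a
  proof
    show "0 < \<delta> (e ! a)" using \<delta> nb(3)[OF a] a by (simp add: represents_def)
    have "nbrs (e ! a) \<inter> set e = (!) e ` set (nb ! a)"
      using e a nb(2)[OF a] by (fastforce simp: nbrs_def diagram_def in_set_conv_nth[of _ e])
    moreover have "inj_on ((!) e) (set (nb ! a))"
      using dist nb(2)[OF a] by (auto simp: inj_on_def nth_eq_iff_index_eq)
    ultimately have "(\<Sum>j\<in>nbrs (e ! a) \<inter> set e. \<delta> j) = (\<Sum>b\<in>set (nb ! a). \<delta> (e ! b))"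
      by (simp add: sum.reindex)
    also have "\<dots> = (\<Sum>b\<in>set (nb ! a). real_of_int (ds ! b))"
      using \<delta> nb(2)[OF a] by (intro sum.cong) (auto simp: represents_def)
    also have "\<dots> = real_of_int (sum_list (map ((!) ds) (nb ! a)))"
      using nb(1)[OF a] by (simp add: sum_list_distinct_conv_sum_set)
    also have "\<dots> = 2 * \<delta> (e ! a)" using nb(4)[OF a] \<delta> a by (simp add: represents_def)
    finally show "(\<Sum>j\<in>nbrs (e ! a) \<inter> set e. \<delta> j) = 2 * \<delta> (e ! a)" .
  qed
  moreover have "connected_on (set e)"
  proof -
    define r where "r = (\<lambda>x y. adj x y \<and> x \<in> set e \<and> y \<in> set e)"
    have r: "r\<^sup>*\<^sup>* (e ! 0) (e ! a)" if "a < length e" for a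
      using that
    proof (induction a rule: less_induct)
      case (less a)
      show ?case
      proof (cases "a = 0")
        case False
        then obtain b where b: "b \<in> set (nb ! a)" "b < a" using nb(5) less.prems by blast
        then have "r (e ! b) (e ! a)"
          using e less.prems adj_sym[of "e ! b"] by (auto simp: r_def diagram_def)
        moreover have "r\<^sup>*\<^sup>* (e ! 0) (e ! b)" using less b by simp
        ultimately show ?thesis by (rule rtranclp.rtrancl_into_rtrancl[rotated])
      qed simp
    qed
    show ?thesis
      by (rule connected_onI[of "e ! 0" "set e", folded r_def]) (use r ne in \<open>auto simp: in_set_conv_nth\<close>)
  qed
  ultimately show ?thesis using ne by (auto simp: affine_on_def in_set_conv_nth)
qed

lemma diagram_not_heavy:
  assumes e: "diagram e nb" and ds: "affine_list nb ds" and t: "trapped_list nb ds xs ys K h a"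
  obtains p where "distinct p" "set p = UNIV" "\<not> heavy_for p"
proof -
  have len: "length e = length nb" and dist: "distinct e" using e by (auto simp: diagram_def)
  have lens: "length ds = length e" "length xs = length e" "length ys = length e"
    using ds t len by (auto simp: affine_list_def trapped_list_def)
  obtain \<delta> where \<delta>: "represents e ds \<delta>" using ex_represents[OF dist lens(1)] .
  obtain \<zeta>\<^sub>1 where z1: "represents e xs \<zeta>\<^sub>1" using ex_represents[OF dist lens(2)] .
  obtain \<zeta>\<^sub>2 where z2: "represents e ys \<zeta>\<^sub>2" using ex_represents[OF dist lens(3)] .
  have one: "represents e (replicate (length nb) 1) (\<lambda>_. 1)" using len by (simp add: represents_def)
  obtain r where r: "distinct r" "set r = - set e" using finite_distinct_list[of "- set e"] by auto
  define p where "p = r @ e"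
  have p: "distinct p" "set p = UNIV" using r dist by (auto simp: p_def)
  obtain c where c: "crossings_list nb (concat (replicate K [0..<length nb])) xs ys = Some c"
      "list_all (\<lambda>z. 0 < z) (fold (dual_reflection_list nb) c (replicate (length nb) 1))"
    using t by (auto simp: trapped_list_def split: option.splits)
  have h: "a < length e" "\<forall>b\<in>set h. b < length e"
    using t len by (auto simp: trapped_list_def list_all_iff)
  have e_map: "map ((!) e) [0..<length nb] = e" using map_nth[of e] len by simp
  have filter: "filter (\<lambda>i. i \<in> set e) (concat (replicate K p)) = map ((!) e) (concat (replicate K [0..<length nb]))"
  proof -
    have "filter (\<lambda>i. i \<in> set e) r = []" using r by (auto simp: filter_empty_conv)
    then have "filter (\<lambda>i. i \<in> set e) p = e" by (simp add: p_def filter_id_conv)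
    then show ?thesis by (induction K) (simp_all add: e_map)
  qed
  have cross: "crossings (map ((!) e) (concat (replicate K [0..<length nb]))) \<zeta>\<^sub>1 \<zeta>\<^sub>2 = Some (map ((!) e) c) \<and>
      set c \<subseteq> set (concat (replicate K [0..<length nb]))"
    by (rule crossings_list[OF e z1 z2 _ c(1)]) (auto simp: len)
  moreover have "set (concat (replicate K [0..<length nb])) \<subseteq> {..<length e}" using len by auto
  ultimately have cl: "\<forall>b\<in>set c. b < length e" by blast
  have ev: "ev \<zeta> (act (word (map ((!) e) h)) (simple_root (e ! a)))
      = real_of_int (fold (dual_reflection_list nb) h zs ! a)" if "represents e zs \<zeta>" for zs \<zeta>
    using represents_fold[OF e that h(2)] h(1) by (simp add: ev_act_word represents_def)
  have sum: "(\<Sum>i\<in>set e. \<zeta> i * \<delta> i) = real_of_int (sum_list (map (\<lambda>b. zs ! b * ds ! b) [0..<length nb]))"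
    if "represents e zs \<zeta>" for zs \<zeta>
  proof -
    have "(\<Sum>i\<in>set e. \<zeta> i * \<delta> i) = (\<Sum>i\<leftarrow>e. \<zeta> i * \<delta> i)"
      using dist by (simp add: sum_list_distinct_conv_sum_set)
    also have "\<dots> = (\<Sum>b\<leftarrow>[0..<length nb]. \<zeta> (e ! b) * \<delta> (e ! b))"
      by (subst e_map[symmetric]) (simp add: comp_def del: upt_conv_Cons)
    also have "\<dots> = (\<Sum>b\<leftarrow>[0..<length nb]. real_of_int (zs ! b * ds ! b))"
      using that \<delta> len by (intro arg_cong[where f = sum_list] map_cong) (auto simp: represents_def)
    also have "\<dots> = real_of_int (sum_list (map (\<lambda>b. zs ! b * ds ! b) [0..<length nb]))"
      by (simp add: sum_list_distinct_conv_sum_set)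
    finally show ?thesis .
  qed
  have "\<not> heavy_for p"
  proof (rule not_heavy_certificate[OF diagram_affine[OF e ds \<delta>]])
    show "0 < (\<Sum>i\<in>set e. \<zeta>\<^sub>1 i * \<delta> i)" "0 < (\<Sum>i\<in>set e. \<zeta>\<^sub>2 i * \<delta> i)" "1 \<le> K"
      using t by (auto simp: sum[OF z1] sum[OF z2] trapped_list_def)
    show "crossings (filter (\<lambda>i. i \<in> set e) (concat (replicate K p))) \<zeta>\<^sub>1 \<zeta>\<^sub>2 = Some (map ((!) e) c)"
      using cross filter by simp
    show "0 < fold dual_reflection (map ((!) e) c) (\<lambda>_. 1) i" if "i \<in> set e" for i
      using represents_fold[OF e one cl] that c(2)
      by (auto simp: represents_def in_set_conv_nth list_all_length)
    show "set (map ((!) e) h) \<subseteq> set e" "e ! a \<in> set e" using h by auto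
    show "ev \<zeta>\<^sub>1 (act (word (map ((!) e) h)) (simple_root (e ! a))) < 0"
      "ev \<zeta>\<^sub>2 (act (word (map ((!) e) h)) (simple_root (e ! a))) < 0"
      "0 < ev (\<lambda>_. 1) (act (word (map ((!) e) h)) (simple_root (e ! a)))"
      using t by (simp_all only: ev[OF z1] ev[OF z2] ev[OF one] trapped_list_def) simp_all
  qed
  then show ?thesis using that p by blast
qed

end

text \<open>
  The functionals were found by a search. In \<open>\<tilde>E\<^sub>6\<close> and \<open>\<tilde>E\<^sub>7\<close> only the branch vertex \<open>0\<close>, in
  \<open>\<tilde>E\<^sub>8\<close> only its neighbour \<open>4\<close> on the long arm is never crossed; the remaining vertices form
  diagrams of type \<open>A\<close> whose Coxeter elements have order dividing \<open>3\<close>, \<open>4\<close> and \<open>5\<close>, respectively.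
\<close>

lemma E6_affine: "affine_list [[1, 3, 5], [0, 2], [1], [0, 4], [3], [0, 6], [5]] [3, 2, 1, 2, 1, 2, 1]"
  by code_simp

lemma E6_trapped:
  "trapped_list [[1, 3, 5], [0, 2], [1], [0, 4], [3], [0, 6], [5]] [3, 2, 1, 2, 1, 2, 1]
    [1, 5, -1, -4, -1, -1, 2] [1, -5, 4, 1, 1, 4, -5] 3 [3, 0, 1, 4, 3, 0, 5] 6"
  by code_simp

lemma E7_affine: "affine_list [[1, 2, 5], [0], [0, 3], [2, 4], [3], [0, 6], [5, 7], [6]] [4, 2, 3, 2, 1, 3, 2, 1]"
  by code_simp

lemma E7_trapped:
  "trapped_list [[1, 2, 5], [0], [0, 3], [2, 4], [3], [0, 6], [5, 7], [6]] [4, 2, 3, 2, 1, 3, 2, 1]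
    [1, -5, 6, -1, -1, -1, -4, 6] [1, 5, -6, 4, 1, 1, 1, -6] 4 [6, 5, 0, 1, 2, 0, 5, 6] 7"
  by code_simp

lemma E8_affine: "affine_list [[1, 2, 4], [0], [0, 3], [2], [0, 5], [4, 6], [5, 7], [6, 8], [7]] [6, 3, 4, 2, 5, 4, 3, 2, 1]"
  by code_simp

lemma E8_trapped:
  "trapped_list [[1, 2, 4], [0], [0, 3], [2], [0, 5], [4, 6], [5, 7], [6, 8], [7]] [6, 3, 4, 2, 5, 4, 3, 2, 1]
    [-1, 2, 6, 1, 2, -7, -7, 6, 7] [5, -6, -6, -1, -4, 7, 7, -1, -7] 5 [1, 4, 0, 2, 3, 5, 4, 0, 1, 2, 0, 4, 5] 6"
  by code_simp

section \<open>Affine tripods and the infinite case\<close>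

context simply_laced_tree_system
begin

lemma path_table:
  "simple_path L \<Longrightarrow> \<forall>i\<in>set [0..<length L]. \<forall>j\<in>set [0..<length L]. adj (L ! i) (L ! j) \<longleftrightarrow> j = Suc i \<or> i = Suc j"
  using adjacent_on_path by simp

lemma diagramI:
  assumes "distinct e" "length e = length nb"
    "\<forall>a\<in>set [0..<length e]. \<forall>b\<in>set [0..<length e]. adj (e ! a) (e ! b) \<longleftrightarrow> b \<in> set (nb ! a)"
  shows "diagram e nb"
  using assms by (simp add: diagram_def)

lemma tripod_paths:
  assumes "tripod v p q r"
  shows "simple_path (rev p @ v # q)" "simple_path (rev p @ v # r)" "simple_path (rev q @ v # r)"
    and "distinct (v # p @ q @ r)"
  using assms by (auto simp: tripod_def joined_def simple_path_def)

text \<open>Vertices are numbered from 0 in the order \<open>v\<close>, \<open>p\<close>,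
  \<open>q\<close>, \<open>r\<close>, each arm outwards. Any two of them lie on one of the three
  paths through \<open>v\<close>, so the path tables determine all adjacencies.\<close>

lemma affine_tripod_not_heavy:
  assumes affine_tripod
  obtains p where "distinct p" "set p = UNIV" "\<not> heavy_for p"
proof -
  obtain v p q r where t: "tripod v p q r"
    and len: "(length p, length q, length r) \<in> {(2, 2, 2), (1, 3, 3), (1, 2, 5)}"
    using assms unfolding affine_tripod_def by blast
  note tables = tripod_paths(1-3)[OF t, THEN path_table]
  note dist = tripod_paths(4)[OF t]
  from len consider "length p = 2" "length q = 2" "length r = 2" | "length p = 1" "length q = 3" "length r = 3"
    | "length p = 1" "length q = 2" "length r = 5" by auto
  then show ?thesis
  proof cases
    case 1
    then obtain p1 p2 q1 q2 r1 r2 where e: "p = [p1, p2]" "q = [q1, q2]" "r = [r1, r2]"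
      by (auto simp: numeral_eq_Suc length_Suc_conv)
    have "diagram (v # p @ q @ r) [[1, 3, 5], [0, 2], [1], [0, 4], [3], [0, 6], [5]]"
      using dist tables unfolding e by (intro diagramI) (simp_all add: upt_rec)
    then show ?thesis using diagram_not_heavy[OF _ E6_affine E6_trapped] that by blast
  next
    case 2
    then obtain p1 q1 q2 q3 r1 r2 r3 where e: "p = [p1]" "q = [q1, q2, q3]" "r = [r1, r2, r3]"
      by (auto simp: numeral_eq_Suc length_Suc_conv)
    have "diagram (v # p @ q @ r) [[1, 2, 5], [0], [0, 3], [2, 4], [3], [0, 6], [5, 7], [6]]"
      using dist tables unfolding e by (intro diagramI) (simp_all add: upt_rec)
    then show ?thesis using diagram_not_heavy[OF _ E7_affine E7_trapped] that by blast
  next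
    case 3
    then obtain p1 q1 q2 r1 r2 r3 r4 r5 where e: "p = [p1]" "q = [q1, q2]" "r = [r1, r2, r3, r4, r5]"
      by (auto simp: numeral_eq_Suc length_Suc_conv)
    have "diagram (v # p @ q @ r) [[1, 2, 4], [0], [0, 3], [2], [0, 5], [4, 6], [5, 7], [6, 8], [7]]"
      using dist tables unfolding e by (intro diagramI) (simp_all add: upt_rec)
    then show ?thesis using diagram_not_heavy[OF _ E8_affine E8_trapped] that by blast
  qed
qed

theorem infinite_ancient:
  assumes "infinite (carrier W)"
  shows ancient
proof -
  from affine_subdiagram_or_superharmonic
  consider P a b c d where "double_fork P a b c d" | affine_tripod
    using finite_if_superharmonic assms by blast
  then obtain p where "distinct p" "set p = UNIV" "\<not> heavy_for p"
  proof cases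
    case 1
    then show ?thesis using double_fork_not_heavy that by blast
  next
    case 2
    then show ?thesis using affine_tripod_not_heavy that by blast
  qed
  then show ?thesis by (rule ancientI)
qed

end

theorem corollary1p21:
  fixes W :: "('w, 'b) monoid_scheme" and s :: "'i::finite \<Rightarrow> 'w"
  assumes "coxeter_system W s"
    and "is_tree (coxeter_system.adj W s)"
    and "coxeter_system.simply_laced W s"
  shows "(finite (carrier W) \<longrightarrow> coxeter_system.futuristic W s) \<and>
         (infinite (carrier W) \<longrightarrow> coxeter_system.ancient W s)"
proof -
  interpret simply_laced_tree_system W s
    using assms by (intro simply_laced_tree_system.intro simply_laced_system.intro
        simply_laced_system_axioms.intro simply_laced_tree_system_axioms.intro)
  show ?thesis using finite_futuristic infinite_ancient by blast
qed

end
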